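(* The space $U$ with a universal unconditional basis has two continua of renormings (i.e. two families, each of cardinality $\mathfrak{c}$, of equivalent norms) whose isometry groups are pairwise non-conjugate in the isomorphism group of $U$, such that the renormings of the first continuum are maximal, and for the renormings of the second continuum no isometry group is contained in any maximal bounded subgroup of $\mathrm{GL}(U)$.
   Context: $U$ is Pełczyński's space: the (unique up to isomorphism) Banach space with a normalized unconditional basis $(u_i)$ such that every normalized unconditional basic sequence (in any Banach space) is equivalent to a subsequence of $(u_i)$. The isometry group $\operatorname{Isom}(X,\|\cdot\|)$ is the group of surjective linear isometries of $(X,\|\cdot\|)$. A renorming $(X,\|\cdot\|)$ is maximal if whenever $|||\cdot|||$ is an equivalent norm on $X$ with $\operatorname{Isom}(X,\|\cdot\|)\subseteq\operatorname{Isom}(X,|||\cdot|||)$, then the two groups are equal. $\mathrm{GL}(X)$ is the group of all isomorphisms of $X$ onto $X$; a subgroup $G$ is bounded if $\sup_{g\in G}\|g\|<\infty$, and a maximal bounded subgroup is a bounded subgroup not properly contained in any other bounded subgroup. Subgroups $G_1,G_2$ of $\mathrm{GL}(X)$ are conjugate if $G_1=T^{-1}G_2T$ for some $T\in\mathrm{GL}(X)$. *)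

theory Defs
  imports
    "HOL-Analysis.Analysis"
    "HOL-Algebra.Group"
    "HOL-Library.Equipollence"
begin

section \<open>Unconditional bases and the universal basis property\<close>

definition schauder_basis_on :: "'a::real_normed_vector set \<Rightarrow> (nat \<Rightarrow> 'a) \<Rightarrow> bool" where
  "schauder_basis_on V x \<longleftrightarrow>
     range x \<subseteq> V \<and> (\<forall>v\<in>V. \<exists>!a::nat \<Rightarrow> real. (\<lambda>i. a i *\<^sub>R x i) sums v)"

text \<open>\<open>summable_on\<close> is convergence of the net of finite partial sums, that is,
  unconditional convergence of the series.\<close>

definition unconditional_basis_on :: "'a::real_normed_vector set \<Rightarrow> (nat \<Rightarrow> 'a) \<Rightarrow> bool" where
  "unconditional_basis_on V x \<longleftrightarrow>
     schauder_basis_on V x \<and>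
     (\<forall>v\<in>V. \<forall>a::nat \<Rightarrow> real.
        (\<lambda>i. a i *\<^sub>R x i) sums v \<longrightarrow> (\<lambda>i. a i *\<^sub>R x i) summable_on UNIV)"

definition normalized_unconditional_basis :: "(nat \<Rightarrow> 'a::banach) \<Rightarrow> bool" where
  "normalized_unconditional_basis x \<longleftrightarrow>
     unconditional_basis_on UNIV x \<and> (\<forall>i. norm (x i) = 1)"

definition normalized_unconditional_basic_sequence :: "(nat \<Rightarrow> 'a::real_normed_vector) \<Rightarrow> bool" where
  "normalized_unconditional_basic_sequence x \<longleftrightarrow>
     unconditional_basis_on (closure (span (range x))) x \<and> (\<forall>i. norm (x i) = 1)"

definition equivalent_sequences ::
    "(nat \<Rightarrow> 'a::real_normed_vector) \<Rightarrow> (nat \<Rightarrow> 'b::real_normed_vector) \<Rightarrow> bool" where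
  "equivalent_sequences x y \<longleftrightarrow>
     (\<forall>a::nat \<Rightarrow> real. summable (\<lambda>i. a i *\<^sub>R x i) \<longleftrightarrow> summable (\<lambda>i. a i *\<^sub>R y i))"

text \<open>HOL cannot quantify over all Banach spaces (all types of class \<open>banach\<close>) inside a formula.
  The definition quantifies over basic sequences in \<open>\<ell>\<^sub>\<infinity>\<close>, the type \<open>nat \<Rightarrow>\<^sub>C real\<close> of bounded
  functions with the supremum norm, which contains every separable Banach space isometrically.
  (\<open>\<ell>\<^sub>\<infinity>\<close> is complete, but the library has the corresponding instance only for metric domains, hence
  the sort \<open>real_normed_vector\<close> above.) The theorem \<open>universal_unconditional_basisD\<close> below
  derives the property for an arbitrary Banach space.\<close>

definition universal_unconditional_basis :: "(nat \<Rightarrow> 'a::banach) \<Rightarrow> bool" where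
  "universal_unconditional_basis u \<longleftrightarrow>
     normalized_unconditional_basis u \<and>
     (\<forall>x :: nat \<Rightarrow> (nat \<Rightarrow>\<^sub>C real). normalized_unconditional_basic_sequence x \<longrightarrow>
        (\<exists>s. strict_mono s \<and> equivalent_sequences x (u \<circ> s)))"


section \<open>Renormings, isometry groups and bounded subgroups\<close>

definition is_norm :: "('a::real_vector \<Rightarrow> real) \<Rightarrow> bool" where
  "is_norm N \<longleftrightarrow>
     (\<forall>x. 0 \<le> N x) \<and> (\<forall>x. N x = 0 \<longleftrightarrow> x = 0) \<and>
     (\<forall>c x. N (c *\<^sub>R x) = \<bar>c\<bar> * N x) \<and> (\<forall>x y. N (x + y) \<le> N x + N y)"

definition equivalent_norm :: "('a::real_normed_vector \<Rightarrow> real) \<Rightarrow> bool" where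
  "equivalent_norm N \<longleftrightarrow>
     is_norm N \<and> (\<exists>c>0. \<exists>C>0. \<forall>x. c * norm x \<le> N x \<and> N x \<le> C * norm x)"

definition Isom :: "('a::real_vector \<Rightarrow> real) \<Rightarrow> ('a \<Rightarrow> 'a) set" where
  "Isom N = {T. linear T \<and> surj T \<and> (\<forall>x. N (T x) = N x)}"

definition maximal_renorming :: "('a::real_normed_vector \<Rightarrow> real) \<Rightarrow> bool" where
  "maximal_renorming N \<longleftrightarrow>
     equivalent_norm N \<and>
     (\<forall>M. equivalent_norm M \<longrightarrow> Isom N \<subseteq> Isom M \<longrightarrow> Isom N = Isom M)"

definition GL :: "('a::real_normed_vector \<Rightarrow> 'a) monoid" where
  "GL = \<lparr>carrier = {T. bounded_linear T \<and> bij T \<and> bounded_linear (inv_into UNIV T)},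
         mult = (\<circ>), one = id\<rparr>"

definition bounded_subgroup :: "('a::real_normed_vector \<Rightarrow> 'a) set \<Rightarrow> bool" where
  "bounded_subgroup G \<longleftrightarrow> subgroup G GL \<and> (\<exists>B. \<forall>g\<in>G. onorm g \<le> B)"

definition maximal_bounded_subgroup :: "('a::real_normed_vector \<Rightarrow> 'a) set \<Rightarrow> bool" where
  "maximal_bounded_subgroup G \<longleftrightarrow>
     bounded_subgroup G \<and> (\<forall>H. bounded_subgroup H \<longrightarrow> \<not> G \<subset> H)"

definition conjugate_subgroups ::
    "('a::real_normed_vector \<Rightarrow> 'a) set \<Rightarrow> ('a \<Rightarrow> 'a) set \<Rightarrow> bool" where
  "conjugate_subgroups G H \<longleftrightarrow>
     (\<exists>T\<in>carrier GL. G = (\<lambda>h. inv\<^bsub>GL\<^esub> T \<otimes>\<^bsub>GL\<^esub> h \<otimes>\<^bsub>GL\<^esub> T) ` H)"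

lemma group_GL: "group (GL :: ('a::real_normed_vector \<Rightarrow> 'a) monoid)"
proof (rule groupI)
  fix x y :: "'a \<Rightarrow> 'a" assume x: "x \<in> carrier GL" and y: "y \<in> carrier GL"
  have "inv_into UNIV (x \<circ> y) = inv_into UNIV y \<circ> inv_into UNIV x"
    using x y by (intro o_inv_distrib) (auto simp: GL_def)
  then show "x \<otimes>\<^bsub>GL\<^esub> y \<in> carrier GL"
    using x y by (auto simp: GL_def comp_def intro: bounded_linear_compose bij_comp[unfolded comp_def])
next
  show "\<one>\<^bsub>GL\<^esub> \<in> carrier (GL :: ('a \<Rightarrow> 'a) monoid)"
    by (simp add: GL_def id_def[symmetric] inv_id[unfolded id_def] )
       (simp add: id_def)
next
  fix x :: "'a \<Rightarrow> 'a" assume x: "x \<in> carrier GL"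
  then have "inv_into UNIV x \<in> carrier GL" "inv_into UNIV x \<otimes>\<^bsub>GL\<^esub> x = \<one>\<^bsub>GL\<^esub>"
    by (auto simp: GL_def bij_imp_bij_inv inv_inv_eq bij_is_inj)
  then show "\<exists>y\<in>carrier GL. y \<otimes>\<^bsub>GL\<^esub> x = \<one>\<^bsub>GL\<^esub>" by blast
qed (auto simp: GL_def)

lemma m_inv_GL: "T \<in> carrier GL \<Longrightarrow> inv\<^bsub>GL\<^esub> T = inv_into UNIV T"
  by (rule group.inv_equality[OF group_GL])
     (auto simp: GL_def bij_imp_bij_inv inv_inv_eq bij_is_inj)

lemma bounded_subgroup_Isom:
  fixes N :: "'a::real_normed_vector \<Rightarrow> real"
  assumes N: "equivalent_norm N"
  shows "bounded_subgroup (Isom N)"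
proof -
  from N obtain c C where c: "c > 0" "C > 0" "\<And>x. c * norm x \<le> N x" "\<And>x. N x \<le> C * norm x"
    and n: "is_norm N" unfolding equivalent_norm_def by blast
  have bd: "norm (T x) \<le> norm x * (C / c)" if "T \<in> Isom N" for T x
  proof -
    have "c * norm (T x) \<le> C * norm x"
      using c(3)[of "T x"] c(4)[of x] that by (simp add: Isom_def)
    then show ?thesis using c(1) by (simp add: field_simps)
  qed
  have bl: "bounded_linear T" if "T \<in> Isom N" for T
    using bd[OF that] that unfolding bounded_linear_def bounded_linear_axioms_def Isom_def by blast
  have bij: "bij T" if T: "T \<in> Isom N" for T
  proof -
    have "x = y" if "T x = T y" for x y
    proof -
      have "T (x - y) = 0" using T that by (simp add: Isom_def linear_diff)
      moreover have "N (T (x - y)) = N (x - y)" using T by (simp add: Isom_def)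
      ultimately have "x - y = 0" using n unfolding is_norm_def by metis
      then show ?thesis by simp
    qed
    then show ?thesis using T by (auto simp: bij_def inj_def Isom_def)
  qed
  have inv: "inv_into UNIV T \<in> Isom N" if T: "T \<in> Isom N" for T
  proof -
    have b: "bij T" using bij[OF T] .
    have lin: "linear T" and NT: "\<And>x. N (T x) = N x" using T by (auto simp: Isom_def)
    have TT: "T (inv_into UNIV T x) = x" for x using b by (simp add: bij_is_surj surj_f_inv_f)
    have eq: "inv_into UNIV T x = y" if "T y = x" for x y
      using that b by (simp add: bij_is_inj inv_f_eq)
    have "linear (inv_into UNIV T)"
      by (intro linearI eq) (simp_all add: linear_add[OF lin] linear_cmul[OF lin] TT)
    moreover have "N (inv_into UNIV T x) = N x" for x
      using NT[of "inv_into UNIV T x"] by (simp add: TT)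
    ultimately show ?thesis using b by (auto simp: Isom_def bij_is_surj bij_imp_bij_inv)
  qed
  have sub: "Isom N \<subseteq> carrier GL" using bl bij inv by (auto simp: GL_def)
  have "subgroup (Isom N) GL"
  proof
    show "Isom N \<subseteq> carrier GL" by (rule sub)
    show "x \<otimes>\<^bsub>GL\<^esub> y \<in> Isom N" if "x \<in> Isom N" "y \<in> Isom N" for x y
    proof -
      have "linear (x \<circ> y)" "surj (x \<circ> y)"
        using that by (simp_all add: Isom_def linear_compose comp_surj del: comp_apply)
      then show ?thesis using that by (simp add: GL_def Isom_def)
    qed
    show "\<one>\<^bsub>GL\<^esub> \<in> Isom N" by (auto simp: GL_def Isom_def linear_iff)
    show "inv\<^bsub>GL\<^esub> x \<in> Isom N" if "x \<in> Isom N" for x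
      using that inv sub by (simp add: m_inv_GL subset_iff)
  qed
  moreover have "onorm T \<le> C / c" if "T \<in> Isom N" for T
    using bd[OF that] c by (intro onorm_bound) (auto simp: mult.commute)
  ultimately show ?thesis unfolding bounded_subgroup_def by blast
qed


section \<open>The universal property for an arbitrary Banach space\<close>

text \<open>The functional in the Hahn-Banach theorem is obtained as a minimal sublinear function.\<close>

definition sublinear :: "('a::real_vector \<Rightarrow> real) \<Rightarrow> bool" where
  "sublinear p \<longleftrightarrow> p 0 = 0 \<and> (\<forall>x y. p (x + y) \<le> p x + p y) \<and> (\<forall>c>0. \<forall>x. p (c *\<^sub>R x) \<le> c * p x)"

lemma sublinear_scaleR:
  assumes "sublinear p" "0 \<le> c"
  shows "p (c *\<^sub>R x) = c * p x"
proof (cases "c = 0")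
  case True then show ?thesis using assms by (simp add: sublinear_def)
next
  case False
  then have c: "c > 0" using assms by simp
  have "p ((1 / c) *\<^sub>R (c *\<^sub>R x)) \<le> (1 / c) * p (c *\<^sub>R x)"
    using assms c unfolding sublinear_def by (metis divide_pos_pos zero_less_one)
  then have "c * p x \<le> p (c *\<^sub>R x)" using c by (simp add: field_simps)
  moreover have "p (c *\<^sub>R x) \<le> c * p x" using assms c by (simp add: sublinear_def)
  ultimately show ?thesis by simp
qed

lemma sublinear_minus: "sublinear p \<Longrightarrow> - p (- x) \<le> p x"
proof -
  assume p: "sublinear p"
  have "p (x + - x) \<le> p x + p (- x)" using p unfolding sublinear_def by blast
  moreover have "p 0 = 0" using p by (simp add: sublinear_def)
  ultimately show ?thesis by simp
qed

lemma sublinear_reduce: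
  fixes p :: "'a::real_vector \<Rightarrow> real"
  assumes p: "sublinear p"
  obtains q where "sublinear q" "\<And>x. q x \<le> p x" "\<And>x. q x \<le> p (x + y) - p y"
proof
  define F where "F = (\<lambda>x t. p (x + t *\<^sub>R y) - t * p y)"
  define q where "q = (\<lambda>x. INF t\<in>{0..}. F x t)"
  have add: "p (x + y) \<le> p x + p y" for x y using p by (simp add: sublinear_def)
  have hom: "0 \<le> c \<Longrightarrow> p (c *\<^sub>R x) = c * p x" for c x by (rule sublinear_scaleR[OF p])
  have low: "- p (- x) \<le> F x t" if "0 \<le> t" for x t
    using add[of "x + t *\<^sub>R y" "- x"] hom[OF that, of y] by (simp add: F_def)
  have bdd: "bdd_below (F x ` {0..})" for x
    using low by (intro bdd_belowI2[where m = "- p (- x)"]) auto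
  have qle: "q x \<le> F x t" if "0 \<le> t" for x t
    unfolding q_def using bdd that by (intro cINF_lower) auto
  have qge: "z \<le> q x" if "\<And>t. 0 \<le> t \<Longrightarrow> z \<le> F x t" for x z
    unfolding q_def using that by (intro cINF_greatest) auto
  show "sublinear q"
    unfolding sublinear_def
  proof (intro conjI allI impI)
    have "F 0 t = 0" if "0 \<le> t" for t using hom[OF that] by (simp add: F_def)
    then show "q 0 = 0" using qle[of 0 0] qge[of 0 0] by force
  next
    fix x x'
    have "q (x + x') - F x s \<le> F x' t" if "0 \<le> s" "0 \<le> t" for s t
    proof -
      have "q (x + x') \<le> F (x + x') (s + t)" using that by (intro qle) auto
      also have "\<dots> \<le> F x s + F x' t"
        using add[of "x + s *\<^sub>R y" "x' + t *\<^sub>R y"] by (simp add: F_def algebra_simps)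
      finally show ?thesis by simp
    qed
    then have "q (x + x') - F x s \<le> q x'" if "0 \<le> s" for s using that by (intro qge) auto
    then have "q (x + x') - q x' \<le> F x s" if "0 \<le> s" for s using that by force
    then have "q (x + x') - q x' \<le> q x" by (intro qge) auto
    then show "q (x + x') \<le> q x + q x'" by simp
  next
    fix c :: real and x assume c: "0 < c"
    have "q (c *\<^sub>R x) / c \<le> F x t" if "0 \<le> t" for t
    proof -
      have "q (c *\<^sub>R x) \<le> F (c *\<^sub>R x) (c * t)" using c that by (intro qle) auto
      also have "\<dots> = c * F x t"
        using hom[of c "x + t *\<^sub>R y"] c by (simp add: F_def algebra_simps)
      finally show ?thesis using c by (simp add: field_simps)
    qed
    then have "q (c *\<^sub>R x) / c \<le> q x" by (intro qge) auto
    then show "q (c *\<^sub>R x) \<le> c * q x" using c by (simp add: field_simps)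
  qed
  show "q x \<le> p x" for x using qle[of 0 x] by (simp add: F_def)
  show "q x \<le> p (x + y) - p y" for x using qle[of 1 x] by (simp add: F_def)
qed

lemma sublinear_dominates_linear:
  fixes p :: "'a::real_vector \<Rightarrow> real"
  assumes p: "sublinear p"
  obtains f where "linear f" "\<And>x. f x \<le> p x"
proof -
  define A where "A = {q. sublinear q \<and> (\<forall>x. q x \<le> p x)}"
  define P where "P = (\<lambda>q r :: 'a \<Rightarrow> real. \<forall>x. r x \<le> q x)"
  have "\<exists>m\<in>A. \<forall>a\<in>A. P m a \<longrightarrow> a = m"
  proof (rule predicate_Zorn)
    show "partial_order_on A (relation_of P A)"
      by (rule partial_order_on_relation_ofI) (auto simp: P_def fun_eq_iff intro: order_trans antisym)
  next
    fix C assume C: "C \<in> Chains (relation_of P A)"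
    have CA: "C \<subseteq> A" and tot: "\<And>q r. q \<in> C \<Longrightarrow> r \<in> C \<Longrightarrow> P q r \<or> P r q"
      using C by (auto simp: Chains_def relation_of_def)
    show "\<exists>u\<in>A. \<forall>a\<in>C. P a u"
    proof (cases "C = {}")
      case True
      then show ?thesis using p by (auto simp: A_def)
    next
      case False
      define u where "u = (\<lambda>x. INF q\<in>C. q x)"
      have low: "- p (- x) \<le> q x" if "q \<in> C" for q x
      proof -
        have "sublinear q" "q (- x) \<le> p (- x)" using that CA by (auto simp: A_def)
        then show ?thesis using sublinear_minus[of q x] by linarith
      qed
      have bdd: "bdd_below ((\<lambda>q. q x) ` C)" for x
        using low by (intro bdd_belowI2[where m = "- p (- x)"]) auto
      have ule: "u x \<le> q x" if "q \<in> C" for q x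
        unfolding u_def using bdd that by (intro cINF_lower) auto
      have uge: "z \<le> u x" if "\<And>q. q \<in> C \<Longrightarrow> z \<le> q x" for x z
        unfolding u_def using that False by (intro cINF_greatest) auto
      have sub: "sublinear q" if "q \<in> C" for q using that CA by (auto simp: A_def)
      have "sublinear u"
        unfolding sublinear_def
      proof (intro conjI allI impI)
        show "u 0 = 0" 
        proof -
          have "\<And>q. q \<in> C \<Longrightarrow> q 0 = 0" using sub by (simp add: sublinear_def)
          then have "u 0 = (INF q\<in>C. 0)" unfolding u_def by (intro INF_cong) auto
          then show ?thesis using False by simp
        qed
      next
        fix x y
        have "u (x + y) - q x \<le> r y" if q: "q \<in> C" and r: "r \<in> C" for q r
        proof -
          obtain s where s: "s \<in> C" "s x \<le> q x" "s y \<le> r y"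
            using tot[OF q r] q r by (auto simp: P_def)
          have "s (x + y) \<le> s x + s y" using sub[OF s(1)] by (simp add: sublinear_def)
          then show ?thesis using ule[OF s(1), of "x + y"] s by linarith
        qed
        then have "u (x + y) - q x \<le> u y" if "q \<in> C" for q using that by (intro uge) auto
        then have "u (x + y) - u y \<le> q x" if "q \<in> C" for q using that by force
        then have "u (x + y) - u y \<le> u x" by (intro uge) auto
        then show "u (x + y) \<le> u x + u y" by simp
      next
        fix c :: real and x assume c: "0 < c"
        have "u (c *\<^sub>R x) / c \<le> q x" if "q \<in> C" for q
        proof -
          have "u (c *\<^sub>R x) \<le> q (c *\<^sub>R x)" by (rule ule[OF that])
          also have "\<dots> = c * q x" using sublinear_scaleR[OF sub[OF that]] c by simp
          finally show ?thesis using c by (simp add: field_simps)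
        qed
        then have "u (c *\<^sub>R x) / c \<le> u x" by (intro uge) auto
        then show "u (c *\<^sub>R x) \<le> c * u x" using c by (simp add: field_simps)
      qed
      moreover have "u x \<le> p x" for x
      proof -
        obtain q where q: "q \<in> C" using False by blast
        then have "q x \<le> p x" using CA by (auto simp: A_def)
        then show ?thesis using ule[OF q, of x] by linarith
      qed
      ultimately show ?thesis using ule by (auto simp: A_def P_def)
    qed
  qed
  then obtain m where m: "sublinear m" "\<And>x. m x \<le> p x"
    and min: "\<And>q. sublinear q \<Longrightarrow> (\<And>x. q x \<le> m x) \<Longrightarrow> q = m"
  proof -
    assume *: "\<exists>m\<in>A. \<forall>a\<in>A. P m a \<longrightarrow> a = m"
      and thesis: "\<And>m. sublinear m \<Longrightarrow> (\<And>x. m x \<le> p x) \<Longrightarrow>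
        (\<And>q. sublinear q \<Longrightarrow> (\<And>x. q x \<le> m x) \<Longrightarrow> q = m) \<Longrightarrow> thesis"
    from * obtain m where m: "m \<in> A" "\<And>q. q \<in> A \<Longrightarrow> P m q \<Longrightarrow> q = m" by blast
    show thesis
    proof (rule thesis)
      show "sublinear m" "m x \<le> p x" for x using m(1) by (auto simp: A_def)
      show "q = m" if "sublinear q" "\<And>x. q x \<le> m x" for q
      proof (rule m(2))
        have "q x \<le> p x" for x using that(2)[of x] m(1) by (auto simp: A_def intro: order_trans)
        then show "q \<in> A" using that by (simp add: A_def)
        show "P m q" using that by (simp add: P_def)
      qed
    qed
  qed
  have add: "m (x + y) = m x + m y" for x y
  proof -
    obtain q where "sublinear q" "\<And>x. q x \<le> m x" "\<And>x. q x \<le> m (x + y) - m y"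
      using sublinear_reduce[OF m(1), of y] by blast
    with min[of q] have "m x \<le> m (x + y) - m y" by auto
    moreover have "m (x + y) \<le> m x + m y" using m by (simp add: sublinear_def)
    ultimately show ?thesis by simp
  qed
  have neg: "m (- x) = - m x" for x
    using add[of x "- x"] m(1) by (simp add: sublinear_def)
  have "m (c *\<^sub>R x) = c * m x" for c x
  proof (cases "0 \<le> c")
    case True then show ?thesis by (rule sublinear_scaleR[OF m(1)])
  next
    case False
    then show ?thesis
      using sublinear_scaleR[OF m(1), of "- c" x] neg[of "c *\<^sub>R x"] by simp
  qed
  then have "linear m" using add by (intro linearI) auto
  then show ?thesis using m that by blast
qed

lemma norming_functional:
  fixes v :: "'a::real_normed_vector"
  obtains f :: "'a \<Rightarrow> real" where "linear f" "\<And>x. \<bar>f x\<bar> \<le> norm x" "f v = norm v"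
proof -
  have "sublinear (norm :: 'a \<Rightarrow> real)"
    by (auto simp: sublinear_def intro: norm_triangle_ineq)
  then obtain q where q: "sublinear q" "\<And>x. q x \<le> norm x" "\<And>x. q x \<le> norm (x + v) - norm v"
    using sublinear_reduce by blast
  obtain f where f: "linear f" "\<And>x. f x \<le> q x"
    using sublinear_dominates_linear[OF q(1)] by blast
  have neg: "f (- x) = - f x" for x by (rule linear_neg[OF f(1)])
  have le: "f x \<le> norm x" for x using f(2)[of x] q(2)[of x] by linarith
  have "\<bar>f x\<bar> \<le> norm x" for x using le[of x] le[of "- x"] neg[of x] by simp
  moreover have "f v = norm v"
    using f(2)[of "- v"] q(3)[of "- v"] neg[of v] le[of v] by simp
  ultimately show ?thesis using that f(1) by blast
qed

lemma closure_span_range_approx: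
  fixes x :: "nat \<Rightarrow> 'a::real_normed_vector"
  obtains d :: "nat \<Rightarrow> 'a"
  where "\<And>v e. v \<in> closure (span (range x)) \<Longrightarrow> 0 < e \<Longrightarrow> \<exists>n. norm (v - d n) < e"
proof -
  define g :: "(rat \<times> nat) list \<Rightarrow> 'a" where
    "g l = (\<Sum>(r, i)\<leftarrow>l. of_rat r *\<^sub>R x i)" for l
  define d where "d = (\<lambda>n. g (from_nat n))"
  have sp: "\<exists>l. norm (v - g l) < e" if "v \<in> span (range x)" "0 < e" for v e
    using that
  proof (induction arbitrary: e rule: span_induct_alt)
    case base
    then show ?case by (intro exI[of _ "[]"]) (simp add: g_def)
  next
    case (step c w y)
    then obtain i where i: "w = x i" by auto
    obtain l where l: "norm (y - g l) < e / 2" using step.IH[of "e / 2"] step.prems by auto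
    define K where "K = norm w + 1"
    have K: "K > 0" "norm w \<le> K" by (auto simp: K_def add_nonneg_pos)
    obtain r where r: "c < of_rat r" "of_rat r < c + e / (2 * K)"
      using of_rat_dense[of c "c + e / (2 * K)"] K step.prems by auto
    have "norm ((c - of_rat r) *\<^sub>R w) \<le> (e / (2 * K)) * K"
      unfolding norm_scaleR using r K by (intro mult_mono) auto
    then have 1: "norm ((c - of_rat r) *\<^sub>R w) \<le> e / 2" using K by simp
    have 2: "c *\<^sub>R w + y - g ((r, i) # l) = (c - of_rat r) *\<^sub>R w + (y - g l)"
      by (simp add: g_def i algebra_simps)
    have "norm (c *\<^sub>R w + y - g ((r, i) # l)) < e"
      unfolding 2 using 1 l norm_triangle_ineq[of "(c - of_rat r) *\<^sub>R w" "y - g l"] by linarith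
    then show ?case by blast
  qed
  show ?thesis
  proof
    fix v e assume "v \<in> closure (span (range x))" "0 < (e::real)"
    then obtain w where w: "w \<in> span (range x)" "dist w v < e / 2"
      using closure_approachable[of v "span (range x)"] by (auto dest: spec[of _ "e / 2"])
    obtain l where l: "norm (w - g l) < e / 2" using sp[OF w(1), of "e / 2"] \<open>0 < e\<close> by auto
    have "norm (v - g l) < e"
      using w(2) l norm_triangle_ineq[of "v - w" "w - g l"] by (simp add: dist_norm norm_minus_commute)
    then show "\<exists>n. norm (v - d n) < e"
      by (metis d_def from_nat_to_nat)
  qed
qed

lemma isometric_embedding_linf:
  fixes x :: "nat \<Rightarrow> 'a::real_normed_vector"
  obtains T :: "'a \<Rightarrow> (nat \<Rightarrow>\<^sub>C real)"
  where "bounded_linear T" "\<And>v. v \<in> closure (span (range x)) \<Longrightarrow> norm (T v) = norm v"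
proof -
  obtain d :: "nat \<Rightarrow> 'a" where
    d: "\<And>v e. v \<in> closure (span (range x)) \<Longrightarrow> 0 < e \<Longrightarrow> \<exists>n. norm (v - d n) < e"
    using closure_span_range_approx[of x] by blast
  have "\<forall>n. \<exists>f. linear f \<and> (\<forall>x. \<bar>f x\<bar> \<le> norm x) \<and> f (d n) = norm (d n)"
    using norming_functional by metis
  then obtain f where f: "\<And>n. linear (f n)" "\<And>n x. \<bar>f n x\<bar> \<le> norm x" "\<And>n. f n (d n) = norm (d n)"
    by metis
  define T :: "'a \<Rightarrow> (nat \<Rightarrow>\<^sub>C real)" where "T = (\<lambda>v. Bcontfun (\<lambda>n. f n v))"
  have T: "apply_bcontfun (T v) n = f n v" for v n
  proof -
    have "(\<lambda>n. f n v) \<in> bcontfun"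
      using f(2)[of _ v] by (intro bcontfun_normI[where b = "norm v"]) (auto intro: continuous_on_discrete)
    then show ?thesis by (simp add: T_def Bcontfun_inverse)
  qed
  have le: "norm (T v) \<le> norm v" for v
    using f(2) by (intro norm_bound) (simp add: T)
  have bl: "bounded_linear T"
    using le by (intro bounded_linear_intro[where K = 1])
      (auto intro!: bcontfun_eqI simp: T linear_add[OF f(1)] linear_cmul[OF f(1)])
  have "norm v \<le> norm (T v)" if v: "v \<in> closure (span (range x))" for v
  proof (rule field_le_epsilon)
    fix e :: real assume "0 < e"
    then obtain n where n: "norm (v - d n) < e / 2" using d[OF v, of "e / 2"] by auto
    have "f n (d n) - f n v = f n (d n - v)" by (rule linear_diff[OF f(1), symmetric])
    also have "\<dots> \<le> norm (v - d n)" using f(2)[of n "d n - v"] by (simp add: norm_minus_commute)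
    finally have "norm (d n) - e / 2 \<le> f n v" using n f(3)[of n] by linarith
    moreover have "f n v \<le> norm (T v)" using norm_bounded[of "T v" n] by (simp add: T)
    moreover have "norm v \<le> norm (d n) + norm (v - d n)"
      by (metis add.commute diff_add_cancel norm_triangle_ineq)
    ultimately show "norm v \<le> norm (T v) + e" using n by linarith
  qed
  then show ?thesis using that[OF bl] le by (simp add: order_antisym)
qed

lemma closure_subspace:
  fixes S :: "'a::real_normed_vector set"
  assumes S: "subspace S"
  shows "subspace (closure S)"
proof (rule subspaceI)
  show "0 \<in> closure S" using subspace_0[OF S] closure_subset by blast
next
  fix x y assume "x \<in> closure S" "y \<in> closure S"
  then obtain f g where "\<forall>n. f n \<in> S" "f \<longlonglongrightarrow> x" "\<forall>n. g n \<in> S" "g \<longlonglongrightarrow> y"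
    unfolding closure_sequential by blast
  then show "x + y \<in> closure S"
    unfolding closure_sequential using subspace_add[OF S]
    by (intro exI[of _ "\<lambda>n. f n + g n"]) (auto intro: tendsto_add)
next
  fix c x assume "x \<in> closure S"
  then obtain f where "\<forall>n. f n \<in> S" "f \<longlonglongrightarrow> x" unfolding closure_sequential by blast
  then show "c *\<^sub>R x \<in> closure S"
    unfolding closure_sequential using subspace_scale[OF S] 
    by (intro exI[of _ "\<lambda>n. c *\<^sub>R f n"]) (auto intro: tendsto_scaleR)
qed

theorem universal_unconditional_basisD:
  fixes u :: "nat \<Rightarrow> 'a::banach" and x :: "nat \<Rightarrow> 'b::banach"
  assumes u: "universal_unconditional_basis u"
    and x: "normalized_unconditional_basic_sequence x"
  obtains s where "strict_mono s" "equivalent_sequences x (u \<circ> s)"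
proof -
  define V where "V = closure (span (range x))"
  obtain T :: "'b \<Rightarrow> (nat \<Rightarrow>\<^sub>C real)" where T: "bounded_linear T"
    and iso: "\<And>v. v \<in> V \<Longrightarrow> norm (T v) = norm v"
    by (rule isometric_embedding_linf[of x, folded V_def]) (rule that)
  interpret T: bounded_linear T by (rule T)
  have subV: "subspace V" unfolding V_def by (intro closure_subspace subspace_span)
  have xV: "x i \<in> V" for i
    unfolding V_def by (intro subsetD[OF closure_subset] span_base rangeI)
  have sumV: "(\<Sum>i\<in>I. a i *\<^sub>R x i) \<in> V" for a I
    using subV xV by (intro subspace_sum subspace_scale) auto
  have Tsum: "T (\<Sum>i\<in>I. a i *\<^sub>R x i) = (\<Sum>i\<in>I. a i *\<^sub>R T (x i))" for a I
    by (simp add: T.sum T.scaleR)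
  have Cauchy_iff: "Cauchy (T \<circ> z) \<longleftrightarrow> Cauchy z" if "\<And>n::nat. z n \<in> V" for z
  proof -
    have "norm (T (z m) - T (z n)) = norm (z m - z n)" for m n
      using iso[of "z m - z n"] that subV by (simp add: T.diff subspace_diff)
    then show ?thesis by (simp add: Cauchy_def dist_norm)
  qed
  have eq: "equivalent_sequences x (T \<circ> x)"
    unfolding equivalent_sequences_def
  proof
    fix a :: "nat \<Rightarrow> real"
    have C: "Cauchy (T \<circ> (\<lambda>n. \<Sum>i<n. a i *\<^sub>R x i)) \<longleftrightarrow> Cauchy (\<lambda>n. \<Sum>i<n. a i *\<^sub>R x i)"
      using sumV by (intro Cauchy_iff)
    show "summable (\<lambda>i. a i *\<^sub>R x i) \<longleftrightarrow> summable (\<lambda>i. a i *\<^sub>R (T \<circ> x) i)"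
    proof
      assume "summable (\<lambda>i. a i *\<^sub>R x i)"
      then show "summable (\<lambda>i. a i *\<^sub>R (T \<circ> x) i)"
        using T.summable[of "\<lambda>i. a i *\<^sub>R x i"] by (simp add: T.scaleR)
    next
      assume "summable (\<lambda>i. a i *\<^sub>R (T \<circ> x) i)"
      then have "Cauchy (T \<circ> (\<lambda>n. \<Sum>i<n. a i *\<^sub>R x i))"
        by (simp add: summable_iff_convergent convergent_Cauchy Tsum comp_def)
      then show "summable (\<lambda>i. a i *\<^sub>R x i)"
        using C by (simp add: summable_iff_convergent Cauchy_convergent_iff)
    qed
  qed
  have sums_iff: "(\<lambda>i. a i *\<^sub>R T (x i)) sums T v \<longleftrightarrow> (\<lambda>i. a i *\<^sub>R x i) sums v" if v: "v \<in> V" for a v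
  proof -
    have n: "norm ((\<Sum>i<n. a i *\<^sub>R T (x i)) - T v) = norm ((\<Sum>i<n. a i *\<^sub>R x i) - v)" for n
      using iso[of "(\<Sum>i<n. a i *\<^sub>R x i) - v"] v sumV subV
      by (simp add: T.diff Tsum subspace_diff)
    show ?thesis
      unfolding sums_def tendsto_iff dist_norm n by (rule refl)
  qed
  have "complete (T ` V)"
    unfolding complete_def
  proof (intro allI impI)
    fix w assume w: "(\<forall>n. w n \<in> T ` V) \<and> Cauchy w"
    then have "\<forall>n. \<exists>y. y \<in> V \<and> w n = T y" by blast
    from choice[OF this] obtain z where z: "\<And>n. z n \<in> V" "\<And>n. w n = T (z n)" by blast
    have "T \<circ> z = w" using z(2) by (simp add: fun_eq_iff)
    then have "Cauchy z" using w Cauchy_iff[of z, OF z(1)] by simp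
    then obtain v where v: "z \<longlonglongrightarrow> v" using Cauchy_convergent_iff convergent_def by blast
    then have "v \<in> V" using z(1) unfolding V_def by (intro closed_sequentially[OF closed_closure _ v]) auto
    moreover have "w = (\<lambda>n. T (z n))" using z(2) by (rule ext)
    then have "w \<longlonglongrightarrow> T v" using T.tendsto[OF v] by simp
    ultimately show "\<exists>l\<in>T ` V. w \<longlonglongrightarrow> l" by blast
  qed
  moreover have "span (range (T \<circ> x)) \<subseteq> T ` V"
    using T.linear subV xV by (intro span_minimal linear_subspace_image) auto
  ultimately have clT: "closure (span (range (T \<circ> x))) \<subseteq> T ` V"
    by (intro closure_minimal complete_imp_closed)
  have uniq: "\<exists>!a. (\<lambda>i. a i *\<^sub>R x i) sums v"
    and unc: "(\<lambda>i. a i *\<^sub>R x i) sums v \<Longrightarrow> (\<lambda>i. a i *\<^sub>R x i) summable_on UNIV"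
    if "v \<in> V" for a v
    using x that by (simp_all add: normalized_unconditional_basic_sequence_def
        unconditional_basis_on_def schauder_basis_on_def V_def)
  have "unconditional_basis_on (closure (span (range (T \<circ> x)))) (T \<circ> x)"
    unfolding unconditional_basis_on_def schauder_basis_on_def
  proof (intro conjI ballI allI impI)
    show "range (T \<circ> x) \<subseteq> closure (span (range (T \<circ> x)))"
      using span_superset closure_subset by (rule order_trans)
  next
    fix w assume "w \<in> closure (span (range (T \<circ> x)))"
    then obtain v where v: "v \<in> V" "w = T v" using clT by blast
    show "\<exists>!a. (\<lambda>i. a i *\<^sub>R (T \<circ> x) i) sums w"
      unfolding comp_def v(2) sums_iff[OF v(1)] by (rule uniq[OF v(1)])
  next
    fix w a assume "w \<in> closure (span (range (T \<circ> x)))"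
      and a: "(\<lambda>i. a i *\<^sub>R (T \<circ> x) i) sums w"
    then obtain v where v: "v \<in> V" "w = T v" using clT by blast
    have "(\<lambda>i. a i *\<^sub>R x i) summable_on UNIV"
      using a unfolding comp_def v(2) sums_iff[OF v(1)] by (rule unc[OF v(1)])
    from summable_on_bounded_linear[OF T this]
    show "(\<lambda>i. a i *\<^sub>R (T \<circ> x) i) summable_on UNIV" by (simp add: T.scaleR)
  qed
  moreover have "norm ((T \<circ> x) i) = 1" for i
    using x iso[OF xV] by (simp add: normalized_unconditional_basic_sequence_def)
  ultimately have "normalized_unconditional_basic_sequence (T \<circ> x)"
    by (simp add: normalized_unconditional_basic_sequence_def)
  then obtain s where "strict_mono s" "equivalent_sequences (T \<circ> x) (u \<circ> s)"
    using u unfolding universal_unconditional_basis_def by blast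
  moreover from this eq have "equivalent_sequences x (u \<circ> s)"
    unfolding equivalent_sequences_def by blast
  ultimately show ?thesis using that by blast
qed

end

theory Submission
  imports Defs "HOL-Probability.Discrete_Topology"
begin

text \<open>Distribute a basis over finite blocks and the blocks over classes, and consider the norm that is
  Euclidean on every block, a \<open>c\<^sub>0\<close>-sum of blocks inside a class, and the given norm of \<open>U\<close> across the
  classes. The resulting unconditional basis contains \<open>u\<close> as a subsequence, and by universality it is
  itself equivalent to a subsequence of \<open>u\<close>; a Cantor-Schroeder-Bernstein argument makes it a
  permutation of \<open>u\<close>, so \<open>U\<close> carries such a norm \<open>N\<close> for all block sizes \<open>\<ge> 2\<close>.

  Let \<open>M\<close> be an equivalent norm with \<open>Isom N \<subseteq> Isom M\<close>. If \<open>M\<close> admits an isometric reflection along a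
  vector with non-zero parts in two blocks, then this reflection and the orthogonal groups of the blocks
  generate rotations between the two blocks, and these merge into one \<open>M\<close>-Euclidean space. As \<open>c\<^sub>0\<close>
  contains no \<open>\<ell>\<^sub>2\<close>, only finitely many blocks of a class merge with a given one; so a block with
  infinitely many interchangeable copies in its class merges with no other. The reflection vectors of
  \<open>M\<close> thus form a union of finite-dimensional components, which are permuted by the isometries and whose
  dimensions are a conjugacy invariant.

  If all blocks of a class have the same dimension, and different classes have different ones, nothing
  merges and \<open>N\<close> is maximal. If one adds a class with one block of dimension \<open>2 ^ (j + 1)\<close> for every
  \<open>j\<close>, the components inside it have distinct dimensions by uniqueness of binary expansions. Every
  isometry fixes them, so two of them can be merged, whatever \<open>M\<close> is: no bounded group containing
  \<open>Isom N\<close> is maximal.\<close>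


section \<open>Countably subadditive seminorms and domination of bases\<close>

text \<open>Reflections carry the argument because a group of isometries sees neither the basis nor
  the blocks, whereas the set of vectors along which it contains a reflection is transported by
  every conjugation. Dimension at least 2 is what makes a reflection usable: inside such a block
  every inner product with the reflection vector that Cauchy-Schwarz admits can be prescribed. The
  obstacle is that a reflection vector of \<open>M\<close> may have parts in infinitely many blocks;
  reflections survive the deletion of one block, and a limit leaves two of them. The norm is a
  supremum over selectors so that it decreases under deletion of coordinates, which the norm of
  \<open>U\<close> need not do. A maximal bounded group is the isometry group of the supremum of the
  norm over its orbits, so for the second family it suffices to enlarge the isometry group of each
  norm \<open>M\<close> above \<open>N\<close>. The dimensions also keep the extra class apart: the
  blocks of the other classes have odd dimension, and every component inside the extra class has
  even dimension.\<close>

lemma norm_sums_le_suminf: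
  fixes f :: "nat \<Rightarrow> 'a::real_normed_vector"
  assumes "f sums s" "\<And>j. norm (f j) \<le> g j" "summable g"
  shows "norm s \<le> (\<Sum>j. g j)"
proof (rule LIMSEQ_le_const2)
  show "(\<lambda>n. norm (\<Sum>j<n. f j)) \<longlonglongrightarrow> norm s"
    using assms(1) by (intro tendsto_norm) (simp add: sums_def)
  have "norm (\<Sum>j<n. f j) \<le> (\<Sum>j. g j)" for n
  proof -
    have "norm (\<Sum>j<n. f j) \<le> (\<Sum>j<n. g j)" by (rule sum_norm_le) (simp add: assms)
    also have "\<dots> \<le> (\<Sum>j. g j)"
      using assms(3) by (rule sum_le_suminf) (use assms(2) norm_ge_zero order_trans in blast)+
    finally show ?thesis .
  qed
  then show "\<exists>N. \<forall>n\<ge>N. norm (\<Sum>j<n. f j) \<le> (\<Sum>j. g j)" by blast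
qed

lemma abs_homogeneousI:
  fixes p :: "'a::real_vector \<Rightarrow> real"
  assumes V: "subspace V" and le: "\<And>c v. v \<in> V \<Longrightarrow> p (c *\<^sub>R v) \<le> \<bar>c\<bar> * p v"
    and nonneg: "\<And>v. 0 \<le> p v" and v: "v \<in> V"
  shows "p (c *\<^sub>R v) = \<bar>c\<bar> * p v"
proof (cases "c = 0")
  case True
  then show ?thesis using le[OF v, of 0] nonneg[of 0] by simp
next
  case False
  have "p ((1 / c) *\<^sub>R (c *\<^sub>R v)) \<le> \<bar>1 / c\<bar> * p (c *\<^sub>R v)"
    using V v by (intro le) (simp add: subspace_scale)
  then have "\<bar>c\<bar> * p v \<le> p (c *\<^sub>R v)" using False by (simp add: field_simps)
  then show ?thesis using le[OF v, of c] by simp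
qed

text \<open>Zabreiko's lemma on a closed subspace. By Baire a sublevel set is dense in some ball;
  symmetry and convexity move the ball to the origin, and countable subadditivity turns density into
  a bound, as in the open mapping theorem.\<close>

lemma countably_subadditive_bounded:
  fixes V :: "'a::banach set" and p :: "'a \<Rightarrow> real"
  assumes V: "closed V" "subspace V"
    and nonneg: "\<And>v. 0 \<le> p v"
    and hom: "\<And>c v. v \<in> V \<Longrightarrow> p (c *\<^sub>R v) = \<bar>c\<bar> * p v"
    and cs: "\<And>x v. (\<And>j::nat. x j \<in> V) \<Longrightarrow> x sums v \<Longrightarrow> summable (\<lambda>j. p (x j)) \<Longrightarrow> p v \<le> (\<Sum>j. p (x j))"
  obtains C where "C > 0" "\<And>v. v \<in> V \<Longrightarrow> p v \<le> C * norm v"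
proof -
  have V0: "0 \<in> V" using V(2) by (rule subspace_0)
  have p0: "p 0 = 0" using hom[OF V0, of 0] by simp
  have add: "p (u + w) \<le> p u + p w" if "u \<in> V" "w \<in> V" for u w
  proof -
    \<comment> \<open>Two summands padded with zeros turn countable into finite
      subadditivity.\<close>
    define x where "x = (\<lambda>j::nat. if j = 0 then u else if j = 1 then w else 0)"
    have fin: "j \<notin> {0, 1} \<Longrightarrow> x j = 0" for j by (auto simp: x_def)
    have 1: "x sums (u + w)"
      using sums_finite[of "{0, 1}" x] fin by (simp add: x_def)
    have 2: "(\<lambda>j. p (x j)) sums (p u + p w)"
      using sums_finite[of "{0, 1}" "\<lambda>j. p (x j)"] fin p0 by (simp add: x_def)
    have "p (u + w) \<le> (\<Sum>j. p (x j))"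
      using that V0 1 2 by (intro cs) (auto simp: x_def sums_iff)
    then show ?thesis using 2 by (simp add: sums_iff)
  qed
  define A where "A = (\<lambda>n::nat. closure {v \<in> V. p v \<le> n})"
  have AV: "A n \<subseteq> V" for n unfolding A_def by (rule closure_minimal[OF _ V(1)]) blast
  have cl: "closedin (top_of_set V) (A n)" for n
    using AV by (auto simp: A_def intro: closed_subset)
  have "V \<subseteq> (\<Union>n. A n)"
  proof
    fix v assume "v \<in> V"
    moreover obtain n :: nat where "p v \<le> n" using real_arch_simple by blast
    ultimately have "v \<in> {v \<in> V. p v \<le> n}" by simp
    then show "v \<in> (\<Union>n. A n)"
      unfolding A_def by (intro UN_I[of n] subsetD[OF closure_subset]) simp_all
  qed
  then have un: "(\<Union>n. A n) = V" using AV by blast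
  have "completely_metrizable_space (top_of_set V)"
    using V(1) by (simp add: completely_metrizable_space_closedin completely_metrizable_space_euclidean)
  then have "\<not> (\<forall>T\<in>range A. closedin (top_of_set V) T \<and> (top_of_set V) interior_of T = {})"
    using Baire_category_alt[of "top_of_set V" "range A"] un V0 interior_of_topspace[of "top_of_set V"] by auto
  then obtain n where "(top_of_set V) interior_of (A n) \<noteq> {}" using cl by blast
  then obtain v0 where v0: "v0 \<in> (top_of_set V) interior_of (A n)" by blast
  moreover have op: "openin (top_of_set V) ((top_of_set V) interior_of (A n))" by simp
  ultimately obtain r where r: "r > 0" "\<And>w. w \<in> V \<Longrightarrow> dist w v0 < r \<Longrightarrow> w \<in> A n"
    unfolding openin_euclidean_subtopology_iff using interior_of_subset[of "top_of_set V" "A n"] by blast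
  have v0V: "v0 \<in> V" using v0 interior_of_subset_topspace[of "top_of_set V"] by auto
  have s1: "\<exists>a\<in>V. p a \<le> n \<and> norm (w - a) < e" if w: "w \<in> V" "norm w < r" and e: "e > 0" for w e
  proof -
    \<comment> \<open>Half the difference of approximants of \<open>v0 + w\<close> and
      \<open>v0 - w\<close> approximates \<open>w\<close>, and \<open>p\<close> stays bounded by
      \<open>n\<close>.\<close>
    have "v0 + w \<in> A n" "v0 - w \<in> A n"
      using w v0V V(2) by (auto intro!: r simp: dist_norm subspace_add subspace_diff)
    then obtain a b where a: "a \<in> V" "p a \<le> n" "dist a (v0 + w) < e" and b: "b \<in> V" "p b \<le> n" "dist b (v0 - w) < e"
      unfolding A_def closure_approachable using e by blast
    have "p ((1/2) *\<^sub>R a + (-1/2) *\<^sub>R b) \<le> p ((1/2) *\<^sub>R a) + p ((-1/2) *\<^sub>R b)"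
      using a b V(2) by (intro add subspace_scale) auto
    also have "\<dots> \<le> n" unfolding hom[OF a(1)] hom[OF b(1)] using a b by simp
    finally have 1: "p ((1/2) *\<^sub>R a + (-1/2) *\<^sub>R b) \<le> n" .
    have "w - ((1/2) *\<^sub>R a + (-1/2) *\<^sub>R b) = (1/2) *\<^sub>R ((b - (v0 - w)) - (a - (v0 + w)))"
    proof -
      have "w = (1/2) *\<^sub>R w + (1/2) *\<^sub>R w" by (simp flip: scaleR_add_left)
      then show ?thesis by (simp add: algebra_simps)
    qed
    then have "norm (w - ((1/2) *\<^sub>R a + (-1/2) *\<^sub>R b)) = norm ((1/2::real) *\<^sub>R ((b - (v0 - w)) - (a - (v0 + w))))"
      by (rule arg_cong)
    also have "\<dots> = (1/2) * norm ((b - (v0 - w)) - (a - (v0 + w)))" unfolding norm_scaleR by simp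
    also have "\<dots> \<le> (1/2) * (norm (b - (v0 - w)) + norm (a - (v0 + w)))"
      by (intro mult_left_mono norm_triangle_ineq4) simp
    finally have "norm (w - ((1/2) *\<^sub>R a + (-1/2) *\<^sub>R b)) \<le> (1/2) * (norm (b - (v0 - w)) + norm (a - (v0 + w)))" .
    then have "norm (w - ((1/2) *\<^sub>R a + (-1/2) *\<^sub>R b)) < e"
      using a(3) b(3) by (simp add: dist_norm)
    moreover have "(1/2) *\<^sub>R a + (-1/2) *\<^sub>R b \<in> V"
      by (intro subspace_add subspace_scale V(2) a(1) b(1))
    ultimately show ?thesis using 1 by blast
  qed
  have s2: "\<exists>a. a \<in> V \<and> p a \<le> n / 2 ^ j \<and> norm (w - a) < r / 2 ^ Suc j" if w: "w \<in> V" "norm w < r / 2 ^ j" for w j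
  proof -
    have "norm (2 ^ j *\<^sub>R w) < r" using w by (simp add: field_simps)
    then obtain a where a: "a \<in> V" "p a \<le> n" "norm (2 ^ j *\<^sub>R w - a) < r / 2"
      using s1[of "2 ^ j *\<^sub>R w" "r / 2"] w V(2) r(1) by (auto simp: subspace_scale)
    have "w - (1 / 2 ^ j) *\<^sub>R a = (1 / 2 ^ j) *\<^sub>R (2 ^ j *\<^sub>R w - a)" by (simp add: algebra_simps)
    then have "norm (w - (1 / 2 ^ j) *\<^sub>R a) = norm (2 ^ j *\<^sub>R w - a) / 2 ^ j" by simp
    also have "\<dots> < r / 2 / 2 ^ j" using a by (intro divide_strict_right_mono) auto
    finally have "norm (w - (1 / 2 ^ j) *\<^sub>R a) < r / 2 ^ Suc j" by simp
    moreover have "p ((1 / 2 ^ j) *\<^sub>R a) \<le> n / 2 ^ j" using a by (simp add: hom divide_right_mono)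
    ultimately show ?thesis using a V(2) by (intro exI[of _ "(1 / 2 ^ j) *\<^sub>R a"]) (auto simp: subspace_scale)
  qed
  have s3: "p w \<le> 2 * n" if w: "w \<in> V" "norm w < r" for w
  proof -
    \<comment> \<open>\<open>f j\<close> is the remainder after \<open>j\<close> approximations and
      \<open>f j - f (Suc j)\<close> the approximant taken off. These approximants telescope to
      \<open>w\<close>, and their seminorms add up to at most \<open>2 * n\<close>.\<close>
    have "\<exists>f. f 0 = w \<and> (\<forall>j. (f j \<in> V \<and> norm (f j) < r / 2 ^ j) \<and> (f j - f (Suc j) \<in> V \<and> p (f j - f (Suc j)) \<le> n / 2 ^ j))"
    proof -
      have "\<exists>f. \<forall>j. ((f j \<in> V \<and> norm (f j) < r / 2 ^ j) \<and> (j = 0 \<longrightarrow> f j = w)) \<and> (f j - f (Suc j) \<in> V \<and> p (f j - f (Suc j)) \<le> n / 2 ^ j)"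
      proof (rule dependent_nat_choice)
        show "\<exists>x. (x \<in> V \<and> norm x < r / 2 ^ 0) \<and> (0 = (0::nat) \<longrightarrow> x = w)" using w by auto
        fix x j assume "(x \<in> V \<and> norm x < r / 2 ^ j) \<and> (j = 0 \<longrightarrow> x = w)"
        then obtain a where "a \<in> V" "p a \<le> n / 2 ^ j" "norm (x - a) < r / 2 ^ Suc j" "x \<in> V"
          using s2 by blast
        then show "\<exists>y. ((y \<in> V \<and> norm y < r / 2 ^ Suc j) \<and> (Suc j = 0 \<longrightarrow> y = w)) \<and> (x - y \<in> V \<and> p (x - y) \<le> n / 2 ^ j)"
          using V(2) by (intro exI[of _ "x - a"]) (auto simp: subspace_diff)
      qed
      then show ?thesis by blast
    qed
    then obtain f where f: "f 0 = w" "\<And>j. f j \<in> V" "\<And>j. norm (f j) < r / 2 ^ j"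
        "\<And>j. f j - f (Suc j) \<in> V" "\<And>j. p (f j - f (Suc j)) \<le> n / 2 ^ j" by blast
    have "f \<longlonglongrightarrow> 0"
    proof (rule Lim_null_comparison)
      show "\<forall>\<^sub>F j in sequentially. norm (f j) \<le> r * (1 / 2) ^ j"
        using f(3) by (auto intro!: always_eventually simp: less_imp_le power_divide)
      show "(\<lambda>j. r * (1 / 2) ^ j) \<longlonglongrightarrow> 0" by (intro tendsto_mult_right_zero LIMSEQ_power_zero) auto
    qed
    then have sm: "(\<lambda>j. f j - f (Suc j)) sums w" using telescope_sums'[of f 0] f(1) by simp
    have g: "(\<lambda>j. n / 2 ^ j) sums (2 * real n)"
      using sums_mult[OF geometric_sums[of "1/2::real"], of n] by (simp add: power_divide mult.commute)
    have su: "summable (\<lambda>j. p (f j - f (Suc j)))"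
      using f(5) nonneg by (intro summable_comparison_test[OF _ sums_summable[OF g]] exI[of _ 0]) simp
    have "p w \<le> (\<Sum>j. p (f j - f (Suc j)))" by (rule cs[OF f(4) sm su])
    also have "\<dots> \<le> (\<Sum>j. n / 2 ^ j)" using su g f(5) by (intro suminf_le) (auto simp: sums_iff)
    also have "\<dots> = 2 * n" using g by (simp add: sums_iff)
    finally show ?thesis .
  qed
  have "p v \<le> (4 * n / r + 1) * norm v" if v: "v \<in> V" for v
  proof (cases "v = 0")
    case False
    define c where "c = r / (2 * norm v)"
    have c: "c > 0" using False r(1) by (simp add: c_def)
    have "p (c *\<^sub>R v) \<le> 2 * n"
      using v r(1) False V(2) by (intro s3) (auto simp: c_def subspace_scale)
    then have "p v \<le> 2 * n / c" using c v by (simp add: hom field_simps)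
    also have "\<dots> = 4 * n / r * norm v" using False by (simp add: c_def)
    finally show ?thesis by (simp add: distrib_right add_increasing2)
  qed (simp add: p0)
  then show ?thesis using r(1) by (intro that[of "4 * n / r + 1"]) (auto simp: add_nonneg_pos)
qed

text \<open>Both partial sum operators are dominated at once by applying the previous lemma to the larger
  seminorm that bounds the partial sums in \<open>x\<close> and in \<open>y\<close>; this is where continuity of the
  coordinate functionals comes from.\<close>

lemma basis_dominates:
  fixes V :: "'a::banach set" and x :: "nat \<Rightarrow> 'a" and y :: "nat \<Rightarrow> 'b::real_normed_vector"
  assumes V: "closed V" "subspace V" and basis: "schauder_basis_on V x" and nx: "\<And>i. norm (x i) = 1"
    and dom: "\<And>a. summable (\<lambda>i. a i *\<^sub>R x i) \<Longrightarrow> summable (\<lambda>i. a i *\<^sub>R y i)"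
  obtains C where "C > 0"
    "\<And>v a n. v \<in> V \<Longrightarrow> (\<lambda>i. a i *\<^sub>R x i) sums v \<Longrightarrow> norm (\<Sum>i<n. a i *\<^sub>R y i) \<le> C * norm v"
proof -
  have xV: "x i \<in> V" and ex1: "v \<in> V \<Longrightarrow> \<exists>!a. (\<lambda>i. a i *\<^sub>R x i) sums v" for i v
    using basis by (auto simp: schauder_basis_on_def)
  define cf where "cf = (\<lambda>v. THE a. (\<lambda>i. a i *\<^sub>R x i) sums v)"
  have cf: "(\<lambda>i. cf v i *\<^sub>R x i) sums v" if "v \<in> V" for v
    unfolding cf_def by (rule theI'[OF ex1[OF that]])
  have cfI: "cf v = a" if "v \<in> V" "(\<lambda>i. a i *\<^sub>R x i) sums v" for v a
    using ex1[OF that(1)] cf[OF that(1)] that(2) by blast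
  define s where "s = (\<lambda>v n. \<Sum>i<n. cf v i *\<^sub>R x i)"
  define t where "t = (\<lambda>v n. \<Sum>i<n. cf v i *\<^sub>R y i)"
  define p where "p = (\<lambda>v. if v \<in> V then SUP n. norm (s v n) + norm (t v n) else 0)"
  have sv: "s v \<longlonglongrightarrow> v" if "v \<in> V" for v using cf[OF that] by (simp add: s_def sums_def)
  have bdd: "bdd_above (range (\<lambda>n. norm (s v n) + norm (t v n)))" if v: "v \<in> V" for v
  proof -
    have "convergent (s v)" "convergent (t v)"
      using cf[OF v] dom[of "cf v"] by (auto simp: s_def t_def summable_iff_convergent sums_iff)
    then have "Bseq (s v)" "Bseq (t v)" by (auto intro: convergent_imp_Bseq)
    then obtain K L where "\<And>n. norm (s v n) \<le> K" "\<And>n. norm (t v n) \<le> L" unfolding Bseq_def by blast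
    then show ?thesis by (intro bdd_aboveI2[where M = "K + L"]) (simp add: add_mono)
  qed
  have le: "norm (s v n) + norm (t v n) \<le> p v" if "v \<in> V" for v n
    using that bdd[OF that] by (auto simp: p_def intro: cSUP_upper)
  have pI: "p v \<le> B" if "v \<in> V" "\<And>n. norm (s v n) + norm (t v n) \<le> B" for v B
    using that by (auto simp: p_def intro: cSUP_least)
  have p0: "0 \<le> p v" for v
  proof (cases "v \<in> V")
    case True
    then show ?thesis using le[of v 0] by (auto intro: order_trans[rotated])
  qed (simp add: p_def)
  have hom: "p (c *\<^sub>R v) = \<bar>c\<bar> * p v" if v: "v \<in> V" for c v
  proof (rule abs_homogeneousI[OF V(2) _ p0 v])
    fix c v assume v: "v \<in> V"
    have "cf (c *\<^sub>R v) = (\<lambda>i. c * cf v i)"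
      using sums_scaleR_right[OF cf[OF v], of c] V(2) v by (intro cfI) (auto simp: subspace_scale)
    then have "s (c *\<^sub>R v) n = c *\<^sub>R s v n" "t (c *\<^sub>R v) n = c *\<^sub>R t v n" for n
      by (simp_all add: s_def t_def scaleR_sum_right)
    then have "norm (s (c *\<^sub>R v) n) + norm (t (c *\<^sub>R v) n) \<le> \<bar>c\<bar> * p v" for n
      using le[OF v, of n] by (simp flip: distrib_left add: mult_left_mono)
    then show "p (c *\<^sub>R v) \<le> \<bar>c\<bar> * p v" using V(2) v by (intro pI) (auto simp: subspace_scale)
  qed
  have cs: "p v \<le> (\<Sum>j. p (w j))"
    if w: "\<And>j::nat. w j \<in> V" and wv: "w sums v" and su: "summable (\<lambda>j. p (w j))" for w v
  proof -
    have "(\<Sum>j<n. w j) \<in> V" for n using w V(2) by (intro subspace_sum)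
    with wv have vV: "v \<in> V"
      unfolding sums_def by (intro closed_sequentially[OF V(1), of "\<lambda>n. \<Sum>j<n. w j" v])
    have sn: "norm (s (w j) n) \<le> p (w j)" "norm (t (w j) n) \<le> p (w j)" for j n
      using le[OF w, of j n] norm_ge_zero[of "s (w j) n"] norm_ge_zero[of "t (w j) n"] by linarith+
    \<comment> \<open>Since \<open>x\<close> is normalized, a coordinate is the norm of a difference
      of consecutive partial sums; so the coordinates of the \<open>w j\<close> are summable over
      \<open>j\<close>.\<close>
    have "\<bar>cf (w j) i\<bar> \<le> 2 * p (w j)" for i j
    proof -
      have "\<bar>cf (w j) i\<bar> = norm (s (w j) (Suc i) - s (w j) i)" by (simp add: s_def nx)
      also have "\<dots> \<le> norm (s (w j) (Suc i)) + norm (s (w j) i)" by (rule norm_triangle_ineq4)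
      finally show ?thesis using sn(1)[of j i] sn(1)[of j "Suc i"] by linarith
    qed
    then have "summable (\<lambda>j. cf (w j) i)" for i
      by (intro summable_comparison_test[OF _ summable_mult[OF su, of 2]] exI[of _ 0]) simp
    then have b: "(\<lambda>j. cf (w j) i) sums (\<Sum>j. cf (w j) i)" for i by (rule summable_sums)
    define b where "b = (\<lambda>i. \<Sum>j. cf (w j) i)"
    have S: "(\<lambda>j. s (w j) n) sums (\<Sum>i<n. b i *\<^sub>R x i)" for n
      unfolding s_def using b by (intro sums_sum sums_scaleR_left) (simp add: b_def)
    have T: "(\<lambda>j. t (w j) n) sums (\<Sum>i<n. b i *\<^sub>R y i)" for n
      unfolding t_def using b by (intro sums_sum sums_scaleR_left) (simp add: b_def)
    have nw: "norm (w j) \<le> p (w j)" for j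
      using tendsto_norm[OF sv[OF w, of j]] sn(1) by (intro LIMSEQ_le_const2) auto
    have d: "norm (norm (s (w j) n - w j)) \<le> 2 * p (w j)" for j n
      using norm_triangle_ineq4[of "s (w j) n" "w j"] nw[of j] sn(1)[of j n] by simp
    have su2: "summable (\<lambda>j. 2 * p (w j))" using su by (rule summable_mult)
    have "(\<lambda>n. norm (s (w j) n - w j)) \<longlonglongrightarrow> 0" for j
      using sv[OF w, of j] by (simp add: LIM_zero tendsto_norm_zero)
    \<comment> \<open>Tannery's theorem, with the bound \<open>2 * p (w j)\<close>, passes the limit
      of the partial sums through the sum over \<open>j\<close>; hence the coordinatewise sum
      \<open>b\<close> is the expansion of \<open>v\<close>.\<close>
    then have tan: "(\<lambda>n. \<Sum>j. norm (s (w j) n - w j)) \<longlonglongrightarrow> (\<Sum>j. 0)"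
      using tannerys_theorem[of "\<lambda>j n. norm (s (w j) n - w j)" "\<lambda>j. 0" sequentially "\<lambda>j. 2 * p (w j)"] d su2
      by (auto intro: always_eventually)
    have "(\<lambda>n. (\<Sum>i<n. b i *\<^sub>R x i) - v) \<longlonglongrightarrow> 0"
    proof (rule Lim_null_comparison)
      have "norm ((\<Sum>i<n. b i *\<^sub>R x i) - v) \<le> (\<Sum>j. norm (s (w j) n - w j))" for n
        using d by (intro norm_sums_le_suminf[OF sums_diff[OF S wv]] summable_comparison_test[OF _ su2] exI[of _ 0]) simp_all
      then show "\<forall>\<^sub>F n in sequentially. norm ((\<Sum>i<n. b i *\<^sub>R x i) - v) \<le> (\<Sum>j. norm (s (w j) n - w j))"
        by (simp add: always_eventually)
      show "(\<lambda>n. \<Sum>j. norm (s (w j) n - w j)) \<longlonglongrightarrow> 0" using tan by simp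
    qed
    then have "(\<lambda>i. b i *\<^sub>R x i) sums v" by (simp add: sums_def LIM_zero_iff)
    then have cfb: "cf v = b" by (rule cfI[OF vV])
    show ?thesis
    proof (rule pI[OF vV])
      fix n
      have s1: "summable (\<lambda>j. norm (s (w j) n))" "summable (\<lambda>j. norm (t (w j) n))"
        using sn by (intro summable_comparison_test[OF _ su] exI[of _ 0]; simp)+
      have "norm (s v n) \<le> (\<Sum>j. norm (s (w j) n))"
        using norm_sums_le_suminf[OF S[of n] _ s1(1)] by (simp add: s_def cfb)
      moreover have "norm (t v n) \<le> (\<Sum>j. norm (t (w j) n))"
        using norm_sums_le_suminf[OF T[of n] _ s1(2)] by (simp add: t_def cfb)
      moreover have "(\<Sum>j. norm (s (w j) n)) + (\<Sum>j. norm (t (w j) n)) = (\<Sum>j. norm (s (w j) n) + norm (t (w j) n))"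
        using s1 by (rule suminf_add)
      moreover have "\<dots> \<le> (\<Sum>j. p (w j))" using s1 su le[OF w] by (intro suminf_le summable_add)
      ultimately show "norm (s v n) + norm (t v n) \<le> (\<Sum>j. p (w j))" by linarith
    qed
  qed
  obtain C where C: "C > 0" "\<And>v. v \<in> V \<Longrightarrow> p v \<le> C * norm v"
    using countably_subadditive_bounded[OF V p0 hom cs] by blast
  show ?thesis
  proof (rule that[OF C(1)])
    fix v a n assume v: "v \<in> V" and "(\<lambda>i. a i *\<^sub>R x i) sums v"
    then have "cf v = a" by (rule cfI)
    moreover have "norm (t v n) \<le> p v"
      using le[OF v, of n] norm_ge_zero[of "s v n"] by linarith
    ultimately have "norm (\<Sum>i<n. a i *\<^sub>R y i) \<le> p v" by (simp add: t_def)
    then show "norm (\<Sum>i<n. a i *\<^sub>R y i) \<le> C * norm v" using C(2)[OF v] by simp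
  qed
qed


section \<open>Unconditional bases\<close>

text \<open>Equivalence of sequences is phrased with ordered series, but only unordered convergence
  is stable under the permutation of the basis to come.\<close>

lemma unconditional_basis_summable_iff:
  fixes x :: "nat \<Rightarrow> 'a::banach"
  assumes V: "closed V" "subspace V" and x: "unconditional_basis_on V x"
  shows "summable (\<lambda>i. a i *\<^sub>R x i) \<longleftrightarrow> (\<lambda>i. a i *\<^sub>R x i) summable_on UNIV"
proof
  assume "summable (\<lambda>i. a i *\<^sub>R x i)"
  then obtain v where v: "(\<lambda>i. a i *\<^sub>R x i) sums v" by (auto simp: summable_def)
  have "x i \<in> V" for i using x by (auto simp: unconditional_basis_on_def schauder_basis_on_def)
  then have "(\<Sum>i<n. a i *\<^sub>R x i) \<in> V" for n using V(2) by (intro subspace_sum subspace_scale)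
  then have "v \<in> V"
    using v unfolding sums_def by (intro closed_sequentially[OF V(1), of "\<lambda>n. \<Sum>i<n. a i *\<^sub>R x i" v])
  then show "(\<lambda>i. a i *\<^sub>R x i) summable_on UNIV"
    using x v by (simp add: unconditional_basis_on_def)
next
  assume "(\<lambda>i. a i *\<^sub>R x i) summable_on UNIV"
  then show "summable (\<lambda>i. a i *\<^sub>R x i)"
    using has_sum_imp_sums sums_summable unfolding summable_on_def by blast
qed

lemma summable_on_extend_zero:
  fixes x :: "'i \<Rightarrow> 'a::real_normed_vector"
  shows "(\<lambda>i. (if i \<in> A then a i else 0) *\<^sub>R x i) summable_on UNIV \<longleftrightarrow> (\<lambda>i. a i *\<^sub>R x i) summable_on A"
  by (rule summable_on_cong_neutral) auto

lemma unconditional_basis_subseq_summable_iff: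
  fixes x :: "nat \<Rightarrow> 'a::banach"
  assumes x: "unconditional_basis_on UNIV x" and s: "strict_mono s"
  shows "summable (\<lambda>i. a i *\<^sub>R x (s i)) \<longleftrightarrow> (\<lambda>i. a i *\<^sub>R x (s i)) summable_on UNIV"
proof -
  have inj: "inj s" using s by (rule strict_mono_imp_inj_on)
  define b where "b = (\<lambda>q. a (inv_into UNIV s q))"
  define f where "f = (\<lambda>q. (if q \<in> range s then b q else 0) *\<^sub>R x q)"
  have fs: "f (s i) = a i *\<^sub>R x (s i)" for i using inj by (simp add: f_def b_def)
  have "summable (\<lambda>i. f (s i)) \<longleftrightarrow> summable f"
    by (rule summable_mono_reindex[OF s]) (auto simp: f_def)
  also have "\<dots> \<longleftrightarrow> f summable_on UNIV"
    unfolding f_def by (rule unconditional_basis_summable_iff[OF closed_UNIV subspace_UNIV x])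
  also have "\<dots> \<longleftrightarrow> f summable_on (range s)" by (rule summable_on_cong_neutral) (auto simp: f_def)
  also have "\<dots> \<longleftrightarrow> (\<lambda>i. f (s i)) summable_on UNIV"
    using summable_on_reindex[OF inj, of f] by (simp add: comp_def)
  finally show ?thesis by (simp add: fs)
qed

text \<open>\<open>x\<close> is matched with \<open>y\<close> along \<phi> on a set \<open>A\<close>
  and along the inverse of \<psi> off it. Unordered sums split along \<open>A\<close>, and each
  hypothesis restricts to a subset by extending the coefficients by zero.\<close>

lemma unconditional_Schroeder_Bernstein:
  fixes x :: "nat \<Rightarrow> 'a::banach" and y :: "nat \<Rightarrow> 'b::banach"
  assumes inj: "inj \<phi>" "inj \<psi>"
    and xy: "\<And>a. (\<lambda>i. a i *\<^sub>R x i) summable_on UNIV \<longleftrightarrow> (\<lambda>i. a i *\<^sub>R y (\<phi> i)) summable_on UNIV"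
    and yx: "\<And>a. (\<lambda>i. a i *\<^sub>R y i) summable_on UNIV \<longleftrightarrow> (\<lambda>i. a i *\<^sub>R x (\<psi> i)) summable_on UNIV"
  obtains \<pi> :: "nat \<Rightarrow> nat" where "bij \<pi>"
    "\<And>a. (\<lambda>i. a i *\<^sub>R x i) summable_on UNIV \<longleftrightarrow> (\<lambda>i. a i *\<^sub>R y (\<pi> i)) summable_on UNIV"
proof -
  define A where "A = lfp (\<lambda>X. - \<psi> ` (- \<phi> ` X))"
  have "A = - \<psi> ` (- \<phi> ` A)"
    unfolding A_def by (rule lfp_unfold) (auto simp: mono_def)
  then have A: "- A = \<psi> ` (- \<phi> ` A)" by blast
  define C where "C = - \<phi> ` A"
  define \<pi> where "\<pi> = (\<lambda>i. if i \<in> A then \<phi> i else inv_into UNIV \<psi> i)"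
  have \<pi>C: "\<pi> (\<psi> k) = k" if "k \<in> C" for k
  proof -
    have "\<psi> k \<notin> A" using that A C_def by blast
    then show ?thesis using inj(2) by (simp add: \<pi>_def)
  qed
  have "bij_betw \<pi> A (\<phi> ` A)"
    using inj(1) unfolding bij_betw_def by (auto simp: \<pi>_def inj_on_def)
  moreover have "bij_betw \<pi> (- A) (- \<phi> ` A)"
    unfolding A C_def[symmetric] using \<pi>C by (intro bij_betw_byWitness[where f' = \<psi>]) auto
  ultimately have "bij_betw \<pi> (A \<union> - A) (\<phi> ` A \<union> - \<phi> ` A)" by (rule bij_betw_combine) auto
  then have bij: "bij \<pi>" by simp
  have split: "f summable_on UNIV \<longleftrightarrow> f summable_on A \<and> f summable_on (- A)"
    for f :: "nat \<Rightarrow> 'c::banach"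
  proof
    assume "f summable_on UNIV"
    then show "f summable_on A \<and> f summable_on (- A)" using summable_on_subset_banach by blast
  next
    assume "f summable_on A \<and> f summable_on (- A)"
    then have "f summable_on (A \<union> - A)" by (intro summable_on_Un_disjoint) auto
    then show "f summable_on UNIV" by simp
  qed
  have onA: "(\<lambda>i. a i *\<^sub>R x i) summable_on A \<longleftrightarrow> (\<lambda>i. a i *\<^sub>R y (\<pi> i)) summable_on A" for a
  proof -
    have "(\<lambda>i. a i *\<^sub>R x i) summable_on A \<longleftrightarrow> (\<lambda>i. a i *\<^sub>R y (\<phi> i)) summable_on A"
      using xy[of "\<lambda>i. if i \<in> A then a i else 0"] unfolding summable_on_extend_zero .
    also have "\<dots> \<longleftrightarrow> (\<lambda>i. a i *\<^sub>R y (\<pi> i)) summable_on A"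
      by (rule summable_on_cong) (simp add: \<pi>_def)
    finally show ?thesis .
  qed
  have onC: "(\<lambda>i. a i *\<^sub>R x i) summable_on (- A) \<longleftrightarrow> (\<lambda>i. a i *\<^sub>R y (\<pi> i)) summable_on (- A)" for a
  proof -
    have injC: "inj_on \<psi> C" using inj(2) by (rule inj_on_subset) simp
    have "(\<lambda>i. a i *\<^sub>R x i) summable_on (- A) \<longleftrightarrow> (\<lambda>k. a (\<psi> k) *\<^sub>R x (\<psi> k)) summable_on C"
      unfolding A C_def[symmetric] summable_on_reindex[OF injC] by (simp add: comp_def)
    also have "\<dots> \<longleftrightarrow> (\<lambda>k. a (\<psi> k) *\<^sub>R y k) summable_on C"
      using yx[of "\<lambda>k. if k \<in> C then a (\<psi> k) else 0"] unfolding summable_on_extend_zero by simp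
    also have "\<dots> \<longleftrightarrow> (\<lambda>k. a (\<psi> k) *\<^sub>R y (\<pi> (\<psi> k))) summable_on C"
      by (rule summable_on_cong) (simp add: \<pi>C)
    also have "\<dots> \<longleftrightarrow> (\<lambda>i. a i *\<^sub>R y (\<pi> i)) summable_on (- A)"
      unfolding A C_def[symmetric] summable_on_reindex[OF injC] by (simp add: comp_def)
    finally show ?thesis .
  qed
  show ?thesis
    by (rule that[OF bij]) (use split onA onC in metis)
qed

text \<open>A norming functional \<open>f\<close> turns the sum into a real one, which is largest
  when every multiplier is the sign of \<open>f (z i)\<close>. The two sign classes are plain
  subsums, whence the factor 2.\<close>

lemma norm_sum_multiplier_le:
  fixes z :: "'i \<Rightarrow> 'a::real_normed_vector"
  assumes "finite F" and le: "\<And>G. G \<subseteq> F \<Longrightarrow> norm (\<Sum>i\<in>G. z i) \<le> B" and t: "\<And>i. i \<in> F \<Longrightarrow> \<bar>t i\<bar> \<le> 1"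
  shows "norm (\<Sum>i\<in>F. t i *\<^sub>R z i) \<le> 2 * B"
proof -
  obtain f :: "'a \<Rightarrow> real" where f: "linear f" "\<And>x. \<bar>f x\<bar> \<le> norm x"
      "f (\<Sum>i\<in>F. t i *\<^sub>R z i) = norm (\<Sum>i\<in>F. t i *\<^sub>R z i)"
    using norming_functional by blast
  define P where "P = {i \<in> F. f (z i) \<ge> 0}"
  have "norm (\<Sum>i\<in>F. t i *\<^sub>R z i) = (\<Sum>i\<in>F. t i * f (z i))"
    using f(3) by (simp add: linear_sum[OF f(1)] linear_cmul[OF f(1)])
  also have "\<dots> \<le> (\<Sum>i\<in>F. \<bar>f (z i)\<bar>)"
  proof (rule sum_mono)
    fix i assume "i \<in> F"
    then have "\<bar>t i * f (z i)\<bar> \<le> 1 * \<bar>f (z i)\<bar>"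
      unfolding abs_mult using t by (intro mult_right_mono) auto
    then show "t i * f (z i) \<le> \<bar>f (z i)\<bar>" by linarith
  qed
  also have "\<dots> = (\<Sum>i\<in>P. \<bar>f (z i)\<bar>) + (\<Sum>i\<in>F - P. \<bar>f (z i)\<bar>)"
    using assms(1) by (subst sum.subset_diff[of P F]) (auto simp: P_def)
  also have "(\<Sum>i\<in>P. \<bar>f (z i)\<bar>) = f (\<Sum>i\<in>P. z i)"
    by (simp add: linear_sum[OF f(1)] P_def)
  also have "(\<Sum>i\<in>F - P. \<bar>f (z i)\<bar>) = - f (\<Sum>i\<in>F - P. z i)"
    unfolding linear_sum[OF f(1)] sum_negf[symmetric] by (rule sum.cong) (auto simp: P_def)
  also have "f (\<Sum>i\<in>P. z i) + - f (\<Sum>i\<in>F - P. z i) \<le> B + B"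
    using f(2)[of "\<Sum>i\<in>P. z i"] f(2)[of "\<Sum>i\<in>F - P. z i"] le[of P] le[of "F - P"]
    by (fastforce simp: P_def)
  finally show ?thesis by simp
qed

lemma span_range_sum:
  fixes x :: "nat \<Rightarrow> 'a::real_vector"
  assumes "v \<in> span (range x)"
  obtains F c where "finite F" "v = (\<Sum>i\<in>F. c i *\<^sub>R x i)" "\<And>i. i \<notin> F \<Longrightarrow> c i = 0"
proof -
  have "\<exists>F c. finite F \<and> v = (\<Sum>i\<in>F. c i *\<^sub>R x i) \<and> (\<forall>i. i \<notin> F \<longrightarrow> c i = 0)"
    using assms
  proof (induction rule: span_induct_alt)
    case base
    show ?case by (intro exI[of _ "{}"] exI[of _ "\<lambda>_. 0"]) simp
  next
    case (step r w y)
    then obtain j F c where j: "w = x j" and F: "finite F" "y = (\<Sum>i\<in>F. c i *\<^sub>R x i)" "\<forall>i. i \<notin> F \<longrightarrow> c i = 0"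
      by blast
    have "y = (\<Sum>i\<in>insert j F. c i *\<^sub>R x i)"
      unfolding F(2) using F by (intro sum.mono_neutral_left) auto
    moreover have "r *\<^sub>R w = (\<Sum>i\<in>insert j F. (if i = j then r else 0) *\<^sub>R x i)"
      using F(1) by (subst sum.mono_neutral_right[of _ "{j}"]) (auto simp: j)
    ultimately have "r *\<^sub>R w + y = (\<Sum>i\<in>insert j F. ((if i = j then r else 0) + c i) *\<^sub>R x i)"
      by (simp only: scaleR_add_left sum.distrib)
    then show ?case using F
      by (intro exI[of _ "insert j F"] exI[of _ "\<lambda>i. (if i = j then r else 0) + c i"]) auto
  qed
  then show ?thesis using that by blast
qed

text \<open>The projections onto finite sets of coordinates are contractions, uniformly in the set.
  So the coordinates of finite combinations tending to \<open>v\<close> converge, and their limits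
  expand \<open>v\<close> along the net of all finite sets.\<close>

lemma suppression_unconditional_basic_sequence:
  fixes x :: "nat \<Rightarrow> 'a::banach"
  assumes nx: "\<And>i. norm (x i) = 1"
    and sup: "\<And>F G a. finite G \<Longrightarrow> F \<subseteq> G \<Longrightarrow> norm (\<Sum>i\<in>F. a i *\<^sub>R x i) \<le> norm (\<Sum>i\<in>G. a i *\<^sub>R x i)"
  shows "normalized_unconditional_basic_sequence x"
proof -
  define V where "V = closure (span (range x))"
  have uniq: "a = b" if a: "(\<lambda>i. a i *\<^sub>R x i) sums v" and b: "(\<lambda>i. b i *\<^sub>R x i) sums v" for a b v
  proof
    fix i
    define c where "c = (\<lambda>i. a i - b i)"
    have "(\<lambda>i. c i *\<^sub>R x i) sums 0"
      using sums_diff[OF a b] by (simp add: c_def scaleR_diff_left)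
    then have "(\<lambda>n. norm (\<Sum>i<n. c i *\<^sub>R x i)) \<longlonglongrightarrow> 0"
      unfolding sums_def by (rule tendsto_norm_zero)
    moreover have "\<bar>c i\<bar> \<le> norm (\<Sum>i<n. c i *\<^sub>R x i)" if "Suc i \<le> n" for n
      using sup[of "{..<n}" "{i}" c] that nx by simp
    ultimately have "\<bar>c i\<bar> \<le> 0" by (intro LIMSEQ_le_const) auto
    then show "a i = b i" by (simp add: c_def)
  qed
  have ex: "\<exists>b. ((\<lambda>i. b i *\<^sub>R x i) has_sum v) UNIV" if v: "v \<in> V" for v
  proof -
    obtain d where d: "\<And>n. d n \<in> span (range x)" "d \<longlonglongrightarrow> v"
      using v unfolding V_def closure_sequential by blast
    have "\<forall>n. \<exists>F c. finite F \<and> d n = (\<Sum>i\<in>F. c i *\<^sub>R x i) \<and> (\<forall>i. i \<notin> F \<longrightarrow> c i = 0)"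
      using span_range_sum[OF d(1)] by metis
    then obtain F c where F: "\<And>n. finite (F n)" "\<And>n. d n = (\<Sum>i\<in>F n. c n i *\<^sub>R x i)" "\<And>n i. i \<notin> F n \<Longrightarrow> c n i = 0"
      by metis
    have dG: "d n = (\<Sum>i\<in>G. c n i *\<^sub>R x i)" if "finite G" "F n \<subseteq> G" for n G
      unfolding F(2) using that F(3) by (intro sum.mono_neutral_left) auto
    have 1: "norm (\<Sum>i\<in>G. (c n i - c m i) *\<^sub>R x i) \<le> norm (d n - d m)" if "finite G" for G n m
    proof -
      have "d n - d m = (\<Sum>i\<in>G \<union> (F n \<union> F m). (c n i - c m i) *\<^sub>R x i)"
        using that F(1) by (subst (1 2) dG[of "G \<union> (F n \<union> F m)"]) (auto simp: scaleR_diff_left sum_subtractf)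
      then show ?thesis using sup[of "G \<union> (F n \<union> F m)" G "\<lambda>i. c n i - c m i"] that F(1) by simp
    qed
    have "Cauchy d" using d(2) by (rule LIMSEQ_imp_Cauchy)
    have "Cauchy (\<lambda>n. c n i)" for i
    proof (rule CauchyI)
      fix r :: real assume "r > 0"
      then obtain M where "\<forall>m\<ge>M. \<forall>n\<ge>M. norm (d m - d n) < r" using CauchyD[OF \<open>Cauchy d\<close>] by blast
      moreover have "norm (c m i - c n i) \<le> norm (d m - d n)" for m n
        using 1[of "{i}" m n] nx by simp
      ultimately show "\<exists>M. \<forall>m\<ge>M. \<forall>n\<ge>M. norm (c m i - c n i) < r" using order_le_less_trans by blast
    qed
    then have "\<forall>i. \<exists>l. (\<lambda>n. c n i) \<longlonglongrightarrow> l" using Cauchy_convergent_iff convergent_def by blast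
    then obtain b where b: "\<And>i. (\<lambda>n. c n i) \<longlonglongrightarrow> b i" by metis
    have 2: "norm (\<Sum>i\<in>G. (c n i - b i) *\<^sub>R x i) \<le> norm (d n - v)" if "finite G" for G n
      by (rule LIMSEQ_le[where X = "\<lambda>m. norm (\<Sum>i\<in>G. (c n i - c m i) *\<^sub>R x i)" and Y = "\<lambda>m. norm (d n - d m)"])
        (use that 1 in \<open>auto intro!: tendsto_intros b d(2)\<close>)
    have "((\<lambda>i. b i *\<^sub>R x i) has_sum v) UNIV"
      unfolding has_sum_def tendsto_iff
    proof (intro allI impI)
      fix r :: real assume "r > 0"
      then have "\<forall>\<^sub>F n in sequentially. norm (d n - v) < r / 2"
        using d(2) unfolding tendsto_iff by (auto simp: dist_norm dest: spec[of _ "r / 2"])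
      then obtain n where n: "norm (d n - v) < r / 2" unfolding eventually_sequentially by blast
      \<comment> \<open>Once \<open>G\<close> contains the support of \<open>d n\<close>, replacing
        the coefficients of \<open>d n\<close> by \<open>b\<close> costs at most another
        \<open>norm (d n - v)\<close>.\<close>
      have "dist (\<Sum>i\<in>G. b i *\<^sub>R x i) v < r" if "finite G" "F n \<subseteq> G" for G
      proof -
        have "(\<Sum>i\<in>G. b i *\<^sub>R x i) - v = (d n - v) - (\<Sum>i\<in>G. (c n i - b i) *\<^sub>R x i)"
          using dG[OF that] by (simp add: scaleR_diff_left sum_subtractf)
        then have "norm ((\<Sum>i\<in>G. b i *\<^sub>R x i) - v) \<le> norm (d n - v) + norm (\<Sum>i\<in>G. (c n i - b i) *\<^sub>R x i)"
          using norm_triangle_ineq4 by metis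
        then show ?thesis using n 2[OF that(1), of n] by (simp add: dist_norm)
      qed
      then show "\<forall>\<^sub>F G in finite_subsets_at_top UNIV. dist (\<Sum>i\<in>G. b i *\<^sub>R x i) v < r"
        unfolding eventually_finite_subsets_at_top using F(1) by (intro exI[of _ "F n"]) auto
    qed
    then show ?thesis by blast
  qed
  have "unconditional_basis_on V x"
    unfolding unconditional_basis_on_def schauder_basis_on_def
  proof (intro conjI ballI allI impI)
    show "range x \<subseteq> V" unfolding V_def using span_superset closure_subset by (rule order_trans)
    show "\<exists>!a. (\<lambda>i. a i *\<^sub>R x i) sums v" if "v \<in> V" for v
      using ex[OF that] has_sum_imp_sums uniq by blast
    show "(\<lambda>i. a i *\<^sub>R x i) summable_on UNIV" if "v \<in> V" "(\<lambda>i. a i *\<^sub>R x i) sums v" for v a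
      using ex[OF that(1)] has_sum_imp_sums uniq[OF that(2)] has_sum_imp_summable by metis
  qed
  then show ?thesis using nx by (simp add: normalized_unconditional_basic_sequence_def V_def)
qed


section \<open>Block renormings of a space with a universal basis\<close>

instance bcontfun :: (metric_space, banach) banach ..

text \<open>Block \<open>i\<close> is spanned by the \<open>e p\<close> with \<open>blk p = i\<close>, and belongs to the class \<open>\<kappa> i\<close>. The last two
  assumptions are all that is used of the norm described above.\<close>

locale block_space =
  fixes e :: "nat \<Rightarrow> 'a::banach" and cf :: "nat \<Rightarrow> 'a \<Rightarrow> real"
    and blk \<kappa> :: "nat \<Rightarrow> nat" and N :: "'a \<Rightarrow> real"
  assumes cf_bl: "bounded_linear (cf p)"
    and cf_e: "cf p (e q) = (if p = q then 1 else 0)"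
    and expand: "((\<lambda>p. cf p v *\<^sub>R e p) has_sum v) UNIV"
    and norm_e: "norm (e p) = 1"
    and fin: "finite (blk -` {i})" and two: "2 \<le> card (blk -` {i})"
    and equiv: "equivalent_norm N"
    and N_transversal: "finite A \<Longrightarrow> (\<And>i. i \<in> A \<Longrightarrow> blk (g i) = i \<and> \<kappa> i = k) \<Longrightarrow> N (\<Sum>i\<in>A. e (g i)) \<le> 1"
    and N_isometry: "bounded_linear T \<Longrightarrow> inj \<sigma> \<Longrightarrow> (\<And>i. \<kappa> (\<sigma> i) = \<kappa> i) \<Longrightarrow>
      (\<And>i w. (\<And>p. blk p \<noteq> i \<Longrightarrow> cf p w = 0) \<Longrightarrow>
        (\<forall>p. blk p \<noteq> \<sigma> i \<longrightarrow> cf p (T w) = 0) \<and>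
        (\<Sum>p\<in>blk -` {\<sigma> i}. (cf p (T w))\<^sup>2) = (\<Sum>p\<in>blk -` {i}. (cf p w)\<^sup>2)) \<Longrightarrow> N (T v) \<le> N v"

text \<open>The dual ball of \<open>c\<^sub>0\<close>-sums of Euclidean blocks, restricted to functionals that live on one block
  of each class; these already determine the norm.\<close>

definition selectors :: "(nat \<Rightarrow> nat) \<Rightarrow> (nat \<Rightarrow> nat) \<Rightarrow> (nat \<Rightarrow> real) set" where
  "selectors blk \<kappa> = {\<theta>. (\<forall>i. (\<Sum>p\<in>blk -` {i}. (\<theta> p)\<^sup>2) \<le> 1) \<and>
     (\<forall>p q. \<kappa> (blk p) = \<kappa> (blk q) \<longrightarrow> blk p \<noteq> blk q \<longrightarrow> \<theta> p = 0 \<or> \<theta> q = 0)}"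

section \<open>The block norm as a supremum over selectors\<close>

locale block_data =
  fixes u :: "nat \<Rightarrow> 'a::banach" and blk \<kappa> :: "nat \<Rightarrow> nat"
  assumes univ: "universal_unconditional_basis u" and fin: "finite (blk -` {i})"
    and two: "2 \<le> card (blk -` {i})" and surj: "surj \<kappa>"
begin

text \<open>On a \<open>discrete\<close> type every bounded function is continuous, so functions of
  selectors form a \<open>bcontfun\<close> space; the default 0 turns every index into a
  selector.\<close>

definition sel :: "(nat \<Rightarrow> real) discrete \<Rightarrow> nat \<Rightarrow> real" where
  "sel t = (if of_discrete t \<in> selectors blk \<kappa> then of_discrete t else (\<lambda>_. 0))"

text \<open>A vector is represented by the function that sends a selector to its pairing with the
  blocks, with one value in \<open>U\<close> per class. The supremum over selectors is the block
  norm.\<close>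

definition y :: "nat \<Rightarrow> ((nat \<Rightarrow> real) discrete \<Rightarrow>\<^sub>C 'a)" where
  "y p = Bcontfun (\<lambda>t. sel t p *\<^sub>R u (\<kappa> (blk p)))"

lemma norm_u: "norm (u i) = 1"
  using univ by (simp add: universal_unconditional_basis_def normalized_unconditional_basis_def)

lemma u_basis: "unconditional_basis_on UNIV u"
  using univ by (simp add: universal_unconditional_basis_def normalized_unconditional_basis_def)

lemma sel_selectors: "sel t \<in> selectors blk \<kappa>"
  by (simp add: sel_def) (simp add: selectors_def)

lemma sel_discrete: "\<theta> \<in> selectors blk \<kappa> \<Longrightarrow> sel (discrete \<theta>) = \<theta>"
  by (simp add: sel_def discrete_inverse)

lemma selectors_abs_le:
  assumes "\<theta> \<in> selectors blk \<kappa>" shows "\<bar>\<theta> p\<bar> \<le> 1"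
proof -
  have "(\<theta> p)\<^sup>2 \<le> (\<Sum>q\<in>blk -` {blk p}. (\<theta> q)\<^sup>2)"
    using fin by (intro member_le_sum) auto
  also have "\<dots> \<le> 1" using assms by (simp add: selectors_def)
  finally show ?thesis by (simp add: abs_square_le_1)
qed

lemma selectors_mono:
  assumes "\<theta> \<in> selectors blk \<kappa>" "\<And>p. \<eta> p = \<theta> p \<or> \<eta> p = 0"
  shows "\<eta> \<in> selectors blk \<kappa>"
proof -
  have "(\<Sum>p\<in>blk -` {i}. (\<eta> p)\<^sup>2) \<le> (\<Sum>p\<in>blk -` {i}. (\<theta> p)\<^sup>2)" for i
    using assms(2) by (intro sum_mono) (metis order_refl zero_le_power2 zero_power2)
  then show ?thesis using assms unfolding selectors_def by (auto intro: order_trans) metis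
qed

text \<open>On a set with at most one vector from each class, a single selector reads off all
  coefficients unchanged; there the norm of \<open>y\<close> dominates that of
  \<open>u\<close>.\<close>

lemma transversal_selector:
  assumes "\<And>p q. p \<in> R \<Longrightarrow> q \<in> R \<Longrightarrow> \<kappa> (blk p) = \<kappa> (blk q) \<Longrightarrow> p = q"
  shows "(\<lambda>p. if p \<in> R then 1 else 0) \<in> selectors blk \<kappa>"
proof -
  have "(\<Sum>p\<in>blk -` {i}. (if p \<in> R then 1 else 0 :: real)\<^sup>2) \<le> 1" for i
  proof (cases "\<exists>p\<in>R. blk p = i")
    case True
    then obtain p where p: "p \<in> R" "blk p = i" by blast
    have "(\<Sum>q\<in>blk -` {i}. (if q \<in> R then 1 else 0 :: real)\<^sup>2) = (\<Sum>q\<in>blk -` {i}. if q = p then 1 else 0)"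
      using p assms by (intro sum.cong) auto
    also have "\<dots> \<le> 1" using fin by simp
    finally show ?thesis .
  next
    case False
    then have "(\<Sum>q\<in>blk -` {i}. (if q \<in> R then 1 else 0 :: real)\<^sup>2) = 0" by (intro sum.neutral) auto
    then show ?thesis by simp
  qed
  then show ?thesis using assms by (auto simp: selectors_def)
qed

lemma apply_y: "apply_bcontfun (y p) t = sel t p *\<^sub>R u (\<kappa> (blk p))"
proof -
  have "(\<lambda>t. sel t p *\<^sub>R u (\<kappa> (blk p))) \<in> bcontfun"
  proof (rule bcontfun_normI)
    show "continuous_on UNIV (\<lambda>t. sel t p *\<^sub>R u (\<kappa> (blk p)))"
      unfolding continuous_on_open_vimage[OF open_UNIV] by (simp add: open_discrete)
    show "norm (sel t p *\<^sub>R u (\<kappa> (blk p))) \<le> 1" for t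
      using selectors_abs_le[OF sel_selectors] by (simp add: norm_u)
  qed
  then show ?thesis by (simp add: y_def Bcontfun_inverse)
qed

lemma apply_sum_y:
  "apply_bcontfun (\<Sum>i\<in>F. a i *\<^sub>R y (g i)) t = (\<Sum>i\<in>F. (a i * sel t (g i)) *\<^sub>R u (\<kappa> (blk (g i))))"
  by (induction F rule: infinite_finite_induct) (simp_all add: apply_y)

lemma norm_sum_y_ge:
  assumes "\<theta> \<in> selectors blk \<kappa>"
  shows "norm (\<Sum>i\<in>F. (a i * \<theta> (g i)) *\<^sub>R u (\<kappa> (blk (g i)))) \<le> norm (\<Sum>i\<in>F. a i *\<^sub>R y (g i))"
  using norm_bounded[of "\<Sum>i\<in>F. a i *\<^sub>R y (g i)" "discrete \<theta>"]
  by (simp add: apply_sum_y sel_discrete[OF assms])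

lemma norm_sum_y_le:
  assumes "\<And>\<theta>. \<theta> \<in> selectors blk \<kappa> \<Longrightarrow> norm (\<Sum>i\<in>F. (a i * \<theta> (g i)) *\<^sub>R u (\<kappa> (blk (g i)))) \<le> B"
  shows "norm (\<Sum>i\<in>F. a i *\<^sub>R y (g i)) \<le> B"
  by (rule norm_bound) (simp add: apply_sum_y assms sel_selectors)

lemma norm_y: "norm (y p) = 1"
proof (rule antisym)
  show "norm (y p) \<le> 1"
    by (rule norm_bound) (simp add: apply_y norm_u selectors_abs_le sel_selectors)
  have "(\<lambda>q. if q \<in> {p} then 1 else 0) \<in> selectors blk \<kappa>" by (rule transversal_selector) simp
  then show "1 \<le> norm (y p)" using norm_sum_y_ge[where F = "{p}" and a = "\<lambda>_. 1" and g = "\<lambda>q. q"] norm_u by force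
qed

lemma y_inj_basic:
  assumes g: "inj g"
  shows "normalized_unconditional_basic_sequence (\<lambda>i. y (g i))"
proof (rule suppression_unconditional_basic_sequence)
  fix F G :: "nat set" and a assume FG: "finite G" "F \<subseteq> G"
  show "norm (\<Sum>i\<in>F. a i *\<^sub>R y (g i)) \<le> norm (\<Sum>i\<in>G. a i *\<^sub>R y (g i))"
  proof (rule norm_sum_y_le)
    fix \<theta> assume \<theta>: "\<theta> \<in> selectors blk \<kappa>"
    \<comment> \<open>Deleting summands amounts to zeroing the selector; injectivity of
      \<open>g\<close> keeps the remaining summands intact.\<close>
    define \<eta> where "\<eta> = (\<lambda>p. if p \<in> g ` F then \<theta> p else 0)"
    have \<eta>: "\<eta> \<in> selectors blk \<kappa>" using \<theta> by (rule selectors_mono) (simp add: \<eta>_def)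
    have "(\<Sum>i\<in>F. (a i * \<theta> (g i)) *\<^sub>R u (\<kappa> (blk (g i)))) = (\<Sum>i\<in>G. (a i * \<eta> (g i)) *\<^sub>R u (\<kappa> (blk (g i))))"
      using FG g by (intro sum.mono_neutral_cong_left) (auto simp: \<eta>_def dest: injD)
    then show "norm (\<Sum>i\<in>F. (a i * \<theta> (g i)) *\<^sub>R u (\<kappa> (blk (g i)))) \<le> norm (\<Sum>i\<in>G. a i *\<^sub>R y (g i))"
      using norm_sum_y_ge[OF \<eta>, where a = a and g = g and F = G] by simp
  qed
qed (rule norm_y)

lemma y_inj_summable_iff:
  assumes "inj g"
  shows "summable (\<lambda>i. a i *\<^sub>R y (g i)) \<longleftrightarrow> (\<lambda>i. a i *\<^sub>R y (g i)) summable_on UNIV"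
  using y_inj_basic[OF assms] unfolding normalized_unconditional_basic_sequence_def
  by (intro unconditional_basis_summable_iff[of "closure (span (range (\<lambda>i. y (g i))))"])
     (auto intro: closure_subspace subspace_span)

section \<open>Each of the sequences \<open>u\<close> and \<open>y\<close> embeds in the
  other\<close>

definition pick :: "nat \<Rightarrow> nat" where "pick k = (SOME p. \<kappa> (blk p) = k)"

lemma pick: "\<kappa> (blk (pick k)) = k"
proof -
  obtain i where "\<kappa> i = k" using surj by (metis surjD)
  moreover have "blk -` {i} \<noteq> {}" using two[of i] by force
  ultimately have "\<exists>p. \<kappa> (blk p) = k" by auto
  then show ?thesis unfolding pick_def by (rule someI_ex)
qed

lemma inj_pick: "inj pick"
  using pick by (metis injI)

text \<open>On one vector per class a selector acts as a multiplier bounded by 1, which costs a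
  factor 2; conversely the selector that is 1 on these vectors recovers the norm of
  \<open>u\<close>.\<close>

lemma u_pick_summable_iff:
  "(\<lambda>k. a k *\<^sub>R u k) summable_on UNIV \<longleftrightarrow> (\<lambda>k. a k *\<^sub>R y (pick k)) summable_on UNIV"
proof
  assume "(\<lambda>k. a k *\<^sub>R u k) summable_on UNIV"
  then obtain s where s: "((\<lambda>k. a k *\<^sub>R u k) has_sum s) UNIV" by (auto simp: summable_on_def)
  have "summable (\<lambda>k. a k *\<^sub>R y (pick k))"
    unfolding summable_Cauchy
  proof (intro allI impI)
    fix r :: real assume r: "r > 0"
    \<comment> \<open>Two deviations of \<open>r / 6\<close> bound a tail by \<open>r / 3\<close>,
      and the multipliers double it to \<open>2 * (r / 3) < r\<close>.\<close>
    then have "\<forall>\<^sub>F G in finite_subsets_at_top UNIV. dist (\<Sum>k\<in>G. a k *\<^sub>R u k) s < r / 6"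
      using s unfolding has_sum_def tendsto_iff by (auto dest: spec[of _ "r / 6"])
    then obtain F where F: "finite F" "\<And>G. finite G \<Longrightarrow> F \<subseteq> G \<Longrightarrow> dist (\<Sum>k\<in>G. a k *\<^sub>R u k) s < r / 6"
      unfolding eventually_finite_subsets_at_top by auto
    have small: "norm (\<Sum>k\<in>G. a k *\<^sub>R u k) \<le> r / 3" if "finite G" "G \<inter> F = {}" for G
    proof -
      have "(\<Sum>k\<in>G. a k *\<^sub>R u k) = ((\<Sum>k\<in>G \<union> F. a k *\<^sub>R u k) - s) - ((\<Sum>k\<in>F. a k *\<^sub>R u k) - s)"
        using that F(1) by (simp add: sum.union_disjoint)
      also have "norm \<dots> \<le> norm ((\<Sum>k\<in>G \<union> F. a k *\<^sub>R u k) - s) + norm ((\<Sum>k\<in>F. a k *\<^sub>R u k) - s)"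
        by (rule norm_triangle_ineq4)
      also have "\<dots> \<le> r / 6 + r / 6"
        using F(2)[of "G \<union> F"] F(2)[of F] F(1) that by (intro add_mono) (auto simp: dist_norm)
      finally show ?thesis by simp
    qed
    obtain M where M: "\<And>k. k \<in> F \<Longrightarrow> k < M"
      using F(1) unfolding finite_nat_set_iff_bounded by blast
    have "norm (\<Sum>k\<in>{m..<n}. a k *\<^sub>R y (pick k)) < r" if "m \<ge> M" for m n
    proof -
      have "norm (\<Sum>k\<in>{m..<n}. a k *\<^sub>R y (pick k)) \<le> 2 * (r / 3)"
      proof (rule norm_sum_y_le)
        fix \<theta> assume \<theta>: "\<theta> \<in> selectors blk \<kappa>"
        have "norm (\<Sum>k\<in>{m..<n}. \<theta> (pick k) *\<^sub>R (a k *\<^sub>R u k)) \<le> 2 * (r / 3)"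
        proof (rule norm_sum_multiplier_le)
          fix G assume G: "G \<subseteq> {m..<n}"
          show "norm (\<Sum>k\<in>G. a k *\<^sub>R u k) \<le> r / 3"
          proof (rule small)
            show "finite G" using G by (rule finite_subset) simp
            have "k \<notin> F" if "k \<in> G" for k using M[of k] \<open>m \<ge> M\<close> G that by force
            then show "G \<inter> F = {}" by blast
          qed
        qed (simp_all add: selectors_abs_le[OF \<theta>])
        then show "norm (\<Sum>k\<in>{m..<n}. (a k * \<theta> (pick k)) *\<^sub>R u (\<kappa> (blk (pick k)))) \<le> 2 * (r / 3)"
          by (simp add: pick mult.commute)
      qed
      then show ?thesis using r by simp
    qed
    then show "\<exists>M. \<forall>m\<ge>M. \<forall>n. norm (\<Sum>k\<in>{m..<n}. a k *\<^sub>R y (pick k)) < r" by blast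
  qed
  then show "(\<lambda>k. a k *\<^sub>R y (pick k)) summable_on UNIV" by (simp add: y_inj_summable_iff inj_pick)
next
  assume "(\<lambda>k. a k *\<^sub>R y (pick k)) summable_on UNIV"
  then have s: "summable (\<lambda>k. a k *\<^sub>R y (pick k))" by (simp add: y_inj_summable_iff inj_pick)
  have \<theta>: "(\<lambda>p. if p \<in> range pick then 1 else 0) \<in> selectors blk \<kappa>"
    by (rule transversal_selector) (auto simp: pick)
  have "norm (\<Sum>k\<in>F. a k *\<^sub>R u k) \<le> norm (\<Sum>k\<in>F. a k *\<^sub>R y (pick k))" for F
    using norm_sum_y_ge[OF \<theta>, where a = a and g = pick and F = F] by (simp add: pick)
  then have "summable (\<lambda>k. a k *\<^sub>R u k)"
    using s unfolding summable_Cauchy by (meson order_le_less_trans)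
  then show "(\<lambda>k. a k *\<^sub>R u k) summable_on UNIV"
    using unconditional_basis_summable_iff[OF closed_UNIV subspace_UNIV u_basis] by simp
qed

lemma u_permutation_equivalent_y:
  obtains \<pi> :: "nat \<Rightarrow> nat" where "bij \<pi>"
    "\<And>a. (\<lambda>i. a i *\<^sub>R y i) summable_on UNIV \<longleftrightarrow> (\<lambda>i. a i *\<^sub>R u (\<pi> i)) summable_on UNIV"
proof -
  have inj_id: "inj (\<lambda>i::nat. i)" by simp
  obtain s where s: "strict_mono s" "equivalent_sequences y (u \<circ> s)"
    using universal_unconditional_basisD[OF univ y_inj_basic[OF inj_id]] by blast
  have ys: "(\<lambda>i. a i *\<^sub>R y i) summable_on UNIV \<longleftrightarrow> (\<lambda>i. a i *\<^sub>R u (s i)) summable_on UNIV" for a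
    using s(2) y_inj_summable_iff[OF inj_id] unconditional_basis_subseq_summable_iff[OF u_basis s(1)]
    by (simp add: equivalent_sequences_def)
  show ?thesis
    by (rule unconditional_Schroeder_Bernstein[OF strict_mono_imp_inj_on[OF s(1)] inj_pick ys u_pick_summable_iff])
       (rule that)
qed

text \<open>The new selector is the transpose of \<open>A\<close> applied to \<theta>, and the
  transpose of a contraction is a contraction: if \<open>S\<close> is its squared length on a block,
  Cauchy-Schwarz gives \<open>S\<^sup>2 \<le> S\<close>. It still lives on one block of each class
  because \<sigma> is injective and preserves classes.\<close>

lemma pullback_selector:
  assumes \<theta>: "\<theta> \<in> selectors blk \<kappa>" and \<sigma>: "inj \<sigma>" "\<And>i. \<kappa> (\<sigma> i) = \<kappa> i"
    and A: "\<And>i w. (\<Sum>q\<in>blk -` {\<sigma> i}. (\<Sum>p\<in>blk -` {i}. w p * A q p)\<^sup>2) \<le> (\<Sum>p\<in>blk -` {i}. (w p)\<^sup>2)"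
  shows "(\<lambda>p. \<Sum>q\<in>blk -` {\<sigma> (blk p)}. \<theta> q * A q p) \<in> selectors blk \<kappa>" (is "?\<eta> \<in> _")
proof -
  have "(\<Sum>p\<in>blk -` {i}. (?\<eta> p)\<^sup>2) \<le> 1" for i
  proof -
    define S where "S = (\<Sum>p\<in>blk -` {i}. (?\<eta> p)\<^sup>2)"
    have "S = (\<Sum>p\<in>blk -` {i}. \<Sum>q\<in>blk -` {\<sigma> i}. \<theta> q * (?\<eta> p * A q p))"
      unfolding S_def by (intro sum.cong refl) (simp add: power2_eq_square sum_distrib_left mult_ac)
    also have "\<dots> = (\<Sum>q\<in>blk -` {\<sigma> i}. \<theta> q * (\<Sum>p\<in>blk -` {i}. ?\<eta> p * A q p))"
      by (subst sum.swap) (simp add: sum_distrib_left)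
    finally have "S\<^sup>2 \<le> (\<Sum>q\<in>blk -` {\<sigma> i}. (\<theta> q)\<^sup>2) * (\<Sum>q\<in>blk -` {\<sigma> i}. (\<Sum>p\<in>blk -` {i}. ?\<eta> p * A q p)\<^sup>2)"
      using Cauchy_Schwarz_ineq_sum by simp
    also have "\<dots> \<le> 1 * S"
      unfolding S_def using \<theta> A by (intro mult_mono) (auto simp: selectors_def sum_nonneg)
    finally have "S * S \<le> 1 * S" by (simp add: power2_eq_square)
    moreover have "S \<ge> 0" by (simp add: S_def sum_nonneg)
    ultimately show ?thesis unfolding S_def[symmetric] by (metis mult_le_cancel_right not_le order_le_less zero_le_one)
  qed
  moreover have "?\<eta> p = 0 \<or> ?\<eta> q = 0" if "\<kappa> (blk p) = \<kappa> (blk q)" "blk p \<noteq> blk q" for p q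
  proof (rule ccontr)
    assume "\<not> ?thesis"
    then obtain p' q' where "p' \<in> blk -` {\<sigma> (blk p)}" "\<theta> p' \<noteq> 0" "q' \<in> blk -` {\<sigma> (blk q)}" "\<theta> q' \<noteq> 0"
      by (metis (no_types, lifting) mult_zero_left sum.neutral)
    then show False using \<theta> that \<sigma> by (auto simp: selectors_def dest: injD) (metis injD)
  qed
  ultimately show ?thesis by (simp add: selectors_def)
qed

end

lemma has_sum_ext:
  assumes f: "bounded_linear f" and g: "bounded_linear g" and fg: "\<And>p. f (e p) = g (e p)"
    and v: "((\<lambda>p. a p *\<^sub>R e p) has_sum v) UNIV"
  shows "f v = g v"
proof -
  interpret f: bounded_linear f by (rule f)
  interpret g: bounded_linear g by (rule g)
  have "((\<lambda>p. f (a p *\<^sub>R e p)) has_sum f v) UNIV" using has_sum_bounded_linear[OF f v] by (simp add: comp_def)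
  moreover have "((\<lambda>p. g (a p *\<^sub>R e p)) has_sum g v) UNIV" using has_sum_bounded_linear[OF g v] by (simp add: comp_def)
  ultimately show ?thesis by (simp add: f.scaleR g.scaleR fg has_sum_unique)
qed

section \<open>Transport of the block norm to the given space\<close>

context block_data begin

text \<open>A permutation \<open>e\<close> of \<open>u\<close> is equivalent to \<open>y\<close>, so
  the linear map \<open>z\<close> with \<open>z (e p) = y p\<close> is bounded above and below;
  \<open>N\<close> is the norm pulled back along \<open>z\<close>.\<close>

theorem block_space_exists:
  obtains e :: "nat \<Rightarrow> 'a" and cf N where "block_space e cf blk \<kappa> N"
proof -
  obtain \<pi> where \<pi>: "bij \<pi>"
    and yu: "\<And>a. (\<lambda>i. a i *\<^sub>R y i) summable_on UNIV \<longleftrightarrow> (\<lambda>i. a i *\<^sub>R u (\<pi> i)) summable_on UNIV"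
    using u_permutation_equivalent_y by blast
  define e where "e = (\<lambda>p. u (\<pi> p))"
  have norm_e: "norm (e p) = 1" for p by (simp add: e_def norm_u)
  define uc where "uc = (\<lambda>v. THE a. (\<lambda>i. a i *\<^sub>R u i) sums v)"
  have ex1: "\<exists>!a. (\<lambda>i. a i *\<^sub>R u i) sums v" for v
    using u_basis by (simp add: unconditional_basis_on_def schauder_basis_on_def)
  have uc: "(\<lambda>i. uc v i *\<^sub>R u i) sums v" for v unfolding uc_def by (rule theI'[OF ex1])
  have ucI: "uc v = a" if "(\<lambda>i. a i *\<^sub>R u i) sums v" for v a using ex1[of v] uc[of v] that by blast
  have schauder_u: "schauder_basis_on UNIV u" using u_basis by (simp add: unconditional_basis_on_def)
  \<comment> \<open>Taking \<open>u\<close> for both sequences bounds the partial sums, and with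
    them the coordinate functionals.\<close>
  obtain C where C: "C > 0" "\<And>v a n. (\<lambda>i. a i *\<^sub>R u i) sums v \<Longrightarrow> norm (\<Sum>i<n. a i *\<^sub>R u i) \<le> C * norm v"
    using basis_dominates[OF closed_UNIV subspace_UNIV schauder_u norm_u, of u] by auto
  have uc_le: "\<bar>uc v i\<bar> \<le> (2 * C) * norm v" for v i
  proof -
    have "\<bar>uc v i\<bar> = norm ((\<Sum>j<Suc i. uc v j *\<^sub>R u j) - (\<Sum>j<i. uc v j *\<^sub>R u j))" by (simp add: norm_u)
    also have "\<dots> \<le> C * norm v + C * norm v"
      using norm_triangle_ineq4 C(2)[OF uc] by (meson add_mono order_trans)
    finally show ?thesis by simp
  qed
  have uc_bl: "bounded_linear (\<lambda>v. uc v i)" for i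
  proof (rule bounded_linear_intro)
    have "uc (v + w) = (\<lambda>i. uc v i + uc w i)" for v w
      using sums_add[OF uc[of v] uc[of w]] by (intro ucI) (simp add: scaleR_add_left)
    then show "uc (v + w) i = uc v i + uc w i" for v w by simp
    have "uc (c *\<^sub>R v) = (\<lambda>i. c * uc v i)" for c v
      using sums_scaleR_right[OF uc[of v], of c] by (intro ucI) simp
    then show "uc (c *\<^sub>R v) i = c *\<^sub>R uc v i" for c v by simp
    show "norm (uc v i) \<le> norm v * (2 * C)" for v using uc_le[of v i] by (simp add: mult.commute)
  qed
  have uc_has_sum: "((\<lambda>i. uc v i *\<^sub>R u i) has_sum v) UNIV" for v
  proof -
    have "(\<lambda>i. uc v i *\<^sub>R u i) summable_on UNIV"
      using uc[of v] u_basis by (simp add: unconditional_basis_on_def)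
    then obtain s where s: "((\<lambda>i. uc v i *\<^sub>R u i) has_sum s) UNIV" by (auto simp: summable_on_def)
    then have "s = v" using has_sum_imp_sums uc sums_unique2 by blast
    then show ?thesis using s by simp
  qed
  define cf where "cf = (\<lambda>p v. uc v (\<pi> p))"
  have cf_bl: "bounded_linear (cf p)" for p unfolding cf_def by (rule uc_bl)
  note cf_lin = bounded_linear.linear[OF cf_bl]
  have "uc (u i) = (\<lambda>j. if j = i then 1 else 0)" for i
    using sums_single[of i "\<lambda>j. u j"] by (intro ucI) (simp add: if_distrib[of "\<lambda>c. c *\<^sub>R _"] cong: if_cong)
  then have cf_e: "cf p (e q) = (if p = q then 1 else 0)" for p q
    using bij_is_inj[OF \<pi>] by (simp add: cf_def e_def inj_eq)
  have expand: "((\<lambda>p. cf p v *\<^sub>R e p) has_sum v) UNIV" for v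
    using has_sum_reindex_bij_betw[OF \<pi>, of "\<lambda>i. uc v i *\<^sub>R u i" v] uc_has_sum[of v] by (simp add: cf_def e_def)
  have e_sums: "a = (\<lambda>p. cf p v)" if a: "(\<lambda>p. a p *\<^sub>R e p) sums v" for a v
  proof
    fix p
    interpret c: bounded_linear "cf p" by (rule cf_bl)
    have "(\<lambda>q. a q * cf p (e q)) sums cf p v" using c.sums[OF a] by (simp add: c.scaleR)
    moreover have "(\<lambda>q. a q * cf p (e q)) = (\<lambda>q. if q = p then a q else 0)" by (auto simp: cf_e)
    then have "(\<lambda>q. a q * cf p (e q)) sums a p" using sums_single[of p a] by simp
    ultimately show "a p = cf p v" using sums_unique2 by blast
  qed
  have schauder_e: "schauder_basis_on UNIV e"
    unfolding schauder_basis_on_def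
  proof (intro conjI ballI)
    show "\<exists>!a. (\<lambda>i. a i *\<^sub>R e i) sums v" for v
      by (rule ex1I[of _ "\<lambda>p. cf p v"]) (rule has_sum_imp_sums[OF expand], rule e_sums)
  qed simp
  have inj_id: "inj (\<lambda>i::nat. i)" by simp
  have e_to_y: "summable (\<lambda>p. a p *\<^sub>R y p)" if a: "summable (\<lambda>p. a p *\<^sub>R e p)" for a
  proof -
    obtain v where "(\<lambda>p. a p *\<^sub>R e p) sums v" using a by (auto simp: summable_def)
    then have "(\<lambda>p. a p *\<^sub>R e p) summable_on UNIV"
      using e_sums expand[of v] by (auto simp: summable_on_def)
    then show ?thesis using yu[of a] y_inj_summable_iff[OF inj_id, of a] by (simp add: e_def)
  qed
  have y_to_e: "summable (\<lambda>p. a p *\<^sub>R e p)" if "summable (\<lambda>p. a p *\<^sub>R y p)" for a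
  proof -
    have "(\<lambda>p. a p *\<^sub>R e p) summable_on UNIV"
      using that yu[of a] y_inj_summable_iff[OF inj_id, of a] by (simp add: e_def)
    then show ?thesis by (metis has_sum_imp_sums summable_on_def sums_summable)
  qed
  define V where "V = closure (span (range y))"
  have V: "closed V" "subspace V" unfolding V_def by (auto intro: closure_subspace subspace_span)
  have schauder_y: "schauder_basis_on V y"
    using y_inj_basic[OF inj_id]
    by (simp add: normalized_unconditional_basic_sequence_def unconditional_basis_on_def V_def)
  define z where "z = (\<lambda>v. \<Sum>p. cf p v *\<^sub>R y p)"
  have z: "(\<lambda>p. cf p v *\<^sub>R y p) sums z v" for v
    unfolding z_def using has_sum_imp_sums[OF expand[of v]] by (intro summable_sums e_to_y) (rule sums_summable)
  obtain K where K: "K > 0" "\<And>v a n. (\<lambda>i. a i *\<^sub>R e i) sums v \<Longrightarrow> norm (\<Sum>i<n. a i *\<^sub>R y i) \<le> K * norm v"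
    using basis_dominates[OF closed_UNIV subspace_UNIV schauder_e norm_e e_to_y] by auto
  obtain L where L: "L > 0" "\<And>v a n. v \<in> V \<Longrightarrow> (\<lambda>i. a i *\<^sub>R y i) sums v \<Longrightarrow> norm (\<Sum>i<n. a i *\<^sub>R e i) \<le> L * norm v"
    using basis_dominates[OF V schauder_y norm_y y_to_e] by blast
  have z_le: "norm (z v) \<le> K * norm v" for v
    using tendsto_norm[OF z[of v, unfolded sums_def]] K(2)[OF has_sum_imp_sums[OF expand[of v]]]
    by (intro LIMSEQ_le_const2) auto
  have yV: "y i \<in> V" for i
    unfolding V_def by (intro subsetD[OF closure_subset] span_base rangeI)
  then have "(\<Sum>i<n. cf i v *\<^sub>R y i) \<in> V" for n v using V(2) by (intro subspace_sum subspace_scale)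
  then have zV: "z v \<in> V" for v
    using z[of v] unfolding sums_def by (intro closed_sequentially[OF V(1), of "\<lambda>n. \<Sum>i<n. cf i v *\<^sub>R y i" "z v"])
  have z_ge: "norm v \<le> L * norm (z v)" for v
    using tendsto_norm[OF has_sum_imp_sums[OF expand[of v], unfolded sums_def]] L(2)[OF zV z, of v]
    by (intro LIMSEQ_le_const2) auto
  have z_bl: "bounded_linear z"
  proof (rule bounded_linear_intro)
    show "z (v + w) = z v + z w" for v w
      using sums_add[OF z[of v] z[of w]] z[of "v + w"]
      by (auto simp: linear_add[OF cf_lin] scaleR_add_left dest: sums_unique2)
    show "z (c *\<^sub>R v) = c *\<^sub>R z v" for c v
      using sums_scaleR_right[OF z[of v], of c] z[of "c *\<^sub>R v"]
      by (auto simp: linear_cmul[OF cf_lin] dest: sums_unique2)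
    show "norm (z v) \<le> norm v * K" for v using z_le[of v] by (simp add: mult.commute)
  qed
  interpret z: bounded_linear z by (rule z_bl)
  have z_e: "z (e p) = y p" for p
    using z[of "e p"] sums_single[of p y] by (auto simp: cf_e if_distrib[of "\<lambda>c. c *\<^sub>R _"] cong: if_cong dest: sums_unique2)
  define N where "N = (\<lambda>v. norm (z v))"
  have equiv: "equivalent_norm N"
    unfolding equivalent_norm_def
  proof (intro conjI exI allI)
    have "v = 0" if "z v = 0" for v using z_ge[of v] that by simp
    then show "is_norm N"
      by (auto simp: is_norm_def N_def z.zero z.scaleR z.add norm_triangle_ineq)
    show "0 < 1 / L" "0 < K" using K L by auto
    show "1 / L * norm v \<le> N v" for v using z_ge[of v] L(1) by (simp add: N_def field_simps)
    show "N v \<le> K * norm v" for v using z_le by (simp add: N_def)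
  qed
  have trans: "N (\<Sum>i\<in>A. e (g i)) \<le> 1"
    if A: "finite A" "\<And>i. i \<in> A \<Longrightarrow> blk (g i) = i \<and> \<kappa> i = k" for A g k
  proof -
    have "norm (\<Sum>i\<in>A. 1 *\<^sub>R y (g i)) \<le> 1"
    proof (rule norm_sum_y_le)
      fix \<theta> assume \<theta>: "\<theta> \<in> selectors blk \<kappa>"
      have "\<theta> (g i) = 0 \<or> \<theta> (g j) = 0" if "i \<in> A" "j \<in> A" "i \<noteq> j" for i j
        using \<theta> A(2)[OF that(1)] A(2)[OF that(2)] that(3) unfolding selectors_def by simp
      \<comment> \<open>A selector sees at most one block of the class, so at most one summand
        survives.\<close>
      then obtain j where j: "\<And>i. i \<in> A \<Longrightarrow> i \<noteq> j \<Longrightarrow> \<theta> (g i) = 0" by metis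
      have "(\<Sum>i\<in>A. (1 * \<theta> (g i)) *\<^sub>R u (\<kappa> (blk (g i)))) = (\<Sum>i\<in>A \<inter> {j}. \<theta> (g i) *\<^sub>R u (\<kappa> (blk (g i))))"
        using A(1) j by (intro sum.mono_neutral_cong_right) auto
      then show "norm (\<Sum>i\<in>A. (1 * \<theta> (g i)) *\<^sub>R u (\<kappa> (blk (g i)))) \<le> 1"
        using selectors_abs_le[OF \<theta>] by (cases "j \<in> A") (auto simp: norm_u)
    qed
    then show ?thesis by (simp add: N_def z.sum z_e)
  qed
  have isom: "N (T v) \<le> N v"
    if T: "bounded_linear T" and \<sigma>: "inj \<sigma>" "\<And>i. \<kappa> (\<sigma> i) = \<kappa> i"
      and iso: "\<And>i w. (\<And>p. blk p \<noteq> i \<Longrightarrow> cf p w = 0) \<Longrightarrow>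
        (\<forall>p. blk p \<noteq> \<sigma> i \<longrightarrow> cf p (T w) = 0) \<and>
        (\<Sum>p\<in>blk -` {\<sigma> i}. (cf p (T w))\<^sup>2) = (\<Sum>p\<in>blk -` {i}. (cf p w)\<^sup>2)" for T \<sigma> v
  proof -
    interpret T: bounded_linear T by (rule T)
    \<comment> \<open>The matrix of \<open>T\<close>: it vanishes except from block \<open>i\<close>
      to block \<open>\<sigma> i\<close>, and is isometric there.\<close>
    define A where "A = (\<lambda>q p. cf q (T (e p)))"
    have A0: "A q p = 0" if "blk q \<noteq> \<sigma> (blk p)" for q p
      using iso[of "blk p" "e p"] that by (fastforce simp: A_def cf_e)
    have Te: "T (e p) = (\<Sum>q\<in>blk -` {\<sigma> (blk p)}. A q p *\<^sub>R e q)" for p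
    proof (rule has_sum_unique)
      show "((\<lambda>q. cf q (T (e p)) *\<^sub>R e q) has_sum T (e p)) UNIV" by (rule expand)
      have "((\<lambda>q. A q p *\<^sub>R e q) has_sum (\<Sum>q\<in>blk -` {\<sigma> (blk p)}. A q p *\<^sub>R e q)) (blk -` {\<sigma> (blk p)})"
        using fin by (rule has_sum_finite)
      then have "((\<lambda>q. A q p *\<^sub>R e q) has_sum (\<Sum>q\<in>blk -` {\<sigma> (blk p)}. A q p *\<^sub>R e q)) UNIV"
        by (rule has_sum_cong_neutral[THEN iffD1, rotated 3]) (auto simp: A0)
      then show "((\<lambda>q. cf q (T (e p)) *\<^sub>R e q) has_sum (\<Sum>q\<in>blk -` {\<sigma> (blk p)}. A q p *\<^sub>R e q)) UNIV"
        by (simp add: A_def)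
    qed
    have Ale: "(\<Sum>q\<in>blk -` {\<sigma> i}. (\<Sum>p\<in>blk -` {i}. w p * A q p)\<^sup>2) \<le> (\<Sum>p\<in>blk -` {i}. (w p)\<^sup>2)" for i w
    proof -
      define x where "x = (\<Sum>p\<in>blk -` {i}. w p *\<^sub>R e p)"
      have cfx: "cf q x = (\<Sum>p\<in>blk -` {i}. w p * cf q (e p))" for q
        unfolding x_def by (simp add: linear_sum[OF cf_lin] linear_cmul[OF cf_lin])
      have cfx1: "cf q x = (if blk q = i then w q else 0)" for q
        unfolding cfx cf_e using fin by (auto simp: if_distrib cong: if_cong)
      have cfT: "cf q (T x) = (\<Sum>p\<in>blk -` {i}. w p * A q p)" for q
        unfolding x_def A_def by (simp add: T.sum T.scaleR linear_sum[OF cf_lin] linear_cmul[OF cf_lin])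
      have "(\<Sum>p\<in>blk -` {\<sigma> i}. (cf p (T x))\<^sup>2) = (\<Sum>p\<in>blk -` {i}. (cf p x)\<^sup>2)"
        using iso[of i x] by (simp add: cfx1)
      then show ?thesis by (simp add: cfT cfx1)
    qed
    show ?thesis
      unfolding N_def
    proof (rule norm_bound)
      fix t
      \<comment> \<open>Evaluating \<open>z (T v)\<close> at \<open>t\<close> is evaluating
        \<open>z v\<close> at the transposed selector \<eta>, which bounds it by
        \<open>norm (z v)\<close>.\<close>
      define \<eta> where "\<eta> = (\<lambda>p. \<Sum>q\<in>blk -` {\<sigma> (blk p)}. sel t q * A q p)"
      have \<eta>: "\<eta> \<in> selectors blk \<kappa>"
        unfolding \<eta>_def by (rule pullback_selector[OF sel_selectors \<sigma> Ale])
      have ev: "bounded_linear (\<lambda>w. apply_bcontfun (z w) s)" for s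
        by (rule bounded_linear_intro[where K = K])
           (use norm_bounded z_le in \<open>auto simp: z.add z.scaleR mult.commute intro: order_trans\<close>)
      have "apply_bcontfun (z (T v)) t = apply_bcontfun (z v) (discrete \<eta>)"
      proof (rule has_sum_ext[OF _ ev _ expand])
        show "bounded_linear (\<lambda>v. apply_bcontfun (z (T v)) t)"
          using bounded_linear_compose[OF ev T] .
        fix p
        have "apply_bcontfun (z (T (e p))) t = (\<Sum>q\<in>blk -` {\<sigma> (blk p)}. (A q p * sel t q) *\<^sub>R u (\<kappa> (blk q)))"
          unfolding Te by (simp add: z.sum z.scaleR z_e apply_sum_y)
        also have "\<dots> = (\<Sum>q\<in>blk -` {\<sigma> (blk p)}. (sel t q * A q p) *\<^sub>R u (\<kappa> (blk p)))"
          by (rule sum.cong) (auto simp: \<sigma>(2) mult.commute)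
        also have "\<dots> = \<eta> p *\<^sub>R u (\<kappa> (blk p))" by (simp add: \<eta>_def scaleR_sum_left)
        finally show "apply_bcontfun (z (T (e p))) t = apply_bcontfun (z (e p)) (discrete \<eta>)"
          by (simp add: z_e apply_y sel_discrete[OF \<eta>])
      qed
      then show "norm (apply_bcontfun (z (T v)) t) \<le> norm (z v)" using norm_bounded by metis
    qed
  qed
  have "block_space e cf blk \<kappa> N"
    by (rule block_space.intro, (rule cf_bl cf_e expand norm_e fin two equiv trans; assumption)+, erule isom; blast)
  then show ?thesis by (rule that)
qed

end


section \<open>Isometric reflections\<close>

lemma is_normD:
  assumes "is_norm M"
  shows "0 \<le> M x" "M x = 0 \<longleftrightarrow> x = 0" "M (c *\<^sub>R x) = \<bar>c\<bar> * M x" "M (x + y) \<le> M x + M y"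
    "M (- x) = M x" "M (x - y) \<le> M x + M y" "M 0 = 0"
proof -
  show 1: "0 \<le> M x" "M x = 0 \<longleftrightarrow> x = 0" "M (c *\<^sub>R x) = \<bar>c\<bar> * M x" "M (x + y) \<le> M x + M y" for x y c
    using assms by (auto simp: is_norm_def)
  show 2: "M (- x) = M x" for x using 1(3)[of "-1" x] by simp
  show "M (x - y) \<le> M x + M y" using 1(4)[of x "- y"] 2[of y] by simp
  show "M 0 = 0" by (simp add: 1(2))
qed

lemma Isom_compose: "S \<in> Isom M \<Longrightarrow> T \<in> Isom M \<Longrightarrow> (\<lambda>x. S (T x)) \<in> Isom M"
  unfolding Isom_def using linear_compose[of T S] comp_surj[of T S] by (auto simp: comp_def)

lemma Isom_id: "(\<lambda>x. x) \<in> Isom M"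
  by (simp add: Isom_def linear_iff)

lemma Isom_bij:
  assumes M: "is_norm M" and T: "T \<in> Isom M"
  shows "bij T"
proof -
  have lin: "linear T" and "surj T" and MT: "\<And>x. M (T x) = M x" using T by (auto simp: Isom_def)
  have "x = y" if "T x = T y" for x y
  proof -
    have "M (x - y) = M (T (x - y))" by (simp add: MT)
    also have "\<dots> = 0" using that by (simp add: linear_diff[OF lin] is_normD[OF M])
    finally show ?thesis using is_normD(2)[OF M, of "x - y"] by simp
  qed
  then show ?thesis using \<open>surj T\<close> by (simp add: bij_def inj_def)
qed

lemma linear_inv_into:
  assumes "linear T" "bij T"
  shows "linear (inv_into UNIV T)"
proof -
  have eq: "inv_into UNIV T x = y" if "T y = x" for x y
    using that assms(2) by (simp add: bij_is_inj inv_f_eq)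
  have TT: "T (inv_into UNIV T x) = x" for x using assms(2) by (simp add: bij_is_surj surj_f_inv_f)
  show ?thesis
    by (intro linearI eq) (simp_all add: linear_add[OF assms(1)] linear_cmul[OF assms(1)] TT)
qed

lemma Isom_inv:
  assumes M: "is_norm M" and T: "T \<in> Isom M"
  shows "inv_into UNIV T \<in> Isom M"
proof -
  have b: "bij T" by (rule Isom_bij[OF assms])
  have "M (inv_into UNIV T x) = M x" for x
    using T b by (metis (mono_tags, lifting) Isom_def bij_is_surj mem_Collect_eq surj_f_inv_f)
  then show ?thesis using T b by (simp add: Isom_def linear_inv_into bij_is_surj bij_imp_bij_inv)
qed

lemma Isom_involution:
  assumes "linear T" "\<And>v. T (T v) = v" "\<And>v. N (T v) \<le> N v"
  shows "T \<in> Isom N"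
proof -
  have "N (T v) = N v" for v using assms(2)[of v] assms(3)[of v] assms(3)[of "T v"] by simp
  then show ?thesis using assms unfolding Isom_def by (auto simp: surj_def) metis
qed

text \<open>The kernel of \<open>f\<close> is the mirror and \<open>x\<close> spans the line that is
  reversed. For an equivalent norm, continuity of \<open>f\<close> follows from the invariance by
  \<open>reflects_norm_le\<close>.\<close>

definition reflects :: "('a::real_vector \<Rightarrow> real) \<Rightarrow> 'a \<Rightarrow> ('a \<Rightarrow> real) \<Rightarrow> bool" where
  "reflects M x f \<longleftrightarrow> linear f \<and> f x = 1 \<and> (\<forall>v. M (v - (2 * f v) *\<^sub>R x) = M v)"

lemma reflects_iff_Isom:
  "reflects M x f \<longleftrightarrow> linear f \<and> f x = 1 \<and> (\<lambda>v. v - (2 * f v) *\<^sub>R x) \<in> Isom M"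
proof
  assume r: "reflects M x f"
  then have f: "linear f" "f x = 1" by (auto simp: reflects_def)
  have "(\<lambda>v. v - (2 * f v) *\<^sub>R x) \<in> Isom M"
  proof (rule Isom_involution)
    show "linear (\<lambda>v. v - (2 * f v) *\<^sub>R x)"
      by (rule linearI) (simp_all add: linear_add[OF f(1)] linear_cmul[OF f(1)] algebra_simps)
    show "v - (2 * f v) *\<^sub>R x - (2 * f (v - (2 * f v) *\<^sub>R x)) *\<^sub>R x = v" for v
      by (simp add: linear_diff[OF f(1)] linear_cmul[OF f(1)] f(2) algebra_simps)
    show "M (v - (2 * f v) *\<^sub>R x) \<le> M v" for v using r by (simp add: reflects_def)
  qed
  then show "linear f \<and> f x = 1 \<and> (\<lambda>v. v - (2 * f v) *\<^sub>R x) \<in> Isom M" using f by simp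
qed (simp add: reflects_def Isom_def)

lemma reflects_image:
  assumes r: "reflects M x f" and T: "T \<in> Isom M" "bij T"
  shows "reflects M (T x) (\<lambda>v. f (inv_into UNIV T v))"
  unfolding reflects_def
proof (intro conjI allI)
  have lin: "linear T" and MT: "\<And>v. M (T v) = M v" using T by (auto simp: Isom_def)
  have f: "linear f" "f x = 1" using r by (auto simp: reflects_def)
  show "linear (\<lambda>v. f (inv_into UNIV T v))"
    using linear_compose[OF linear_inv_into[OF lin T(2)] f(1)] by (simp add: comp_def)
  show "f (inv_into UNIV T (T x)) = 1" using T(2) f by (simp add: bij_is_inj)
  fix v
  obtain w where w: "v = T w" using T(2) by (meson bij_pointE)
  have "M (T w - (2 * f w) *\<^sub>R T x) = M (T (w - (2 * f w) *\<^sub>R x))"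
    by (simp add: linear_diff[OF lin] linear_cmul[OF lin])
  also have "\<dots> = M (T w)" using r by (simp add: MT reflects_def)
  finally show "M (v - (2 * f (inv_into UNIV T v)) *\<^sub>R T x) = M v"
    using T(2) by (simp add: w bij_is_inj)
qed

lemma reflects_pullback:
  assumes M: "is_norm M" and r: "reflects M (T x) f" and T: "T \<in> Isom M"
  obtains g where "reflects M x g"
proof -
  have b: "bij T" by (rule Isom_bij[OF M T])
  have "inv_into UNIV T (T x) = x" using b by (simp add: bij_is_inj)
  then show ?thesis
    using reflects_image[OF r Isom_inv[OF M T] bij_imp_bij_inv[OF b]] that by simp
qed

text \<open>The part along \<open>x\<close> and the part in the mirror are half the difference and
  half the sum of \<open>v\<close> and its image, which have the same norm.\<close>

lemma reflects_norm_le: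
  assumes M: "is_norm M" and r: "reflects M x f"
  shows "\<bar>f v\<bar> * M x \<le> M v" "M (v - f v *\<^sub>R x) \<le> M v"
proof -
  have MR: "M (v - (2 * f v) *\<^sub>R x) = M v" using r by (simp add: reflects_def)
  have "2 * (\<bar>f v\<bar> * M x) = M (v - (v - (2 * f v) *\<^sub>R x))" by (simp add: is_normD(3)[OF M] abs_mult)
  also have "\<dots> \<le> M v + M v" using is_normD(6)[OF M, of v "v - (2 * f v) *\<^sub>R x"] MR by simp
  finally show "\<bar>f v\<bar> * M x \<le> M v" by simp
  have "v - f v *\<^sub>R x = (1/2) *\<^sub>R (v + (v - (2 * f v) *\<^sub>R x))"
    by (simp add: algebra_simps flip: scaleR_add_left)
  then have "M (v - f v *\<^sub>R x) = (1/2) * M (v + (v - (2 * f v) *\<^sub>R x))"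
    using is_normD(3)[OF M, of "1/2"] by simp
  also have "\<dots> \<le> (1/2) * (M v + M v)" using is_normD(4)[OF M, of v "v - (2 * f v) *\<^sub>R x"] MR by simp
  finally show "M (v - f v *\<^sub>R x) \<le> M v" by simp
qed

text \<open>The powers of \<open>A\<close> send \<open>x\<close> to \<open>x\<close> plus all
  multiples of \<open>d\<close> by naturals, while the norm stays the same.\<close>

lemma unipotent_isometry_trivial:
  assumes M: "is_norm M" and A: "linear A" "\<And>v. M (A v) = M v" and d: "A d = d" "A x = x + d"
  shows "d = 0"
proof -
  have "M (x + real n *\<^sub>R d) = M x" for n
  proof (induction n)
    case (Suc n)
    have "A (x + real n *\<^sub>R d) = x + real (Suc n) *\<^sub>R d"
      by (simp add: linear_add[OF A(1)] linear_cmul[OF A(1)] d algebra_simps)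
    then show ?case using A(2)[of "x + real n *\<^sub>R d"] Suc by simp
  qed simp
  then have "real n * M d \<le> 2 * M x" for n
    using is_normD(6)[OF M, of "x + real n *\<^sub>R d" x] is_normD(3)[OF M, of "real n" d] by simp
  then have "M d \<le> 0" using reals_Archimedean3[of "M d"] by (metis less_le_not_le not_le)
  then show ?thesis using is_normD(1,2)[OF M, of d] by simp
qed

text \<open>For orthogonal reflections \<open>f y * g x\<close> is the squared cosine of the angle
  between \<open>x\<close> and \<open>y\<close>; the bounds say that it behaves so for any norm. In
  the borderline cases the product of the two reflections, or its negative, is unipotent on the span
  of \<open>x\<close> and \<open>y\<close>, which an isometry can only be trivially.\<close>

lemma reflects_pair:
  assumes M: "is_norm M" and x: "reflects M x f" and y: "reflects M y g"
  shows "0 \<le> f y * g x" "f y * g x \<le> 1" "f y * g x = 1 \<Longrightarrow> x = g x *\<^sub>R y"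
    "g x = 0 \<Longrightarrow> f y = 0"
proof -
  have f: "linear f" "f x = 1" and g: "linear g" "g y = 1" using x y by (auto simp: reflects_def)
  have x0: "M x > 0" and y0: "M y > 0"
    using f g is_normD(1,2)[OF M, of x] is_normD(1,2)[OF M, of y] linear_0[OF f(1)] linear_0[OF g(1)]
    by (metis less_eq_real_def zero_neq_one)+
  have "(\<bar>f y\<bar> * M x) * (\<bar>g x\<bar> * M y) \<le> M y * M x"
    using reflects_norm_le(1)[OF M x, of y] reflects_norm_le(1)[OF M y, of x] x0 y0
    by (intro mult_mono) auto
  then have "\<bar>f y * g x\<bar> * (M x * M y) \<le> 1 * (M x * M y)" by (simp add: abs_mult mult_ac)
  then have "\<bar>f y * g x\<bar> \<le> 1" using x0 y0 by (simp add: mult_le_cancel_right)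
  then show "f y * g x \<le> 1" by simp
  have "\<bar>f (x - g x *\<^sub>R y)\<bar> * M x \<le> M x"
    using reflects_norm_le(1)[OF M x, of "x - g x *\<^sub>R y"] reflects_norm_le(2)[OF M y, of x] by simp
  then have "\<bar>1 - f y * g x\<bar> \<le> 1"
    using x0 by (simp add: linear_diff[OF f(1)] linear_cmul[OF f(1)] f(2) mult.commute)
  then show "0 \<le> f y * g x" by simp
  define A where "A = (\<lambda>v. (v - (2 * g v) *\<^sub>R y) - (2 * f (v - (2 * g v) *\<^sub>R y)) *\<^sub>R x)"
  have linA: "linear A"
    unfolding A_def by (rule linearI)
      (simp_all add: linear_add[OF f(1)] linear_cmul[OF f(1)] linear_diff[OF f(1)] linear_add[OF g(1)] linear_cmul[OF g(1)] algebra_simps)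
  have MA: "M (A v) = M v" for v using x y by (simp add: A_def reflects_def)
  show "x = g x *\<^sub>R y" if t: "f y * g x = 1"
  proof -
    define d where "d = 2 *\<^sub>R (x - g x *\<^sub>R y)"
    have fd: "f d = 0" using t by (simp add: d_def linear_diff[OF f(1)] linear_cmul[OF f(1)] f(2) mult.commute)
    have gd: "g d = 0" by (simp add: d_def linear_diff[OF g(1)] linear_cmul[OF g(1)] g(2))
    have "A d = d" by (simp add: A_def fd gd)
    moreover have "A x = x + d"
      using t by (simp add: A_def d_def linear_diff[OF f(1)] linear_cmul[OF f(1)] f(2) algebra_simps flip: scaleR_add_left)
    ultimately have "d = 0" by (rule unipotent_isometry_trivial[OF M linA MA])
    then show ?thesis by (simp add: d_def)
  qed
  show "f y = 0" if gx: "g x = 0"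
  proof -
    define d where "d = (2 * f y) *\<^sub>R x"
    have "linear (\<lambda>v. - A v)" using linA by (simp add: linear_iff)
    moreover have "M (- A v) = M v" for v by (simp add: is_normD(5)[OF M] MA)
    moreover have "- A d = d"
      by (simp add: A_def d_def linear_cmul[OF g(1)] linear_cmul[OF f(1)] gx f(2) algebra_simps flip: scaleR_add_left)
    moreover have "- A y = y + - d"
      by (simp add: A_def d_def g(2) linear_diff[OF f(1)] linear_cmul[OF f(1)] algebra_simps scaleR_2)
        (simp flip: scaleR_add_left)
    ultimately have "- d = 0"
      using unipotent_isometry_trivial[OF M, of "\<lambda>v. - A v" "- d" y] linear_neg[OF linA] by simp
    then show ?thesis using f(2) linear_0[OF f(1)] by (auto simp: d_def)
  qed
qed

section \<open>Euclidean geometry of the blocks\<close>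

context block_space begin

lemmas cf_lin = bounded_linear.linear[OF cf_bl]
lemmas cf_simps = linear_add[OF cf_lin] linear_diff[OF cf_lin] linear_cmul[OF cf_lin] linear_sum[OF cf_lin]
  linear_0[OF cf_lin] linear_neg[OF cf_lin]

lemma cf_eqI: assumes "\<And>p. cf p v = cf p w" shows "v = w"
  using has_sum_unique[OF expand[of v]] expand[of w] by (simp add: assms)

definition E :: "nat \<Rightarrow> 'a set" where "E i = {v. \<forall>p. blk p \<noteq> i \<longrightarrow> cf p v = 0}"

definition P :: "nat \<Rightarrow> 'a \<Rightarrow> 'a" where "P i v = (\<Sum>p\<in>blk -` {i}. cf p v *\<^sub>R e p)"

definition B :: "nat \<Rightarrow> 'a \<Rightarrow> 'a \<Rightarrow> real" where "B i v w = (\<Sum>p\<in>blk -` {i}. cf p v * cf p w)"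

lemma subspace_E: "subspace (E i)"
  by (auto simp: subspace_def E_def cf_simps)

lemma e_in_E: "e p \<in> E (blk p)" by (auto simp: E_def cf_e)

lemma cf_P: "cf p (P i v) = (if blk p = i then cf p v else 0)"
  by (simp add: P_def cf_simps cf_e if_distrib fin cong: if_cong)

lemma P_in_E: "P i v \<in> E i" by (simp add: E_def cf_P)

lemma P_E: "w \<in> E i \<Longrightarrow> P j w = (if i = j then w else 0)"
  by (rule cf_eqI) (auto simp: cf_P E_def cf_simps)

lemma P_bl: "bounded_linear (P i)"
  unfolding P_def by (intro bounded_linear_sum bounded_linear_scaleR_const cf_bl)

lemmas P_lin = bounded_linear.linear[OF P_bl]
lemmas P_simps = linear_add[OF P_lin] linear_diff[OF P_lin] linear_cmul[OF P_lin] linear_sum[OF P_lin]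
  linear_0[OF P_lin] linear_neg[OF P_lin]

lemma P_P: "P j (P i v) = (if i = j then P i v else 0)" using P_E[OF P_in_E] .

lemma B_bl: "bounded_linear (B i v)"
  unfolding B_def by (intro bounded_linear_sum bounded_linear_const_mult cf_bl)

lemmas B_lin = bounded_linear.linear[OF B_bl]
lemmas B_simps_right = linear_add[OF B_lin] linear_diff[OF B_lin] linear_cmul[OF B_lin] linear_0[OF B_lin] linear_neg[OF B_lin]

lemma B_commute: "B i v w = B i w v" by (simp add: B_def mult.commute)

lemma B_simps_left:
  "B i (v + v') w = B i v w + B i v' w" "B i (v - v') w = B i v w - B i v' w" "B i (c *\<^sub>R v) w = c * B i v w"
  "B i 0 w = 0"
  by (simp_all add: B_commute[of i _ w] B_simps_right)

lemmas B_simps = B_simps_left B_simps_right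

lemma B_P: "B i (P i v) w = B i v w" "B i v (P i w) = B i v w"
  by (simp_all add: B_def cf_P)

lemma B_nonneg: "0 \<le> B i v v" by (simp add: B_def sum_nonneg)

lemma B_E_other: "w \<in> E j \<Longrightarrow> i \<noteq> j \<Longrightarrow> B i w v = 0" "w \<in> E j \<Longrightarrow> i \<noteq> j \<Longrightarrow> B i v w = 0"
  by (auto simp: B_def E_def intro!: sum.neutral)

lemma B_eq_0_iff: "w \<in> E i \<Longrightarrow> B i w w = 0 \<longleftrightarrow> w = 0"
proof
  assume w: "w \<in> E i" "B i w w = 0"
  then have "\<forall>p\<in>blk -` {i}. cf p w * cf p w = 0"
    unfolding B_def by (subst (asm) sum_nonneg_eq_0_iff) (auto simp: fin)
  then have "cf p w = 0" for p using w(1) by (cases "blk p = i") (auto simp: E_def)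
  then show "w = 0" by (intro cf_eqI) (simp add: cf_simps)
qed (simp add: B_simps)

lemma B_pos: "w \<in> E i \<Longrightarrow> w \<noteq> 0 \<Longrightarrow> 0 < B i w w"
  using B_eq_0_iff B_nonneg by (metis order_le_less)

lemma block_reflection:
  assumes w: "w \<in> E i" "w \<noteq> 0"
  shows "reflects N w (\<lambda>v. B i w v / B i w w)"
proof -
  define R where "R = (\<lambda>v. v - (2 * (B i w v / B i w w)) *\<^sub>R w)"
  have pos: "B i w w > 0" using B_pos[OF w] .
  have bl: "bounded_linear R"
    unfolding R_def divide_inverse by (intro bounded_linear_sub bounded_linear_ident bounded_linear_scaleR_const bounded_linear_const_mult
      bounded_linear_mult_const B_bl)
  have "R \<in> Isom N"
  proof (rule Isom_involution)
    show "linear R" using bl by (rule bounded_linear.linear)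
    show "R (R v) = v" for v using pos by (simp add: R_def B_simps algebra_simps)
    show "N (R v) \<le> N v" for v
    proof (rule N_isometry[OF bl, of "\<lambda>j. j"])
      fix j x assume "\<And>p. blk p \<noteq> j \<Longrightarrow> cf p x = 0"
      then have x: "x \<in> E j" by (simp add: E_def)
      have "R x \<in> E j \<and> B j (R x) (R x) = B j x x"
      proof (cases "i = j")
        case True
        then show ?thesis using x w pos subspace_E[of j]
          by (auto simp: R_def subspace_diff subspace_scale B_simps B_commute[of j x w] field_simps power2_eq_square)
      next
        case False
        then show ?thesis using x by (simp add: R_def B_E_other)
      qed
      then show "(\<forall>p. blk p \<noteq> j \<longrightarrow> cf p (R x) = 0) \<and> (\<Sum>p\<in>blk -` {j}. (cf p (R x))\<^sup>2) = (\<Sum>p\<in>blk -` {j}. (cf p x)\<^sup>2)"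
        by (simp add: E_def B_def power2_eq_square)
    qed simp_all
  qed
  then show ?thesis
    using pos bounded_linear.linear[OF B_bl[of i w]] unfolding reflects_iff_Isom R_def
    by (auto simp: linear_iff add_divide_distrib)
qed

text \<open>A bijection between the two blocks permutes coordinates, and \<open>N_isometry\<close>
  applies because transposing two blocks of one class preserves classes.\<close>

lemma block_swap:
  assumes ij: "i \<noteq> j" "\<kappa> i = \<kappa> j" "card (blk -` {i}) = card (blk -` {j})"
  obtains S where "S \<in> Isom N" "\<And>w. w \<in> E i \<Longrightarrow> S w \<in> E j" "\<And>k w. k \<noteq> i \<Longrightarrow> k \<noteq> j \<Longrightarrow> w \<in> E k \<Longrightarrow> S w = w"
    "\<And>w. w \<in> E i \<Longrightarrow> B j (S w) (S w) = B i w w"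
proof -
  obtain h where h: "bij_betw h (blk -` {i}) (blk -` {j})"
    using finite_same_card_bij[OF fin fin ij(3)] by blast
  define h' where "h' = inv_into (blk -` {i}) h"
  have hb: "blk (h p) = j" if "blk p = i" for p using h that by (auto dest: bij_betwE)
  have h'b: "blk (h' p) = i" if "blk p = j" for p
    using bij_betw_inv_into[OF h] that by (auto simp: h'_def dest: bij_betwE)
  have hh': "h (h' p) = p" if "blk p = j" for p
    using h that by (simp add: h'_def bij_betw_inv_into_right)
  have h'h: "h' (h p) = p" if "blk p = i" for p
    using h that by (simp add: h'_def bij_betw_inv_into_left)
  define \<tau> where "\<tau> = (\<lambda>p. if blk p = i then h p else if blk p = j then h' p else p)"
  have \<tau>\<tau>: "\<tau> (\<tau> p) = p" for p using ij(1) by (auto simp: \<tau>_def hb h'b hh' h'h)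
  have b\<tau>: "blk (\<tau> p) = Transposition.transpose i j (blk p)" for p
    using ij(1) by (auto simp: \<tau>_def hb h'b Transposition.transpose_def)
  \<comment> \<open>Written as a finite correction of the identity, \<open>S\<close> is visibly
    bounded; its coordinates are those of \<open>v\<close> permuted by the involution
    \<tau>.\<close>
  define S where "S = (\<lambda>v. v + (\<Sum>p\<in>blk -` {i} \<union> blk -` {j}. (cf (\<tau> p) v - cf p v) *\<^sub>R e p))"
  have cfS: "cf q (S v) = cf (\<tau> q) v" for q v
  proof -
    have "cf q (S v) = cf q v + (\<Sum>p\<in>blk -` {i} \<union> blk -` {j}. if q = p then cf (\<tau> p) v - cf p v else 0)"
      by (auto simp: S_def cf_simps cf_e intro!: sum.cong)
    also have "\<dots> = cf (\<tau> q) v" using fin by (auto simp: \<tau>_def)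
    finally show ?thesis .
  qed
  have bl: "bounded_linear S"
    unfolding S_def by (intro bounded_linear_add bounded_linear_ident bounded_linear_sum bounded_linear_scaleR_const
      bounded_linear_sub cf_bl)
  have im: "\<tau> ` (blk -` {k}) = blk -` {Transposition.transpose i j k}" for k
  proof
    show "blk -` {Transposition.transpose i j k} \<subseteq> \<tau> ` (blk -` {k})"
    proof
      fix q assume "q \<in> blk -` {Transposition.transpose i j k}"
      then have "\<tau> q \<in> blk -` {k}" by (simp add: b\<tau>)
      then show "q \<in> \<tau> ` (blk -` {k})" using \<tau>\<tau>[of q] by (metis imageI)
    qed
  qed (auto simp: b\<tau>)
  have inj: "inj_on \<tau> X" for X using \<tau>\<tau> by (metis inj_onI)
  have EE: "S w \<in> E (Transposition.transpose i j k) \<and> B (Transposition.transpose i j k) (S w) (S w) = B k w w"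
    if w: "w \<in> E k" for k w
  proof
    show "S w \<in> E (Transposition.transpose i j k)"
    proof -
      have "cf (\<tau> p) w = 0" if "blk p \<noteq> Transposition.transpose i j k" for p
      proof -
        have "blk (\<tau> p) \<noteq> k" using that by (auto simp: b\<tau>)
        then show ?thesis using w by (simp add: E_def)
      qed
      then show ?thesis by (simp add: E_def cfS)
    qed
    have "B (Transposition.transpose i j k) (S w) (S w) = (\<Sum>p\<in>\<tau> ` (blk -` {k}). cf (\<tau> p) w * cf (\<tau> p) w)"
      by (simp add: B_def im cfS)
    also have "\<dots> = B k w w" by (subst sum.reindex[OF inj]) (simp add: \<tau>\<tau> B_def)
    finally show "B (Transposition.transpose i j k) (S w) (S w) = B k w w" .
  qed
  have "S \<in> Isom N"
  proof (rule Isom_involution)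
    show "linear S" using bl by (rule bounded_linear.linear)
    show "S (S v) = v" for v by (rule cf_eqI) (simp add: cfS \<tau>\<tau>)
    show "N (S v) \<le> N v" for v
    proof (rule N_isometry[OF bl, of "Transposition.transpose i j"])
      show "\<kappa> (Transposition.transpose i j k) = \<kappa> k" for k using ij(2) by (simp add: Transposition.transpose_def)
      fix k x assume "\<And>p. blk p \<noteq> k \<Longrightarrow> cf p x = 0"
      then have "x \<in> E k" by (simp add: E_def)
      from EE[OF this] show "(\<forall>p. blk p \<noteq> Transposition.transpose i j k \<longrightarrow> cf p (S x) = 0) \<and>
          (\<Sum>p\<in>blk -` {Transposition.transpose i j k}. (cf p (S x))\<^sup>2) = (\<Sum>p\<in>blk -` {k}. (cf p x)\<^sup>2)"
        by (simp add: E_def B_def power2_eq_square)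
    qed simp
  qed
  moreover have "S w = w" if "k \<noteq> i" "k \<noteq> j" "w \<in> E k" for k w
    using that by (intro cf_eqI) (auto simp: cfS \<tau>_def E_def hb h'b)
  moreover have "S w \<in> E j" "B j (S w) (S w) = B i w w" if "w \<in> E i" for w
    using EE[OF that] by simp_all
  ultimately show ?thesis by (intro that[of S]) auto
qed

end


section \<open>Rotations generated by a reflection\<close>

text \<open>The case \<open>M = N\<close> is included, so that all results also apply to the block
  norm itself.\<close>

locale block_over = block_space +
  fixes M :: "'a \<Rightarrow> real"
  assumes M_equiv: "equivalent_norm M" and sub: "Isom N \<subseteq> Isom M"
begin

lemma M_norm: "is_norm M" using M_equiv by (simp add: equivalent_norm_def)

lemmas M_simps = is_normD[OF M_norm]

lemma M_bounds: obtains c C where "c > 0" "C > 0" "\<And>x. c * norm x \<le> M x" "\<And>x. M x \<le> C * norm x"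
  using M_equiv by (auto simp: equivalent_norm_def)

lemma M_tendsto:
  assumes "(X \<longlongrightarrow> x) F" shows "((\<lambda>n. M (X n)) \<longlongrightarrow> M x) F"
proof -
  obtain c C where C: "C > 0" "\<And>x. M x \<le> C * norm x" using M_bounds by metis
  have le: "\<bar>M v - M w\<bar> \<le> C * norm (v - w)" for v w
  proof -
    have "M v \<le> M (v - w) + M w" "M w \<le> M (v - w) + M v"
      using M_simps(4)[of "v - w" w] M_simps(4)[of "w - v" v] M_simps(5)[of "v - w"] by simp_all
    then show ?thesis using C(2)[of "v - w"] by linarith
  qed
  have "((\<lambda>n. M (X n) - M x) \<longlongrightarrow> 0) F"
  proof (rule Lim_null_comparison)
    show "\<forall>\<^sub>F n in F. norm (M (X n) - M x) \<le> C * norm (X n - x)" using le by simp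
    show "((\<lambda>n. C * norm (X n - x)) \<longlongrightarrow> 0) F"
      using assms by (intro tendsto_mult_right_zero tendsto_norm_zero) (simp add: LIM_zero)
  qed
  then show ?thesis by (simp add: LIM_zero_iff)
qed

lemma block_reflects: "w \<in> E i \<Longrightarrow> w \<noteq> 0 \<Longrightarrow> reflects M w (\<lambda>v. B i w v / B i w w)"
  using block_reflection[of w i] sub unfolding reflects_iff_Isom by auto

text \<open>The reflection along \<open>w - w'\<close> exchanges two vectors of equal length and
  fixes whatever has no part in the block.\<close>

lemma block_rotation:
  assumes w: "w \<in> E i" "w' \<in> E i" "B i w w = B i w' w'"
  obtains h where "h \<in> Isom M" "h w = w'" "\<And>v. P i v = 0 \<Longrightarrow> h v = v"
proof (cases "w = w'")
  case True
  then have "(\<lambda>x. x) w = w'" by simp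
  with Isom_id show ?thesis by (rule that[of "\<lambda>x. x"]) (rule refl)
next
  case False
  define d where "d = w - w'"
  have d: "d \<in> E i" "d \<noteq> 0" using w False subspace_E by (auto simp: d_def subspace_diff)
  have pos: "B i d d > 0" using B_pos[OF d] .
  have Bd: "2 * B i d w = B i d d" using w(3) by (simp add: d_def B_simps B_commute[of i w' w])
  define h where "h = (\<lambda>v. v - (2 * (B i d v / B i d d)) *\<^sub>R d)"
  have "h \<in> Isom M" using block_reflects[OF d] by (simp add: reflects_iff_Isom h_def)
  moreover have two: "2 * (B i d w / B i d d) = 1"
    unfolding times_divide_eq_right Bd using pos by (intro divide_self) simp
  have "h w = w'" unfolding h_def two by (simp add: d_def)
  moreover have "h v = v" if "P i v = 0" for v
    using B_P(2)[of i d v] that by (simp add: h_def B_simps)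
  ultimately show ?thesis by (intro that[of h])
qed

definition \<mu> :: "nat \<Rightarrow> real" where "\<mu> i = M (e (SOME p. blk p = i))"

lemma ex_blk: "\<exists>p. blk p = i"
proof -
  have "blk -` {i} \<noteq> {}" using two[of i] by force
  then show ?thesis by auto
qed

lemma \<mu>_pos: "\<mu> i > 0"
proof -
  have "e p \<noteq> 0" for p using norm_e[of p] by auto
  then show ?thesis unfolding \<mu>_def using M_simps(1,2) by (metis less_eq_real_def)
qed

text \<open>Rotations are transitive on the spheres of a block, so \<open>M\<close> is a multiple of
  the Euclidean norm there, with factor \<open>\<mu> i\<close>.\<close>

lemma M_E: assumes w: "w \<in> E i" shows "(M w)\<^sup>2 = (\<mu> i)\<^sup>2 * B i w w"
proof -
  define p where "p = (SOME p. blk p = i)"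
  have p: "blk p = i" unfolding p_def by (rule someI_ex[OF ex_blk])
  have Bp: "B i (e p) (e p) = 1"
    using p fin by (simp add: B_def cf_e if_distrib cong: if_cong)
  have pE: "sqrt (B i w w) *\<^sub>R e p \<in> E i" using e_in_E[of p] p subspace_E by (simp add: subspace_scale)
  have "B i w w = B i (sqrt (B i w w) *\<^sub>R e p) (sqrt (B i w w) *\<^sub>R e p)"
    using Bp B_nonneg by (simp add: B_simps)
  then obtain h where h: "h \<in> Isom M" "h w = sqrt (B i w w) *\<^sub>R e p"
    using block_rotation[OF w pE] by metis
  have "M (h w) = M w" using h(1) by (simp add: Isom_def)
  then have "M w = M (sqrt (B i w w) *\<^sub>R e p)" by (simp add: h(2))
  also have "\<dots> = sqrt (B i w w) * \<mu> i" using B_nonneg by (simp add: M_simps \<mu>_def p_def)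
  finally show ?thesis using B_nonneg by (simp add: power_mult_distrib mult.commute)
qed

text \<open>Two basis vectors in the block always combine to a nonzero vector orthogonal to
  \<open>x\<close>; the freedom to prescribe inner products rests on this.\<close>

lemma ex_orthogonal_unit:
  assumes x: "x \<in> E i"
  obtains z where "z \<in> E i" "B i x z = 0" "B i z z = 1"
proof -
  obtain p q where pq: "p \<noteq> q" "blk p = i" "blk q = i"
  proof -
    obtain p where p: "blk p = i" using ex_blk by blast
    have "card (blk -` {i} - {p}) \<noteq> 0" using two[of i] p fin[of i] by (simp add: card_Diff_singleton)
    then obtain q where "q \<in> blk -` {i} - {p}" by (metis all_not_in_conv card.empty)
    then show ?thesis using that[of p q] p by auto
  qed
  have Bx: "B i x (e r) = cf r x" if "blk r = i" for r
    using that fin by (simp add: B_def cf_e if_distrib cong: if_cong)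
  define y where "y = (if cf p x = 0 then e p else cf q x *\<^sub>R e p - cf p x *\<^sub>R e q)"
  have yE: "y \<in> E i" using e_in_E[of p] e_in_E[of q] pq subspace_E
    by (auto simp: y_def subspace_diff subspace_scale)
  have xy: "B i x y = 0" by (simp add: y_def B_simps Bx pq)
  have "cf (if cf p x = 0 then p else q) y \<noteq> 0" using pq by (simp add: y_def cf_simps cf_e)
  then have "y \<noteq> 0" by (auto simp: cf_simps)
  then have pos: "B i y y > 0" using B_pos[OF yE] by simp
  show ?thesis
  proof (rule that[of "(1 / sqrt (B i y y)) *\<^sub>R y"])
    show "B i ((1 / sqrt (B i y y)) *\<^sub>R y) ((1 / sqrt (B i y y)) *\<^sub>R y) = 1"
      using pos by (simp add: B_simps field_simps)
  qed (use yE xy subspace_E in \<open>auto simp: subspace_scale B_simps\<close>)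
qed

lemma ex_prescribed_angle:
  assumes x: "x \<in> E i" "x \<noteq> 0" and b: "b\<^sup>2 \<le> B i x x * s" and s: "0 \<le> s"
  obtains w where "w \<in> E i" "B i x w = b" "B i w w = s"
proof -
  obtain z where z: "z \<in> E i" "B i x z = 0" "B i z z = 1" using ex_orthogonal_unit[OF x(1)] by blast
  define \<rho> where "\<rho> = B i x x"
  have \<rho>: "\<rho> > 0" using B_pos[OF x] by (simp add: \<rho>_def)
  have t: "0 \<le> s - b\<^sup>2 / \<rho>" using b \<rho> by (simp add: \<rho>_def field_simps)
  show ?thesis
  proof (rule that[of "(b / \<rho>) *\<^sub>R x + sqrt (s - b\<^sup>2 / \<rho>) *\<^sub>R z"])
    show "(b / \<rho>) *\<^sub>R x + sqrt (s - b\<^sup>2 / \<rho>) *\<^sub>R z \<in> E i"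
      using x z subspace_E by (simp add: subspace_add subspace_scale)
    show "B i x ((b / \<rho>) *\<^sub>R x + sqrt (s - b\<^sup>2 / \<rho>) *\<^sub>R z) = b"
      using \<rho> z by (simp add: B_simps \<rho>_def)
    have "B i ((b / \<rho>) *\<^sub>R x + sqrt (s - b\<^sup>2 / \<rho>) *\<^sub>R z) ((b / \<rho>) *\<^sub>R x + sqrt (s - b\<^sup>2 / \<rho>) *\<^sub>R z)
        = (b / \<rho>)\<^sup>2 * \<rho> + (sqrt (s - b\<^sup>2 / \<rho>))\<^sup>2"
      using z B_commute[of i z x] by (simp add: B_simps \<rho>_def power2_eq_square algebra_simps)
    also have "\<dots> = s" using t \<rho> by (simp add: power2_eq_square)
    finally show "B i ((b / \<rho>) *\<^sub>R x + sqrt (s - b\<^sup>2 / \<rho>) *\<^sub>R z) ((b / \<rho>) *\<^sub>R x + sqrt (s - b\<^sup>2 / \<rho>) *\<^sub>R z) = s" .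
  qed
qed

lemma reflects_orthogonal:
  assumes "reflects M x f" "w \<in> E i" "B i x w = 0"
  shows "f w = 0"
proof (cases "w = 0")
  case False
  then show ?thesis
    using reflects_pair(4)[OF M_norm assms(1) block_reflects[OF assms(2) False]] assms(3) B_commute[of i x w] by simp
qed (use assms(1) in \<open>simp add: reflects_def linear_0\<close>)

text \<open>The mirror contains the part of the block orthogonal to \<open>x\<close>, so on the
  block \<open>f\<close> is a multiple of the inner product with \<open>x\<close>.\<close>

lemma reflects_on_block:
  assumes r: "reflects M x f" and w: "w \<in> E i" and x: "P i x \<noteq> 0"
  shows "f w = f (P i x) * B i x w / B i x x"
proof -
  have f: "linear f" using r by (simp add: reflects_def)
  have \<rho>: "B i x x > 0" using B_pos[OF P_in_E x] by (simp add: B_P)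
  define w0 where "w0 = w - (B i x w / B i x x) *\<^sub>R P i x"
  have "w0 \<in> E i" using w P_in_E subspace_E by (simp add: w0_def subspace_diff subspace_scale)
  moreover have "B i x w0 = 0" using \<rho> by (simp add: w0_def B_simps B_P)
  ultimately have "f w0 = 0" using reflects_orthogonal[OF r] by blast
  then show ?thesis by (simp add: w0_def linear_diff[OF f] linear_cmul[OF f])
qed

text \<open>Rotations of block \<open>a\<close> and the reflection along \<open>x\<close> belong to
  it, with all their products. Its members leave in place the vectors of other blocks that are
  orthogonal to \<open>x\<close>.\<close>

definition mover :: "'a \<Rightarrow> ('a \<Rightarrow> real) \<Rightarrow> nat \<Rightarrow> ('a \<Rightarrow> 'a) set" where
  "mover x f a = {h \<in> Isom M. \<forall>v. P a v = 0 \<longrightarrow> f v = 0 \<longrightarrow> h v = v}"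

lemma mover_compose: "g \<in> mover x f a \<Longrightarrow> h \<in> mover x f a \<Longrightarrow> (\<lambda>v. g (h v)) \<in> mover x f a"
  by (simp add: mover_def Isom_compose)

text \<open>By \<open>reflects_form\<close>, \<open>f (P a x)\<close> will turn out to be the share
  of block \<open>a\<close> in the squared \<open>M\<close>-length of \<open>x\<close>. At this
  stage the bounds come from \<open>reflects_pair\<close> with the reflection along
  \<open>P a x\<close>.\<close>

lemma reflects_weight:
  assumes r: "reflects M x f" and x: "P a x \<noteq> 0" "x - P a x \<noteq> 0"
  shows "0 < f (P a x)" "f (P a x) < 1"
proof -
  have \<rho>: "B a x x > 0" using B_pos[OF P_in_E x(1)] by (simp add: B_P)
  note pair = reflects_pair[OF M_norm r block_reflects[OF P_in_E x(1)]]
  have g: "B a (P a x) x / B a (P a x) (P a x) = 1" using \<rho> by (simp add: B_P)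
  have "f (P a x) \<noteq> 1" using pair(3) g x(2) by auto
  moreover have "f (P a x) \<noteq> 0"
  proof
    assume "f (P a x) = 0"
    from reflects_pair(4)[OF M_norm block_reflects[OF P_in_E x(1)] r this] g show False by simp
  qed
  ultimately show "0 < f (P a x)" "f (P a x) < 1" using pair(1,2) g by auto
qed

text \<open>Rotate \<open>w\<close> inside the block so that its inner product with \<open>x\<close> becomes \<open>b\<close>, then reflect along \<open>x\<close>.
  Taking \<open>b = 0\<close> repeatedly makes \<open>\<beta>\<close> decay geometrically, and once it is small a suitable \<open>b\<close> kills it.\<close>

lemma rotation_step:
  assumes r: "reflects M x f" and x: "P a x \<noteq> 0" "x - P a x \<noteq> 0"
    and w: "w \<in> E a" and b: "b\<^sup>2 \<le> B a x x * B a w w"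
  defines "q \<equiv> f (P a x)" and "\<rho> \<equiv> B a x x" and "x' \<equiv> x - P a x"
  obtains h w1 where "h \<in> mover x f a" "w1 \<in> E a"
    "h (w + \<beta> *\<^sub>R x') = w1 + ((2 * q - 1) * \<beta> - 2 * q * b / \<rho>) *\<^sub>R x'"
    "q * B a w1 w1 / \<rho> + (1 - q) * ((2 * q - 1) * \<beta> - 2 * q * b / \<rho>)\<^sup>2 = q * B a w w / \<rho> + (1 - q) * \<beta>\<^sup>2"
proof -
  have f: "linear f" "f x = 1" using r by (auto simp: reflects_def)
  have \<rho>: "\<rho> > 0" using B_pos[OF P_in_E x(1)] by (simp add: B_P \<rho>_def)
  have "b\<^sup>2 \<le> B a (P a x) (P a x) * B a w w" using b by (simp add: B_P)
  then obtain w' where w': "w' \<in> E a" "B a x w' = b" "B a w' w' = B a w w"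
    using ex_prescribed_angle[OF P_in_E x(1) _ B_nonneg] by (metis B_P(1))
  obtain k where k: "k \<in> Isom M" "k w = w'" "\<And>v. P a v = 0 \<Longrightarrow> k v = v"
    using block_rotation[OF w w'(1)] w'(3) by metis
  have kl: "linear k" using k(1) by (simp add: Isom_def)
  have Px': "P a x' = 0" by (simp add: x'_def P_simps P_P)
  have k1: "k (w + \<beta> *\<^sub>R x') = w' + \<beta> *\<^sub>R x'"
    using k(3)[OF Px'] by (simp add: linear_add[OF kl] linear_cmul[OF kl] k(2))
  \<comment> \<open>The value of \<open>f\<close> at the rotated vector: reflecting subtracts
    \<open>2 * s\<close> times \<open>x\<close>, which changes \<beta> to
    \<open>\<beta> - 2 * s\<close>.\<close>
  define s where "s = q * b / \<rho> + (1 - q) * \<beta>"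
  have fx': "f x' = 1 - q" by (simp add: x'_def q_def linear_diff[OF f(1)] f(2))
  have fw': "f w' = q * b / \<rho>"
    using reflects_on_block[OF r w'(1) x(1)] by (simp add: q_def \<rho>_def w'(2))
  have fs: "f (w' + \<beta> *\<^sub>R x') = s"
    by (simp add: linear_add[OF f(1)] linear_cmul[OF f(1)] fx' fw' s_def)
  define h where "h = (\<lambda>v. k v - (2 * f (k v)) *\<^sub>R x)"
  have Rm: "(\<lambda>v. v - (2 * f v) *\<^sub>R x) \<in> mover x f a"
    using r unfolding reflects_iff_Isom mover_def by simp
  have km: "k \<in> mover x f a" using k by (simp add: mover_def)
  have hm: "h \<in> mover x f a" unfolding h_def using mover_compose[OF Rm km] .
  define w1 where "w1 = w' - (2 * s) *\<^sub>R P a x"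
  have w1: "w1 \<in> E a" using w'(1) P_in_E subspace_E by (simp add: w1_def subspace_diff subspace_scale)
  have \<beta>1: "(2 * q - 1) * \<beta> - 2 * q * b / \<rho> = \<beta> - 2 * s"
    by (simp add: s_def algebra_simps)
  have "x = P a x + x'" by (simp add: x'_def)
  then have "h (w + \<beta> *\<^sub>R x') = w' + \<beta> *\<^sub>R x' - (2 * s) *\<^sub>R (P a x + x')"
    by (simp add: h_def k1 fs)
  then have "h (w + \<beta> *\<^sub>R x') = w1 + ((2 * q - 1) * \<beta> - 2 * q * b / \<rho>) *\<^sub>R x'"
    unfolding \<beta>1 by (simp add: w1_def algebra_simps)
  moreover have Bw1: "B a w1 w1 = B a w w - 4 * s * b + 4 * s\<^sup>2 * \<rho>"
    using B_commute[of a w' x] by (simp add: w1_def B_simps B_P w' \<rho>_def power2_eq_square algebra_simps)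
  have "q * B a w1 w1 / \<rho> = q * B a w w / \<rho> - 4 * s * (q * b / \<rho>) + 4 * s\<^sup>2 * q"
    unfolding Bw1 using \<rho> by (simp add: field_simps)
  then have "q * B a w1 w1 / \<rho> + (1 - q) * (\<beta> - 2 * s)\<^sup>2 = q * B a w w / \<rho> + (1 - q) * \<beta>\<^sup>2
      + 4 * s * (s - q * b / \<rho> - (1 - q) * \<beta>)"
    by (simp add: algebra_simps power2_eq_square)
  then have "q * B a w1 w1 / \<rho> + (1 - q) * ((2 * q - 1) * \<beta> - 2 * q * b / \<rho>)\<^sup>2 = q * B a w w / \<rho> + (1 - q) * \<beta>\<^sup>2"
    unfolding \<beta>1 by (simp add: s_def)
  ultimately show ?thesis using hm w1 by (intro that)
qed

text \<open>\<open>rotation_step\<close> preserves a quadratic form in the block part and \<beta>.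
  Once \<beta> is 0 the vector lies in the block, where \<open>M_E\<close> evaluates the form; so
  \<open>M\<close> is Euclidean on block \<open>a\<close> together with
  \<open>x - P a x\<close>.\<close>

lemma rotation_into_block:
  assumes r: "reflects M x f" and x: "P a x \<noteq> 0" "x - P a x \<noteq> 0" and w: "w \<in> E a"
  obtains h where "h \<in> mover x f a" "h (w + \<beta> *\<^sub>R (x - P a x)) \<in> E a"
    "(M (w + \<beta> *\<^sub>R (x - P a x)))\<^sup>2 = (\<mu> a)\<^sup>2 * (B a w w + B a x x * ((1 - f (P a x)) / f (P a x)) * \<beta>\<^sup>2)"
proof -
  define q where "q = f (P a x)"
  define \<rho> where "\<rho> = B a x x"
  define x' where "x' = x - P a x"
  define c where "c = 2 * q - 1"
  define D where "D = q * B a w w / \<rho> + (1 - q) * \<beta>\<^sup>2"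
  have q: "0 < q" "q < 1" using reflects_weight[OF r x] by (simp_all add: q_def)
  have \<rho>: "\<rho> > 0" using B_pos[OF P_in_E x(1)] by (simp add: B_P \<rho>_def)
  note step = rotation_step[OF r x, folded q_def \<rho>_def x'_def, folded c_def]
  \<comment> \<open>With \<open>b = 0\<close> each step multiplies the coefficient of
    \<open>x'\<close> by \<open>c\<close>, and \<open>\<bar>c\<bar> < 1\<close> because
    \<open>0 < q < 1\<close>.\<close>
  have iter: "\<exists>h\<in>mover x f a. \<exists>w1\<in>E a. h (w + \<beta> *\<^sub>R x') = w1 + (c ^ n * \<beta>) *\<^sub>R x' \<and>
      q * B a w1 w1 / \<rho> + (1 - q) * (c ^ n * \<beta>)\<^sup>2 = D" for n
  proof (induction n)
    case 0
    have "(\<lambda>v. v) \<in> mover x f a" by (simp add: mover_def Isom_id)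
    then show ?case using w by (intro bexI[of _ "\<lambda>v. v"] bexI[of _ w]) (simp_all add: D_def)
  next
    case (Suc n)
    then obtain h w1 where h: "h \<in> mover x f a" "w1 \<in> E a" "h (w + \<beta> *\<^sub>R x') = w1 + (c ^ n * \<beta>) *\<^sub>R x'"
        "q * B a w1 w1 / \<rho> + (1 - q) * (c ^ n * \<beta>)\<^sup>2 = D" by blast
    obtain k w2 where k: "k \<in> mover x f a" "w2 \<in> E a"
        "k (w1 + (c ^ n * \<beta>) *\<^sub>R x') = w2 + (c * (c ^ n * \<beta>) - 2 * q * 0 / \<rho>) *\<^sub>R x'"
        "q * B a w2 w2 / \<rho> + (1 - q) * (c * (c ^ n * \<beta>) - 2 * q * 0 / \<rho>)\<^sup>2 = q * B a w1 w1 / \<rho> + (1 - q) * (c ^ n * \<beta>)\<^sup>2"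
      using step[OF h(2), of 0 "c ^ n * \<beta>"] \<rho> B_nonneg by auto
    then show ?case using h mover_compose[OF k(1) h(1)]
      by (intro bexI[of _ "\<lambda>v. k (h v)"] bexI[of _ w2]) (simp_all add: mult.assoc)
  qed
  have ex: "\<exists>h\<in>mover x f a. h (w + \<beta> *\<^sub>R x') \<in> E a \<and> q * B a (h (w + \<beta> *\<^sub>R x')) (h (w + \<beta> *\<^sub>R x')) / \<rho> = D"
  proof (cases "\<beta> = 0")
    case True
    have "(\<lambda>v. v) \<in> mover x f a" by (simp add: mover_def Isom_id)
    then show ?thesis using w True by (intro bexI[of _ "\<lambda>v. v"]) (simp_all add: D_def)
  next
    case False
    then have D: "D > 0" using q \<rho> B_nonneg[of a w] by (simp add: D_def add_nonneg_pos)
    have "\<bar>c\<bar> < 1" using q by (simp add: c_def)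
    then have lim: "(\<lambda>n. (c ^ n * \<beta>)\<^sup>2) \<longlonglongrightarrow> (0 * \<beta>)\<^sup>2"
      by (intro tendsto_intros LIMSEQ_power_zero) simp
    have "\<forall>\<^sub>F n in sequentially. (c ^ n * \<beta>)\<^sup>2 < 4 * q * D"
      by (rule order_tendstoD(2)[OF lim]) (use D q in simp)
    then obtain n where n: "(c ^ n * \<beta>)\<^sup>2 < 4 * q * D" unfolding eventually_sequentially by blast
    define t where "t = c ^ n * \<beta>"
    obtain h w1 where h: "h \<in> mover x f a" "w1 \<in> E a" "h (w + \<beta> *\<^sub>R x') = w1 + t *\<^sub>R x'"
        "q * B a w1 w1 / \<rho> + (1 - q) * t\<^sup>2 = D" using iter[of n] unfolding t_def by blast
    \<comment> \<open>This \<open>b\<close> makes the next coefficient of \<open>x'\<close> zero. By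
      conservation of \<open>D\<close> and \<open>c\<^sup>2 + 4 * q * (1 - q) = 1\<close>, it is
      admissible exactly when \<open>t\<^sup>2 \<le> 4 * q * D\<close>, which the choice of
      \<open>n\<close> ensures.\<close>
    define b where "b = c * t * \<rho> / (2 * q)"
    have "c\<^sup>2 * t\<^sup>2 \<le> 4 * q * (q * B a w1 w1 / \<rho>)"
    proof -
      have "c\<^sup>2 * t\<^sup>2 + 4 * q * (1 - q) * t\<^sup>2 = t\<^sup>2" by (simp add: c_def power2_eq_square algebra_simps)
      moreover have "4 * q * (q * B a w1 w1 / \<rho>) = 4 * q * D - 4 * q * (1 - q) * t\<^sup>2"
        unfolding h(4)[symmetric] by (simp add: algebra_simps)
      ultimately show ?thesis using n unfolding t_def by linarith
    qed
    then have "(c\<^sup>2 * t\<^sup>2) * (\<rho>\<^sup>2 / (4 * q\<^sup>2)) \<le> 4 * q * (q * B a w1 w1 / \<rho>) * (\<rho>\<^sup>2 / (4 * q\<^sup>2))"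
      by (rule mult_right_mono) simp
    then have "b\<^sup>2 \<le> \<rho> * B a w1 w1"
      using q \<rho> by (simp add: b_def power2_eq_square field_simps)
    moreover have "c * t - 2 * q * b / \<rho> = 0" using q \<rho> by (simp add: b_def)
    ultimately obtain k w2 where k: "k \<in> mover x f a" "w2 \<in> E a" "k (w1 + t *\<^sub>R x') = w2"
        "q * B a w2 w2 / \<rho> = q * B a w1 w1 / \<rho> + (1 - q) * t\<^sup>2"
      using step[OF h(2), of b t] by (metis (no_types, lifting) add.right_neutral mult_zero_right power_zero_numeral scaleR_zero_left)
    then show ?thesis using h mover_compose[OF k(1) h(1)] by (intro bexI[of _ "\<lambda>v. k (h v)"]) simp_all
  qed
  then obtain h where h: "h \<in> mover x f a" "h (w + \<beta> *\<^sub>R x') \<in> E a"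
      "q * B a (h (w + \<beta> *\<^sub>R x')) (h (w + \<beta> *\<^sub>R x')) / \<rho> = D" by blast
  have "M (w + \<beta> *\<^sub>R x') = M (h (w + \<beta> *\<^sub>R x'))" using h(1) by (simp add: mover_def Isom_def)
  then have "(M (w + \<beta> *\<^sub>R x'))\<^sup>2 = (\<mu> a)\<^sup>2 * B a (h (w + \<beta> *\<^sub>R x')) (h (w + \<beta> *\<^sub>R x'))"
    using M_E[OF h(2)] by simp
  also have "B a (h (w + \<beta> *\<^sub>R x')) (h (w + \<beta> *\<^sub>R x')) = \<rho> * D / q" using h(3) q \<rho> by (simp add: field_simps)
  also have "\<dots> = B a w w + \<rho> * ((1 - q) / q) * \<beta>\<^sup>2" using q \<rho> by (simp add: D_def field_simps)
  finally have "(M (w + \<beta> *\<^sub>R x'))\<^sup>2 = (\<mu> a)\<^sup>2 * (B a w w + \<rho> * ((1 - q) / q) * \<beta>\<^sup>2)" .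
  with h(1,2) show ?thesis unfolding q_def \<rho>_def x'_def by (rule that)
qed

text \<open>An isometry moves the remaining part into block \<open>a\<close>, where every nonzero
  vector is a reflection vector; that reflection is pulled back.\<close>

lemma reflects_delete_block:
  assumes r: "reflects M x f" and x: "x - P a x \<noteq> 0"
  obtains g where "reflects M (x - P a x) g"
proof (cases "P a x = 0")
  case True
  then show ?thesis using r that by simp
next
  case False
  obtain h where h: "h \<in> mover x f a" "h (0 + 1 *\<^sub>R (x - P a x)) \<in> E a"
    using rotation_into_block[OF r False x subspace_0[OF subspace_E], where \<beta> = 1] by metis
  have hI: "h \<in> Isom M" using h(1) by (simp add: mover_def)
  then have "M (h (x - P a x)) \<noteq> 0" using x by (simp add: Isom_def M_simps)
  then have h0: "h (x - P a x) \<noteq> 0" by (auto simp: M_simps)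
  have hE: "h (x - P a x) \<in> E a" using h(2) by simp
  show ?thesis
    by (rule reflects_pullback[OF M_norm block_reflects[OF hE h0] hI]) (rule that)
qed

text \<open>The functional of a reflection is determined by its vector: on each block it is the
  Euclidean form weighted by \<open>(\<mu> a)\<^sup>2\<close> and divided by
  \<open>(M x)\<^sup>2\<close>. This makes limits of reflections possible.\<close>

lemma reflects_form:
  assumes r: "reflects M x f" and w: "w \<in> E a"
  shows "f w * (M x)\<^sup>2 = (\<mu> a)\<^sup>2 * B a x w"
proof (cases "P a x = 0")
  case True
  then have "B a x w = 0" using B_P(1)[of a x w] by (simp add: B_simps)
  then show ?thesis using reflects_orthogonal[OF r w] by simp
next
  case x: False
  have \<rho>: "B a x x > 0" using B_pos[OF P_in_E x] by (simp add: B_P)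
  have fw: "f w = f (P a x) * B a x w / B a x x" by (rule reflects_on_block[OF r w x])
  have "f (P a x) * (M x)\<^sup>2 = (\<mu> a)\<^sup>2 * B a x x"
  proof (cases "x - P a x = 0")
    case True
    then have Px: "P a x = x" by simp
    have "f x = 1" using r by (simp add: reflects_def)
    then show ?thesis using M_E[OF P_in_E, of a x] unfolding Px by simp
  next
    case False
    obtain h where "(M (P a x + 1 *\<^sub>R (x - P a x)))\<^sup>2
        = (\<mu> a)\<^sup>2 * (B a (P a x) (P a x) + B a x x * ((1 - f (P a x)) / f (P a x)) * 1\<^sup>2)"
      using rotation_into_block[OF r x False P_in_E, where \<beta> = 1] by metis
    then have "(M x)\<^sup>2 = (\<mu> a)\<^sup>2 * (B a x x + B a x x * ((1 - f (P a x)) / f (P a x)))"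
      by (simp add: B_P)
    also have "B a x x + B a x x * ((1 - f (P a x)) / f (P a x)) = B a x x / f (P a x)"
      using reflects_weight(1)[OF r x False] by (simp add: field_simps)
    finally show ?thesis using reflects_weight(1)[OF r x False] by simp
  qed
  then have "f (P a x) * (M x)\<^sup>2 * B a x w / B a x x = (\<mu> a)\<^sup>2 * B a x w" using \<rho> by simp
  then show ?thesis by (simp add: fw mult_ac)
qed

end


section \<open>Merged blocks\<close>

context block_over begin

lemma partial_blocks_tendsto: "(\<lambda>n. \<Sum>c<n. P c x) \<longlonglongrightarrow> x"
  unfolding tendsto_iff
proof (intro allI impI)
  fix r :: real assume "r > 0"
  then have "\<forall>\<^sub>F G in finite_subsets_at_top UNIV. dist (\<Sum>p\<in>G. cf p x *\<^sub>R e p) x < r"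
    using expand[of x] unfolding has_sum_def tendsto_iff by blast
  then obtain F where F: "finite F" "\<And>G. finite G \<Longrightarrow> F \<subseteq> G \<Longrightarrow> dist (\<Sum>p\<in>G. cf p x *\<^sub>R e p) x < r"
    unfolding eventually_finite_subsets_at_top by auto
  obtain m where m: "\<And>p. p \<in> F \<Longrightarrow> blk p < m"
    using finite_imageI[OF F(1), of blk] unfolding finite_nat_set_iff_bounded by auto
  have "dist (\<Sum>c<n. P c x) x < r" if "n \<ge> m" for n
  proof -
    have "(\<Sum>c<n. P c x) = (\<Sum>p\<in>(\<Union>c\<in>{..<n}. blk -` {c}). cf p x *\<^sub>R e p)"
      unfolding P_def by (rule sum.UNION_disjoint[symmetric]) (auto simp: fin)
    moreover have "F \<subseteq> (\<Union>c\<in>{..<n}. blk -` {c})" using m that by force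
    ultimately show ?thesis using F(2)[of "\<Union>c\<in>{..<n}. blk -` {c}"] fin by simp
  qed
  then show "\<forall>\<^sub>F n in sequentially. dist (\<Sum>c<n. P c x) x < r" unfolding eventually_sequentially by blast
qed

lemma reflects_delete_blocks:
  assumes r: "reflects M x f" and a: "P a x \<noteq> 0" "a \<notin> C" and C: "finite C"
  shows "\<exists>g. reflects M (x - (\<Sum>c\<in>C. P c x)) g"
  using C a(2)
proof (induction C rule: finite_induct)
  case empty
  then show ?case using r by auto
next
  case (insert c C)
  define y where "y = x - (\<Sum>c\<in>C. P c x)"
  obtain g where g: "reflects M y g" using insert by (auto simp: y_def)
  have Py: "P c y = P c x" using insert(1,2) by (simp add: y_def P_simps P_P)
  have "P a (y - P c y) = P a x"
    using insert by (simp add: Py y_def P_simps P_P)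
  then have "y - P c y \<noteq> 0" using a(1) by (auto simp: P_simps)
  then have "\<exists>g. reflects M (y - P c y) g" using reflects_delete_block[OF g] by blast
  moreover have "y - P c y = x - (\<Sum>c\<in>insert c C. P c x)"
    unfolding Py using insert by (simp add: y_def)
  ultimately show ?case by simp
qed

lemma cf_sum_e: "cf q (\<Sum>p\<in>F. t p *\<^sub>R e p) = (if q \<in> F then t q else 0)" if "finite F"
  using that by (simp add: cf_simps cf_e if_distrib cong: if_cong)

text \<open>Deleting from \<open>x\<close> more and more blocks other than \<open>a\<close> and
  \<open>b\<close> gives reflection vectors \<open>X n\<close> that tend to \<open>y\<close>. Their
  functionals converge on basis vectors by \<open>reflects_form\<close>, so the limiting reflection
  preserves \<open>M\<close> on finite combinations, and then everywhere by continuity.\<close>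

lemma reflects_two_blocks:
  assumes r: "reflects M x f" and ab: "a \<noteq> b" "P a x \<noteq> 0" "P b x \<noteq> 0"
  shows "\<exists>g. reflects M (P a x + P b x) g"
proof -
  define y where "y = P a x + P b x"
  define X where "X = (\<lambda>n. x - (\<Sum>c\<in>{..<n} - {a, b}. P c x))"
  have "\<forall>n. \<exists>g. reflects M (X n) g"
    unfolding X_def using reflects_delete_blocks[OF r ab(2)] by simp
  then obtain f where f: "\<And>n. reflects M (X n) (f n)" by metis
  have f_lin: "linear (f n)" "f n (X n) = 1" for n using f[of n] by (auto simp: reflects_def)
  have X_eq: "X n = x - (\<Sum>c<n. P c x) + y" if "n > a" "n > b" for n
  proof -
    have "(\<Sum>c<n. P c x) = (\<Sum>c\<in>{..<n} - {a, b}. P c x) + (\<Sum>c\<in>{a, b}. P c x)"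
      using that by (intro sum.subset_diff) auto
    then show ?thesis using ab(1) by (simp add: X_def y_def)
  qed
  have X_lim: "X \<longlonglongrightarrow> y"
  proof -
    have "(\<lambda>n. x - (\<Sum>c<n. P c x) + y) \<longlonglongrightarrow> x - x + y"
      by (intro tendsto_intros partial_blocks_tendsto)
    moreover have "\<forall>\<^sub>F n in sequentially. x - (\<Sum>c<n. P c x) + y = X n"
      using X_eq by (intro eventually_sequentiallyI[of "Suc (max a b)"]) auto
    ultimately have "X \<longlonglongrightarrow> x - x + y" by (rule Lim_transform_eventually)
    then show ?thesis by simp
  qed
  have cfy: "cf p y = (if blk p = a \<or> blk p = b then cf p x else 0)" for p
    using ab(1) by (auto simp: y_def cf_simps cf_P)
  have y0: "y \<noteq> 0" using ab by (metis P_P P_simps(1) P_simps(5) add.right_neutral y_def)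
  have My: "M y > 0" using y0 M_simps(1,2)[of y] by (metis less_eq_real_def)
  have MX: "(\<lambda>n. M (X n)) \<longlonglongrightarrow> M y" using X_lim by (rule M_tendsto)
  have MX0: "M (X n) > 0" for n
    using f_lin[of n] M_simps(1,2)[of "X n"] by (metis less_eq_real_def linear_0 zero_neq_one)
  \<comment> \<open>The functional that \<open>reflects_form\<close> predicts for
    \<open>y\<close>.\<close>
  define g where "g = (\<lambda>v. ((\<mu> a)\<^sup>2 * B a x v + (\<mu> b)\<^sup>2 * B b x v) / (M y)\<^sup>2)"
  have g_bl: "bounded_linear g"
    unfolding g_def divide_inverse
    by (intro bounded_linear_mult_const bounded_linear_add bounded_linear_const_mult B_bl)
  then have g_lin: "linear g" by (rule bounded_linear.linear)
  have Be: "B c v (e p) = (if blk p = c then cf p v else 0)" for c v p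
    using fin by (simp add: B_def cf_e if_distrib cong: if_cong)
  have fe: "(\<lambda>n. f n (e p)) \<longlonglongrightarrow> g (e p)" for p
  proof -
    have "f n (e p) = (\<mu> (blk p))\<^sup>2 * cf p (X n) / (M (X n))\<^sup>2" for n
      using reflects_form[OF f e_in_E, of n p] MX0[of n] by (simp add: Be field_simps)
    moreover have "(\<lambda>n. (\<mu> (blk p))\<^sup>2 * cf p (X n) / (M (X n))\<^sup>2) \<longlonglongrightarrow> (\<mu> (blk p))\<^sup>2 * cf p y / (M y)\<^sup>2"
      using My by (intro tendsto_intros bounded_linear.tendsto[OF cf_bl] X_lim MX) simp
    moreover have "(\<mu> (blk p))\<^sup>2 * cf p y / (M y)\<^sup>2 = g (e p)"
      using ab(1) by (auto simp: g_def Be cfy)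
    ultimately show ?thesis by simp
  qed
  have f_lim: "(\<lambda>n. f n (\<Sum>p\<in>F. t p *\<^sub>R e p)) \<longlonglongrightarrow> g (\<Sum>p\<in>F. t p *\<^sub>R e p)" for F t
    unfolding linear_sum[OF f_lin(1)] linear_sum[OF g_lin] linear_cmul[OF f_lin(1)] linear_cmul[OF g_lin]
    by (intro tendsto_sum tendsto_scaleR tendsto_const fe)
  have "g y = 1"
  proof (rule LIMSEQ_unique)
    have "y = (\<Sum>p\<in>blk -` {a} \<union> blk -` {b}. cf p y *\<^sub>R e p)"
      using fin by (intro cf_eqI) (auto simp: cf_sum_e cfy)
    then show "(\<lambda>n. f n y) \<longlonglongrightarrow> g y" using f_lim by metis
    \<comment> \<open>\<open>f n\<close> depends on \<open>n\<close>, so the uniform bound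
      \<open>reflects_norm_le\<close> is used to replace \<open>X n\<close>, where
      \<open>f n\<close> is 1, by \<open>y\<close>.\<close>
    have "(\<lambda>n. f n (X n - y)) \<longlonglongrightarrow> 0"
    proof (rule Lim_null_comparison)
      have "\<bar>f n (X n - y)\<bar> \<le> M (X n - y) / M (X n)" for n
        using reflects_norm_le(1)[OF M_norm f, of n "X n - y"] MX0[of n] by (simp add: field_simps)
      then show "\<forall>\<^sub>F n in sequentially. norm (f n (X n - y)) \<le> M (X n - y) / M (X n)" by simp
      have "(\<lambda>n. M (X n - y) / M (X n)) \<longlonglongrightarrow> M (y - y) / M y"
        using My by (intro tendsto_intros M_tendsto X_lim) simp
      then show "(\<lambda>n. M (X n - y) / M (X n)) \<longlonglongrightarrow> 0" by (simp add: M_simps)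
    qed
    then have "(\<lambda>n. 1 - f n (X n - y)) \<longlonglongrightarrow> 1 - 0" by (intro tendsto_intros)
    then show "(\<lambda>n. f n y) \<longlonglongrightarrow> 1" by (simp add: linear_diff[OF f_lin(1)] f_lin(2))
  qed
  moreover have "M (v - (2 * g v) *\<^sub>R y) = M v" for v
  proof -
    have fs: "M (s - (2 * g s) *\<^sub>R y) = M s" if s: "s = (\<Sum>p\<in>F. t p *\<^sub>R e p)" for s F t
    proof (rule LIMSEQ_unique)
      have "(\<lambda>n. f n s) \<longlonglongrightarrow> g s" using f_lim[of t F] by (simp add: s)
      then show "(\<lambda>n. M (s - (2 * f n s) *\<^sub>R X n)) \<longlonglongrightarrow> M (s - (2 * g s) *\<^sub>R y)"
        by (intro M_tendsto tendsto_intros X_lim)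
      show "(\<lambda>n. M (s - (2 * f n s) *\<^sub>R X n)) \<longlonglongrightarrow> M s" using f by (simp add: reflects_def)
    qed
    define V where "V = (\<lambda>n. \<Sum>p<n. cf p v *\<^sub>R e p)"
    have V: "V \<longlonglongrightarrow> v" using has_sum_imp_sums[OF expand[of v]] by (simp add: V_def sums_def)
    have "M (V n - (2 * g (V n)) *\<^sub>R y) = M (V n)" for n by (rule fs) (simp add: V_def)
    moreover have "(\<lambda>n. M (V n - (2 * g (V n)) *\<^sub>R y)) \<longlonglongrightarrow> M (v - (2 * g v) *\<^sub>R y)"
      by (intro M_tendsto tendsto_intros V bounded_linear.tendsto[OF g_bl])
    moreover have "(\<lambda>n. M (V n)) \<longlonglongrightarrow> M v" by (intro M_tendsto V)
    ultimately show ?thesis using LIMSEQ_unique by simp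
  qed
  ultimately have "reflects M y g" using g_lin by (simp add: reflects_def)
  then show ?thesis unfolding y_def by blast
qed

text \<open>Transitivity is not visible here; it comes from \<open>F_eq_iff\<close> once the
  components are known to be finite.\<close>

definition merged :: "nat \<Rightarrow> nat \<Rightarrow> bool" where
  "merged i j \<longleftrightarrow> i = j \<or> (\<exists>w\<in>E i. \<exists>v\<in>E j. w \<noteq> 0 \<and> v \<noteq> 0 \<and> (\<exists>f. reflects M (w + v) f))"

lemma merged_refl: "merged i i" by (simp add: merged_def)

lemma merged_sym: "merged i j \<Longrightarrow> merged j i"
  unfolding merged_def using add.commute by metis

lemma reflects_merged:
  assumes "reflects M x f" "P i x \<noteq> 0" "P j x \<noteq> 0"
  shows "merged i j"
proof (cases "i = j")
  case False
  have "\<exists>f. reflects M (P i x + P j x) f" using reflects_two_blocks[OF assms(1) False assms(2,3)] .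
  then show ?thesis unfolding merged_def using P_in_E[of i x] P_in_E[of j x] assms(2,3) by blast
qed (simp add: merged_refl)

text \<open>A rotation turns \<open>w\<close> into a multiple of the witness \<open>w0\<close>, and
  \<open>rotation_into_block\<close> for the reflection along \<open>w0 + v0\<close> carries it on
  into block \<open>b\<close>. The other blocks are orthogonal to \<open>w0 + v0\<close> and stay
  fixed.\<close>

lemma merged_pair:
  assumes m: "merged a b" "a \<noteq> b" and w: "w \<in> E a" and v: "v \<in> E b"
  obtains h where "h \<in> Isom M" "h (w + v) \<in> E b" "\<And>c z. c \<noteq> a \<Longrightarrow> c \<noteq> b \<Longrightarrow> z \<in> E c \<Longrightarrow> h z = z"
    "(M (w + v))\<^sup>2 = (M w)\<^sup>2 + (M v)\<^sup>2"
proof -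
  obtain w0 v0 f where w0: "w0 \<in> E a" "w0 \<noteq> 0" and v0: "v0 \<in> E b" "v0 \<noteq> 0" and f: "reflects M (w0 + v0) f"
    using m unfolding merged_def by blast
  have Pb: "P b (w0 + v0) = v0" using m(2) w0 v0 by (simp add: P_simps P_E)
  have diff: "w0 + v0 - P b (w0 + v0) = w0" by (simp add: Pb)
  have w00: "B a w0 w0 > 0" using B_pos[OF w0] .
  define \<beta> where "\<beta> = sqrt (B a w w / B a w0 w0)"
  have "B a (\<beta> *\<^sub>R w0) (\<beta> *\<^sub>R w0) = \<beta>\<^sup>2 * B a w0 w0" by (simp add: B_simps power2_eq_square)
  then have "B a w w = B a (\<beta> *\<^sub>R w0) (\<beta> *\<^sub>R w0)" using w00 B_nonneg[of a w] by (simp add: \<beta>_def)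
  then obtain k where k: "k \<in> Isom M" "k w = \<beta> *\<^sub>R w0" "\<And>z. P a z = 0 \<Longrightarrow> k z = z"
    using block_rotation[OF w] w0(1) subspace_E subspace_scale by metis
  have kl: "linear k" using k(1) by (simp add: Isom_def)
  have kv: "k (w + v) = v + \<beta> *\<^sub>R w0"
    using k(3)[of v] P_E[OF v, of a] m(2) by (simp add: linear_add[OF kl] k(2))
  define \<gamma> where "\<gamma> = B b (w0 + v0) (w0 + v0) * ((1 - f v0) / f v0)"
  note rot = rotation_into_block[OF f, of b, unfolded diff, unfolded Pb, OF v0(2) w0(2), folded \<gamma>_def]
  obtain h where h: "h \<in> mover (w0 + v0) f b" "h (v + \<beta> *\<^sub>R w0) \<in> E b"
      "(M (v + \<beta> *\<^sub>R w0))\<^sup>2 = (\<mu> b)\<^sup>2 * (B b v v + \<gamma> * \<beta>\<^sup>2)"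
    using rot[OF v] by metis
  \<comment> \<open>The same formula without a part in block \<open>b\<close>: comparing the two
    gives the Pythagorean identity.\<close>
  obtain h' where "(M (0 + \<beta> *\<^sub>R w0))\<^sup>2 = (\<mu> b)\<^sup>2 * (B b 0 0 + \<gamma> * \<beta>\<^sup>2)"
    using rot[OF subspace_0[OF subspace_E]] by metis
  then have Mw0: "(M (\<beta> *\<^sub>R w0))\<^sup>2 = (\<mu> b)\<^sup>2 * (\<gamma> * \<beta>\<^sup>2)" by (simp add: B_simps)
  have hI: "h \<in> Isom M" using h(1) by (simp add: mover_def)
  have Mk: "M (k z) = M z" for z using k(1) by (simp add: Isom_def)
  have "(M (w + v))\<^sup>2 = (M (\<beta> *\<^sub>R w0))\<^sup>2 + (M v)\<^sup>2"
    using h(3) Mk[of "w + v"] M_E[OF v] unfolding kv Mw0 by (simp add: algebra_simps)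
  then have "(M (w + v))\<^sup>2 = (M w)\<^sup>2 + (M v)\<^sup>2" using Mk[of w] by (simp add: k(2))
  moreover have "h (k z) = z" if "c \<noteq> a" "c \<noteq> b" "z \<in> E c" for c z
  proof -
    have "B c (w0 + v0) z = 0" using that(1,2) w0(1) v0(1) by (simp add: B_simps B_E_other)
    then have "f z = 0" using reflects_orthogonal[OF f that(3)] by simp
    moreover have "P a z = 0" "P b z = 0" using that P_E by auto
    ultimately show ?thesis using h(1) k(3) by (simp add: mover_def)
  qed
  ultimately show ?thesis
    using that[of "\<lambda>z. h (k z)"] Isom_compose[OF hI k(1)] h(2) kv by simp
qed

text \<open>The blocks in \<open>A\<close> are swept into block \<open>b\<close> one at a time; the
  isometry used for one of them fixes those that are still to come.\<close>

lemma merged_star: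
  assumes "finite A" "b \<notin> A" "\<And>a. a \<in> A \<Longrightarrow> merged a b" "\<And>a. a \<in> A \<Longrightarrow> y a \<in> E a" "v \<in> E b"
  shows "\<exists>h\<in>Isom M. h ((\<Sum>a\<in>A. y a) + v) \<in> E b"
    "(M ((\<Sum>a\<in>A. y a) + v))\<^sup>2 = (\<Sum>a\<in>A. (M (y a))\<^sup>2) + (M v)\<^sup>2"
proof -
  have "(\<exists>h\<in>Isom M. h ((\<Sum>a\<in>A. y a) + v) \<in> E b) \<and>
      (M ((\<Sum>a\<in>A. y a) + v))\<^sup>2 = (\<Sum>a\<in>A. (M (y a))\<^sup>2) + (M v)\<^sup>2"
    using assms
  proof (induction A arbitrary: v rule: finite_induct)
    case empty
    then show ?case by (intro conjI bexI[OF _ Isom_id]) simp_all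
  next
    case (insert a A)
    have "merged a b" "a \<noteq> b" "y a \<in> E a" using insert.prems by auto
    then obtain h where h: "h \<in> Isom M" "h (y a + v) \<in> E b" "\<And>c z. c \<noteq> a \<Longrightarrow> c \<noteq> b \<Longrightarrow> z \<in> E c \<Longrightarrow> h z = z"
        "(M (y a + v))\<^sup>2 = (M (y a))\<^sup>2 + (M v)\<^sup>2"
      using merged_pair insert.prems(4) by metis
    have hl: "linear h" and Mh: "\<And>z. M (h z) = M z" using h(1) by (auto simp: Isom_def)
    have "h (y c) = y c" if "c \<in> A" for c
    proof -
      have "c \<noteq> a" "c \<noteq> b" "y c \<in> E c" using that insert.hyps insert.prems by auto
      then show ?thesis using h(3) by blast
    qed
    then have hs: "h ((\<Sum>c\<in>insert a A. y c) + v) = (\<Sum>c\<in>A. y c) + h (y a + v)"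
      using insert.hyps by (simp add: linear_add[OF hl] linear_sum[OF hl])
    have IH: "(\<exists>k\<in>Isom M. k ((\<Sum>a\<in>A. y a) + h (y a + v)) \<in> E b) \<and>
      (M ((\<Sum>a\<in>A. y a) + h (y a + v)))\<^sup>2 = (\<Sum>a\<in>A. (M (y a))\<^sup>2) + (M (h (y a + v)))\<^sup>2"
      using insert.prems h(2) by (intro insert.IH) auto
    then obtain k where k: "k \<in> Isom M" "k ((\<Sum>a\<in>A. y a) + h (y a + v)) \<in> E b" by blast
    have "(\<lambda>z. k (h z)) \<in> Isom M" using k(1) h(1) by (rule Isom_compose)
    moreover have "k (h ((\<Sum>c\<in>insert a A. y c) + v)) \<in> E b" using k(2) hs by simp
    moreover have "(M ((\<Sum>c\<in>insert a A. y c) + v))\<^sup>2 = (\<Sum>a\<in>A. (M (y a))\<^sup>2) + (M (y a + v))\<^sup>2"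
      using IH Mh hs by metis
    then have "(M ((\<Sum>c\<in>insert a A. y c) + v))\<^sup>2 = (\<Sum>c\<in>insert a A. (M (y c))\<^sup>2) + (M v)\<^sup>2"
      using insert.hyps h(4) by simp
    ultimately show ?case by (intro conjI bexI[of _ "\<lambda>z. k (h z)"])
  qed
  then show "\<exists>h\<in>Isom M. h ((\<Sum>a\<in>A. y a) + v) \<in> E b"
    "(M ((\<Sum>a\<in>A. y a) + v))\<^sup>2 = (\<Sum>a\<in>A. (M (y a))\<^sup>2) + (M v)\<^sup>2" by auto
qed

text \<open>A class is a \<open>c\<^sub>0\<close>-sum, whereas merged blocks form an \<open>\<ell>\<^sub>2\<close>-sum.\<close>

lemma finite_merged_class: "finite {j. merged i j \<and> \<kappa> j = k}"
proof (rule ccontr)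
  assume inf: "infinite {j. merged i j \<and> \<kappa> j = k}"
  obtain c C where c: "c > 0" "C > 0" "\<And>x. c * norm x \<le> M x" "\<And>x. M x \<le> C * norm x"
    using M_bounds by metis
  obtain c' C' where c': "c' > 0" "\<And>x. c' * norm x \<le> N x"
    using equiv by (auto simp: equivalent_norm_def)
  obtain g where g: "\<And>j. blk (g j) = j" using ex_blk by metis
  \<comment> \<open>A sum of \<open>n\<close> basis vectors, one from each of \<open>n\<close>
    merged blocks of the class, has squared \<open>M\<close>-length at least
    \<open>n * c\<^sup>2\<close>, although its \<open>N\<close>-norm is at most 1.\<close>
  have le: "real n * c\<^sup>2 \<le> (C / c')\<^sup>2" for n
  proof -
    have "infinite ({j. merged i j \<and> \<kappa> j = k} - {i})" using inf by simp
    then obtain A where A: "finite A" "card A = n" "A \<subseteq> {j. merged i j \<and> \<kappa> j = k} - {i}"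
      using infinite_arbitrarily_large by blast
    have "(M ((\<Sum>a\<in>A. e (g a)) + 0))\<^sup>2 = (\<Sum>a\<in>A. (M (e (g a)))\<^sup>2) + (M 0)\<^sup>2"
    proof (rule merged_star(2)[where b = i])
      show "merged a i" if "a \<in> A" for a using A(3) that by (intro merged_sym[of i a]) auto
      show "e (g a) \<in> E a" for a using e_in_E[of "g a"] by (simp add: g)
      show "0 \<in> E i" by (rule subspace_0[OF subspace_E])
    qed (use A in auto)
    then have "(M (\<Sum>a\<in>A. e (g a)))\<^sup>2 = (\<Sum>a\<in>A. (M (e (g a)))\<^sup>2)" by (simp add: M_simps)
    moreover have "(\<Sum>a\<in>A. c\<^sup>2) \<le> (\<Sum>a\<in>A. (M (e (g a)))\<^sup>2)"
      using c(1) c(3)[of "e (g _)"] by (intro sum_mono power_mono) (auto simp: norm_e)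
    moreover have "M (\<Sum>a\<in>A. e (g a)) \<le> C / c'"
    proof -
      have "N (\<Sum>a\<in>A. e (g a)) \<le> 1" using A g by (intro N_transversal[of A g k]) auto
      then have "norm (\<Sum>a\<in>A. e (g a)) \<le> 1 / c'"
        using c'(2)[of "\<Sum>a\<in>A. e (g a)"] c'(1) by (simp add: field_simps)
      then have "C * norm (\<Sum>a\<in>A. e (g a)) \<le> C * (1 / c')" using c(2) by (intro mult_left_mono) auto
      then show ?thesis using c(4)[of "\<Sum>a\<in>A. e (g a)"] by simp
    qed
    then have "(M (\<Sum>a\<in>A. e (g a)))\<^sup>2 \<le> (C / c')\<^sup>2" using M_simps(1) by (intro power_mono)
    ultimately show ?thesis using A(2) by simp
  qed
  obtain n where "(C / c')\<^sup>2 < real n * c\<^sup>2" using reals_Archimedean3[of "c\<^sup>2"] c(1) by auto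
  then show False using le[of n] by simp
qed

text \<open>Swapping \<open>a\<close> with an interchangeable copy \<open>j\<close> different from
  \<open>b\<close> leaves block \<open>b\<close> fixed and so merges \<open>j\<close> with
  \<open>b\<close>; infinitely many copies contradict \<open>finite_merged_class\<close>.\<close>

lemma merged_rigid:
  assumes inf: "infinite {j. \<kappa> j = \<kappa> a \<and> card (blk -` {j}) = card (blk -` {a})}" and m: "merged a b"
  shows "a = b"
proof (rule ccontr)
  assume ab: "a \<noteq> b"
  have "merged b j" if j: "\<kappa> j = \<kappa> a" "card (blk -` {j}) = card (blk -` {a})" "j \<noteq> a" "j \<noteq> b" for j
  proof -
    obtain S where S: "S \<in> Isom N" "\<And>w. w \<in> E a \<Longrightarrow> S w \<in> E j" "\<And>k w. k \<noteq> a \<Longrightarrow> k \<noteq> j \<Longrightarrow> w \<in> E k \<Longrightarrow> S w = w"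
      using block_swap[of a j] j by metis
    have SM: "S \<in> Isom M" using S(1) sub by blast
    have Sl: "linear S" using SM by (simp add: Isom_def)
    obtain w v f where w: "w \<in> E a" "w \<noteq> 0" "v \<in> E b" "v \<noteq> 0" "reflects M (w + v) f"
      using m ab unfolding merged_def by blast
    have "S v = v" using S(3)[of b v] ab j(4) w(3) by simp
    then have "S (w + v) = S w + v" by (simp add: linear_add[OF Sl])
    then have "\<exists>g. reflects M (S w + v) g"
      using reflects_image[OF w(5) SM Isom_bij[OF M_norm SM]] by auto
    moreover have "M (S w) = M w" using SM by (simp add: Isom_def)
    then have "S w \<noteq> 0" using w(2) M_simps(2)[of w] M_simps(7) by auto
    ultimately have "merged j b" using S(2)[OF w(1)] w(3,4) unfolding merged_def by blast
    then show ?thesis by (rule merged_sym)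
  qed
  then have "{j. \<kappa> j = \<kappa> a \<and> card (blk -` {j}) = card (blk -` {a})} - {a, b} \<subseteq> {j. merged b j \<and> \<kappa> j = \<kappa> a}" by auto
  then have "finite ({j. \<kappa> j = \<kappa> a \<and> card (blk -` {j}) = card (blk -` {a})} - {a, b})"
    using finite_merged_class[of b "\<kappa> a"] by (rule finite_subset)
  then show False using inf by simp
qed

end


section \<open>Components and conjugacy\<close>

lemma dim_image_span:
  assumes "linear T" "inj T" "independent B"
  shows "dim (T ` span B) = card B"
proof -
  have "independent (T ` B)"
    using linear_independent_injective_image[OF assms(1,3)] assms(2) by (simp add: inj_on_subset)
  then have "dim (span (T ` B)) = card (T ` B)" by (rule dim_span_eq_card_independent)
  moreover have "card (T ` B) = card B" using assms(2) by (intro card_image) (rule inj_on_subset, auto)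
  ultimately show ?thesis by (simp add: linear_span_image[OF assms(1)])
qed

context block_over begin

definition F :: "nat \<Rightarrow> 'a set" where "F i = {v. \<forall>p. \<not> merged i (blk p) \<longrightarrow> cf p v = 0}"

lemma subspace_F: "subspace (F i)"
  by (auto simp: subspace_def F_def cf_simps)

lemma e_in_F: "e q \<in> F i \<longleftrightarrow> merged i (blk q)"
  by (auto simp: F_def cf_e)

lemma P_e: "P i (e q) = (if blk q = i then e q else 0)"
  using P_E[OF e_in_E[of q]] by auto

lemma e_nonzero: "e q \<noteq> 0"
  using norm_e[of q] by auto

lemma F_P: "v \<in> F i \<Longrightarrow> \<not> merged i j \<Longrightarrow> P j v = 0"
  by (rule cf_eqI) (auto simp: F_def cf_P cf_simps)

lemma cf_nonzero_P: "cf p v \<noteq> 0 \<Longrightarrow> P (blk p) v \<noteq> 0"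
  using cf_P[of p "blk p" v] by (auto simp: cf_simps)

lemma sum_P_eq:
  assumes "finite C" "\<And>p. blk p \<notin> C \<Longrightarrow> cf p v = 0"
  shows "(\<Sum>c\<in>C. P c v) = v"
proof (rule cf_eqI)
  fix p
  have "cf p (\<Sum>c\<in>C. P c v) = (\<Sum>c\<in>C. if blk p = c then cf p v else 0)"
    by (simp add: cf_simps cf_P)
  also have "\<dots> = cf p v" using assms by auto
  finally show "cf p (\<Sum>c\<in>C. P c v) = cf p v" .
qed

lemma F_star:
  assumes fin: "finite {j. merged i j}" and x: "x \<in> F i"
  shows "\<exists>h\<in>Isom M. h x \<in> E i" "(M x)\<^sup>2 = (\<Sum>j\<in>{j. merged i j}. (M (P j x))\<^sup>2)"
proof -
  define A where "A = {j. merged i j} - {i}"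
  have ins: "{j. merged i j} = insert i A" using merged_refl[of i] by (auto simp: A_def)
  have A: "finite A" "i \<notin> A" using fin by (auto simp: A_def)
  have "(\<Sum>c\<in>insert i A. P c x) = x"
    unfolding ins[symmetric] using x by (intro sum_P_eq[OF fin]) (simp add: F_def)
  then have x_eq: "(\<Sum>a\<in>A. P a x) + P i x = x" using A by (simp add: add.commute)
  have m: "merged a i" if "a \<in> A" for a using that by (intro merged_sym[of i a]) (simp add: A_def)
  note star = merged_star[OF A m, of "\<lambda>a. P a x" "P i x", OF _ P_in_E P_in_E, unfolded x_eq]
  show "\<exists>h\<in>Isom M. h x \<in> E i" using star(1) by simp
  show "(M x)\<^sup>2 = (\<Sum>j\<in>{j. merged i j}. (M (P j x))\<^sup>2)"
    unfolding ins using star(2) A by simp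
qed

lemma F_reflects:
  assumes fin: "finite {j. merged i j}" and x: "x \<in> F i" "x \<noteq> 0"
  shows "\<exists>f. reflects M x f"
proof -
  obtain h where h: "h \<in> Isom M" "h x \<in> E i" using F_star(1)[OF fin x(1)] by blast
  have "M (h x) \<noteq> 0" using h(1) x(2) by (simp add: Isom_def M_simps)
  then have h0: "h x \<noteq> 0" by (auto simp: M_simps)
  obtain g where "reflects M x g" by (rule reflects_pullback[OF M_norm block_reflects[OF h(2) h0] h(1)])
  then show ?thesis by blast
qed

lemma reflects_in_F:
  assumes "reflects M x f" "P i x \<noteq> 0"
  shows "x \<in> F i"
  unfolding F_def using reflects_merged[OF assms] cf_nonzero_P by blast

text \<open>When its merged blocks are finite in number, \<open>F i\<close> is thus the largest
  subspace of reflection vectors with a part in block \<open>i\<close>, a description in terms of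
  reflections alone. A vector without such a part is handled by adding one that has it.\<close>

lemma reflecting_subspace_in_F:
  assumes L: "subspace L" "\<And>x. x \<in> L \<Longrightarrow> x \<noteq> 0 \<Longrightarrow> \<exists>f. reflects M x f" and x: "x \<in> L" "P i x \<noteq> 0"
  shows "L \<subseteq> F i"
proof
  have sub: "y \<in> F i" if "y \<in> L" "P i y \<noteq> 0" for y
  proof -
    have "y \<noteq> 0" using that(2) by (auto simp: P_simps)
    then show ?thesis using L(2)[OF that(1)] reflects_in_F that(2) by blast
  qed
  fix v assume v: "v \<in> L"
  show "v \<in> F i"
  proof (cases "P i v = 0")
    case True
    have "x + v \<in> F i" using x v True L(1) by (intro sub) (simp_all add: subspace_add P_simps)
    then have "x + v - x \<in> F i" using sub[OF x] subspace_F by (intro subspace_diff)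
    then show ?thesis by simp
  qed (use sub v in blast)
qed

lemma F_eq:
  assumes fin: "\<And>i. finite {j. merged i j}" and m: "merged i j"
  shows "F i = F j"
proof -
  have "F i \<subseteq> F j" if "merged i j" for i j
  proof -
    obtain q where q: "blk q = j" using ex_blk by blast
    have q1: "e q \<in> F i" and q2: "P j (e q) \<noteq> 0" using q that e_nonzero by (simp_all add: e_in_F P_e)
    show ?thesis by (rule reflecting_subspace_in_F[OF subspace_F F_reflects[OF fin] q1 q2])
  qed
  then show ?thesis using m merged_sym[OF m] by blast
qed

lemma F_eq_iff:
  assumes fin: "\<And>i. finite {j. merged i j}"
  shows "F i = F j \<longleftrightarrow> merged i j"
proof
  assume "F i = F j"
  then show "merged i j" using e_in_F merged_refl ex_blk by metis
qed (rule F_eq[OF fin])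

definition block_dims :: "nat \<Rightarrow> nat" where "block_dims i = card {p. merged i (blk p)}"

lemma block_dims_sum:
  assumes "finite {j. merged i j}"
  shows "block_dims i = (\<Sum>j\<in>{j. merged i j}. card (blk -` {j}))"
proof -
  have "{p. merged i (blk p)} = (\<Union>j\<in>{j. merged i j}. blk -` {j})" by auto
  then show ?thesis unfolding block_dims_def using assms fin by (simp, subst card_UN_disjoint) auto
qed

lemma inj_e: "inj e"
  using cf_e by (metis injI zero_neq_one)

lemma independent_e: "independent (e ` S)"
  unfolding dependent_def
proof clarsimp
  fix p assume p: "p \<in> S" "e p \<in> span (e ` S - {e p})"
  have "span (e ` S - {e p}) \<subseteq> {v. cf p v = 0}"
  proof (rule span_minimal)
    show "e ` S - {e p} \<subseteq> {v. cf p v = 0}" by (auto simp: cf_e)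
    show "subspace {v. cf p v = 0}" by (auto simp: subspace_def cf_simps)
  qed
  then show False using p(2) by (auto simp: cf_e)
qed

lemma F_span:
  assumes "finite {j. merged i j}"
  shows "F i = span (e ` {p. merged i (blk p)})"
proof
  show "span (e ` {p. merged i (blk p)}) \<subseteq> F i"
    by (rule span_minimal[OF _ subspace_F]) (auto simp: e_in_F)
  have S: "finite {p. merged i (blk p)}"
    using finite_UN[of "{j. merged i j}" "\<lambda>j. blk -` {j}"] assms fin
    by (rule_tac finite_subset[of _ "\<Union>j\<in>{j. merged i j}. blk -` {j}"]) auto
  show "F i \<subseteq> span (e ` {p. merged i (blk p)})"
  proof
    fix v assume "v \<in> F i"
    then have "v = (\<Sum>p\<in>{p. merged i (blk p)}. cf p v *\<^sub>R e p)"
      using S by (intro cf_eqI) (auto simp: cf_sum_e F_def)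
    also have "\<dots> \<in> span (e ` {p. merged i (blk p)})"
      by (intro span_sum span_scale span_base) auto
    finally show "v \<in> span (e ` {p. merged i (blk p)})" .
  qed
qed

lemma dim_image_F:
  assumes "finite {j. merged i j}" "linear T" "inj T"
  shows "dim (T ` F i) = block_dims i"
proof -
  have "dim (T ` F i) = card (e ` {p. merged i (blk p)})"
    unfolding F_span[OF assms(1)] by (rule dim_image_span[OF assms(2,3) independent_e])
  also have "\<dots> = block_dims i"
    unfolding block_dims_def by (rule card_image) (rule inj_on_subset[OF inj_e subset_UNIV])
  finally show ?thesis .
qed

end

text \<open>The image of \<open>F i\<close> consists of reflection vectors and so lies in some
  \<open>F j\<close>; the preimage of \<open>F j\<close> likewise lies in \<open>F i\<close>. This
  serves both conjugating isomorphisms and single isometries of \<open>M\<close>.\<close>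

lemma component_correspondence:
  assumes b: "block_over e cf blk \<kappa> N M" "block_over e' cf' blk' \<kappa>' N' M'"
    and fin: "\<And>i. finite {j. block_over.merged cf blk M i j}" "\<And>i. finite {j. block_over.merged cf' blk' M' i j}"
    and T: "linear T" "bij T" and eqv: "\<And>x. (\<exists>f. reflects M x f) \<longleftrightarrow> (\<exists>f. reflects M' (T x) f)"
  shows "\<exists>j. T ` block_over.F cf blk M i = block_over.F cf' blk' M' j \<and>
    block_over.block_dims cf blk M i = block_over.block_dims cf' blk' M' j"
proof -
  interpret A: block_over e cf blk \<kappa> N M by (rule b(1))
  interpret B: block_over e' cf' blk' \<kappa>' N' M' by (rule b(2))
  have T0: "T x = 0 \<longleftrightarrow> x = 0" for x
    using injD[OF bij_is_inj[OF T(2)], of x 0] linear_0[OF T(1)] by auto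
  obtain q where q: "blk q = i" using A.ex_blk by blast
  have eq: "e q \<in> A.F i" "A.P i (e q) \<noteq> 0"
    by (simp_all add: A.e_in_F A.P_e q A.merged_refl A.e_nonzero)
  have "\<exists>p. cf' p (T (e q)) \<noteq> 0"
    using T0[of "e q"] A.e_nonzero[of q] B.cf_eqI[of "T (e q)" 0] by (auto simp: B.cf_simps)
  then obtain j where j: "B.P j (T (e q)) \<noteq> 0" using B.cf_nonzero_P by blast
  have sub: "T ` A.F i \<subseteq> B.F j"
  proof (rule B.reflecting_subspace_in_F)
    show "subspace (T ` A.F i)" by (rule linear_subspace_image[OF T(1) A.subspace_F])
    show "\<exists>f. reflects M' x f" if "x \<in> T ` A.F i" "x \<noteq> 0" for x
    proof -
      obtain w where w: "x = T w" "w \<in> A.F i" using \<open>x \<in> T ` A.F i\<close> by blast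
      then have "w \<noteq> 0" using \<open>x \<noteq> 0\<close> T0 by blast
      then show ?thesis using A.F_reflects[OF fin(1) w(2)] eqv[of w] w(1) by simp
    qed
  qed (use eq j in auto)
  have vim: "{v. T v \<in> B.F j} \<subseteq> A.F i"
  proof (rule A.reflecting_subspace_in_F)
    show "subspace {v. T v \<in> B.F j}"
      using B.subspace_F[of j] by (auto simp: subspace_def linear_0[OF T(1)] linear_add[OF T(1)] linear_cmul[OF T(1)])
    show "\<exists>f. reflects M x f" if "x \<in> {v. T v \<in> B.F j}" "x \<noteq> 0" for x
    proof -
      have "T x \<in> B.F j" "T x \<noteq> 0" using that T0 by simp_all
      then show ?thesis using B.F_reflects[OF fin(2)] eqv[of x] by simp
    qed
    show "e q \<in> {v. T v \<in> B.F j}" using sub eq(1) by blast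
  qed (rule eq(2))
  have "B.F j \<subseteq> T ` A.F i"
  proof
    fix v assume v: "v \<in> B.F j"
    obtain x where x: "v = T x" using surjD[OF bij_is_surj[OF T(2)], of v] by blast
    then have "x \<in> A.F i" using v vim by blast
    then show "v \<in> T ` A.F i" using x by blast
  qed
  with sub have eqF: "T ` A.F i = B.F j" by (rule subset_antisym)
  moreover have "dim (B.F j) = B.block_dims j"
    using B.dim_image_F[OF fin(2) linear_id inj_on_id] by simp
  moreover have "dim (T ` A.F i) = A.block_dims i"
    using A.dim_image_F[OF fin(1) T(1) bij_is_inj[OF T(2)]] .
  ultimately show ?thesis by auto
qed

text \<open>Conjugation by \<open>T\<close> turns the reflection along \<open>x\<close> into the one
  along \<open>T x\<close>.\<close>

lemma conjugate_reflects:
  assumes "conjugate_subgroups (Isom N) (Isom N')"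
  obtains T where "linear T" "bij T" "\<And>x. (\<exists>f. reflects N x f) \<longleftrightarrow> (\<exists>f. reflects N' (T x) f)"
proof -
  obtain T where T: "T \<in> carrier GL" "Isom N = (\<lambda>h. inv\<^bsub>GL\<^esub> T \<otimes>\<^bsub>GL\<^esub> h \<otimes>\<^bsub>GL\<^esub> T) ` Isom N'"
    using assms unfolding conjugate_subgroups_def by blast
  define S where "S = inv_into UNIV T"
  have bij: "bij T" and lin: "linear T" using T(1) by (auto simp: GL_def bounded_linear.linear)
  have linS: "linear S" unfolding S_def by (rule linear_inv_into[OF lin bij])
  have TS: "T (S v) = v" "S (T v) = v" for v
    using bij by (simp_all add: S_def bij_is_surj surj_f_inv_f bij_is_inj)
  have I: "Isom N = (\<lambda>h v. S (h (T v))) ` Isom N'"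
    unfolding T(2) m_inv_GL[OF T(1)] S_def by (auto simp: GL_def comp_def)
  have "\<exists>f. reflects N' (T x) f" if r: "reflects N x f" for x f
  proof -
    have f: "linear f" "f x = 1" and R: "(\<lambda>v. v - (2 * f v) *\<^sub>R x) \<in> Isom N"
      using r by (auto simp: reflects_iff_Isom)
    obtain h where h: "(\<lambda>v. v - (2 * f v) *\<^sub>R x) = (\<lambda>v. S (h (T v)))" "h \<in> Isom N'"
      using R unfolding I by (rule imageE)
    have "h v = v - (2 * f (S v)) *\<^sub>R T x" for v
    proof -
      have "T (S (h (T (S v)))) = T (S v - (2 * f (S v)) *\<^sub>R x)" using fun_cong[OF h(1), of "S v"] by simp
      then show ?thesis by (simp add: TS linear_diff[OF lin] linear_cmul[OF lin])
    qed
    then have "h = (\<lambda>v. v - (2 * f (S v)) *\<^sub>R T x)" by (rule ext)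
    with h(2) have "(\<lambda>v. v - (2 * f (S v)) *\<^sub>R T x) \<in> Isom N'" by simp
    moreover have "linear (\<lambda>v. f (S v))" using linear_compose[OF linS f(1)] by (simp add: comp_def)
    ultimately have "reflects N' (T x) (\<lambda>v. f (S v))" by (simp add: reflects_iff_Isom TS f(2))
    then show ?thesis by blast
  qed
  moreover have "\<exists>f. reflects N x f" if r: "reflects N' (T x) f" for x f
  proof -
    have f: "linear f" "f (T x) = 1" and R: "(\<lambda>v. v - (2 * f v) *\<^sub>R T x) \<in> Isom N'"
      using r by (auto simp: reflects_iff_Isom)
    have "(\<lambda>v. S (T v - (2 * f (T v)) *\<^sub>R T x)) \<in> Isom N" unfolding I using imageI[OF R, of "\<lambda>h v. S (h (T v))"] by simp
    then have "(\<lambda>v. v - (2 * f (T v)) *\<^sub>R x) \<in> Isom N"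
      by (simp add: linear_diff[OF linS] linear_cmul[OF linS] TS)
    moreover have "linear (\<lambda>v. f (T v))" using linear_compose[OF lin f(1)] by (simp add: comp_def)
    ultimately have "reflects N x (\<lambda>v. f (T v))" by (simp add: reflects_iff_Isom f(2))
    then show ?thesis by blast
  qed
  ultimately have "(\<exists>f. reflects N x f) \<longleftrightarrow> (\<exists>f. reflects N' (T x) f)" for x by blast
  then show ?thesis by (rule that[OF lin bij])
qed

lemma conjugate_block_dims:
  assumes b: "block_over e cf blk \<kappa> N N" "block_over e' cf' blk' \<kappa>' N' N'"
    and fin: "\<And>i. finite {j. block_over.merged cf blk N i j}" "\<And>i. finite {j. block_over.merged cf' blk' N' i j}"
    and conj: "conjugate_subgroups (Isom N) (Isom N')"
  shows "range (block_over.block_dims cf blk N) = range (block_over.block_dims cf' blk' N')"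
proof -
  obtain T where T: "linear T" "bij T" and eqv: "\<And>x. (\<exists>f. reflects N x f) \<longleftrightarrow> (\<exists>f. reflects N' (T x) f)"
    using conjugate_reflects[OF conj] by blast
  define S where "S = inv_into UNIV T"
  have S: "linear S" "bij S" unfolding S_def using linear_inv_into[OF T] bij_imp_bij_inv[OF T(2)] by auto
  have eqv': "(\<exists>f. reflects N' x f) \<longleftrightarrow> (\<exists>f. reflects N (S x) f)" for x
    using eqv[of "S x"] T(2) by (simp add: S_def bij_is_surj surj_f_inv_f)
  have "range (block_over.block_dims cf blk N) \<subseteq> range (block_over.block_dims cf' blk' N')"
    using component_correspondence[OF b fin T eqv] by blast
  moreover have "range (block_over.block_dims cf' blk' N') \<subseteq> range (block_over.block_dims cf blk N)"
    using component_correspondence[OF b(2,1) fin(2,1) S eqv'] by blast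
  ultimately show ?thesis by (rule subset_antisym)
qed


section \<open>Overgroups\<close>

context block_over begin

lemma Isom_bounded_linear:
  assumes T: "T \<in> Isom M"
  shows "bounded_linear T"
proof -
  obtain c C where c: "c > 0" "\<And>x. c * norm x \<le> M x" "\<And>x. M x \<le> C * norm x" using M_bounds by metis
  have "norm (T x) \<le> norm x * (C / c)" for x
  proof -
    have "c * norm (T x) \<le> C * norm x" using c(2)[of "T x"] c(3)[of x] T by (simp add: Isom_def)
    then show ?thesis using c(1) by (simp add: field_simps)
  qed
  then show ?thesis
    using T unfolding bounded_linear_def bounded_linear_axioms_def Isom_def by blast
qed

lemma Isom_permutes_components:
  assumes fin: "\<And>i. finite {j. merged i j}" and T: "T \<in> Isom M"
  shows "\<exists>j. T ` F i = F j \<and> block_dims i = block_dims j"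
proof (rule component_correspondence[OF _ _ fin fin])
  show "linear T" "bij T" using T Isom_bij[OF M_norm T] by (auto simp: Isom_def)
  show "(\<exists>f. reflects M x f) \<longleftrightarrow> (\<exists>f. reflects M (T x) f)" for x
    using reflects_image[OF _ T \<open>bij T\<close>, of x] reflects_pullback[OF M_norm _ T, of x] by blast
qed (rule block_over_axioms)+

text \<open>\<open>M\<close> may scale different blocks differently, but not interchangeable ones,
  since their swap is also an \<open>M\<close>-isometry.\<close>

lemma swappable_\<mu>:
  assumes "i \<noteq> j" "\<kappa> i = \<kappa> j" "card (blk -` {i}) = card (blk -` {j})"
  shows "\<mu> i = \<mu> j"
proof -
  obtain S where S: "S \<in> Isom N" "\<And>w. w \<in> E i \<Longrightarrow> S w \<in> E j" "\<And>w. w \<in> E i \<Longrightarrow> B j (S w) (S w) = B i w w"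
    using block_swap[OF assms] by metis
  obtain q where q: "blk q = i" using ex_blk by blast
  have eE: "e q \<in> E i" using e_in_E[of q] by (simp add: q)
  have pos: "B i (e q) (e q) > 0" by (rule B_pos[OF eE e_nonzero])
  have MS: "M (S (e q)) = M (e q)" using S(1) sub by (auto simp: Isom_def)
  have "(\<mu> j)\<^sup>2 * B i (e q) (e q) = (M (S (e q)))\<^sup>2"
    unfolding M_E[OF S(2)[OF eE]] S(3)[OF eE] ..
  also have "\<dots> = (\<mu> i)\<^sup>2 * B i (e q) (e q)" unfolding MS by (rule M_E[OF eE])
  finally have "(\<mu> j)\<^sup>2 * B i (e q) (e q) = (\<mu> i)\<^sup>2 * B i (e q) (e q)" .
  then have "(\<mu> j)\<^sup>2 = (\<mu> i)\<^sup>2" using pos by simp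
  then show ?thesis using \<mu>_pos[of i] \<mu>_pos[of j] by (simp add: power2_eq_iff_nonneg less_imp_le)
qed

text \<open>With blocks as components, an \<open>M\<close>-isometry permutes blocks of equal size.
  Equal size forces equal class, hence equal scale \<open>\<mu>\<close>; so it is Euclidean between
  blocks and preserves classes, and \<open>N_isometry\<close> applies.\<close>

lemma Isom_subset_of_rigid:
  assumes rigid: "\<And>i j. merged i j \<Longrightarrow> i = j"
    and sizes: "\<And>i j. card (blk -` {i}) = card (blk -` {j}) \<Longrightarrow> \<kappa> i = \<kappa> j"
  shows "Isom M \<subseteq> Isom N"
proof
  have m: "merged i j \<longleftrightarrow> i = j" for i j using rigid merged_refl by blast
  have F: "F i = E i" for i by (auto simp: F_def E_def m)
  have fin_m: "finite {j. merged i j}" for i by (simp add: m)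
  have d: "block_dims i = card (blk -` {i})" for i
    unfolding block_dims_def by (rule arg_cong[where f = card]) (auto simp: m)
  have le: "N (T v) \<le> N v" if T: "T \<in> Isom M" for T v
  proof -
    have "\<forall>i. \<exists>j. T ` E i = E j \<and> card (blk -` {i}) = card (blk -` {j})"
      using Isom_permutes_components[OF fin_m T] by (simp add: F d)
    then obtain \<sigma> where \<sigma>: "\<And>i. T ` E i = E (\<sigma> i)" "\<And>i. card (blk -` {i}) = card (blk -` {\<sigma> i})" by metis
    have injT: "inj T" by (rule bij_is_inj[OF Isom_bij[OF M_norm T]])
    have "i = j" if "\<sigma> i = \<sigma> j" for i j
    proof -
      have "T ` E i = T ` E j" using \<sigma>(1) that by simp
      then have "F i = F j" using inj_image_eq_iff[OF injT] F by simp
      then show ?thesis using F_eq_iff[OF fin_m] m by simp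
    qed
    then have inj: "inj \<sigma>" by (rule injI)
    have \<kappa>\<sigma>: "\<kappa> (\<sigma> i) = \<kappa> i" for i by (rule sizes[OF \<sigma>(2), symmetric])
    have \<mu>\<sigma>: "\<mu> (\<sigma> i) = \<mu> i" for i
    proof (cases "i = \<sigma> i")
      case False
      then show ?thesis by (rule swappable_\<mu>[OF _ \<kappa>\<sigma>[symmetric] \<sigma>(2), symmetric])
    qed (rule arg_cong[OF sym])
    show ?thesis
    proof (rule N_isometry[OF Isom_bounded_linear[OF T] inj \<kappa>\<sigma>])
      fix i w assume "\<And>p. blk p \<noteq> i \<Longrightarrow> cf p w = 0"
      then have w: "w \<in> E i" by (simp add: E_def)
      have Tw: "T w \<in> E (\<sigma> i)" using \<sigma>(1)[of i] w by blast
      have MT: "M (T w) = M w" using T by (simp add: Isom_def)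
      have "(\<mu> i)\<^sup>2 * B (\<sigma> i) (T w) (T w) = (M (T w))\<^sup>2" unfolding M_E[OF Tw] \<mu>\<sigma> ..
      also have "\<dots> = (\<mu> i)\<^sup>2 * B i w w" unfolding MT by (rule M_E[OF w])
      finally have "(\<mu> i)\<^sup>2 * B (\<sigma> i) (T w) (T w) = (\<mu> i)\<^sup>2 * B i w w" .
      then have "B (\<sigma> i) (T w) (T w) = B i w w" using \<mu>_pos[of i] by simp
      then show "(\<forall>p. blk p \<noteq> \<sigma> i \<longrightarrow> cf p (T w) = 0) \<and>
          (\<Sum>p\<in>blk -` {\<sigma> i}. (cf p (T w))\<^sup>2) = (\<Sum>p\<in>blk -` {i}. (cf p w)\<^sup>2)"
        using Tw by (simp add: E_def B_def power2_eq_square)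
    qed
  qed
  fix T assume T: "T \<in> Isom M"
  have "N (T v) = N v" for v
  proof -
    have "inv_into UNIV T (T v) = v" using Isom_bij[OF M_norm T] by (simp add: bij_is_inj)
    then show ?thesis using le[OF T, of v] le[OF Isom_inv[OF M_norm T], of "T v"] by simp
  qed
  then show "T \<in> Isom N" using T by (simp add: Isom_def)
qed

text \<open>The blocks in \<open>C\<close> are made one Euclidean space and the rest is split off as
  a direct summand, so that isometries of the Euclidean part extend by the identity. Equivalence
  holds because only finitely many bounded projections are involved.\<close>

lemma enlarged_norm:
  assumes C: "finite C"
  defines "M' \<equiv> \<lambda>v. M (v - (\<Sum>c\<in>C. P c v)) + L2_set (\<lambda>c. M (P c v)) C"
  shows "equivalent_norm M'"
proof -
  define Q where "Q = (\<lambda>v. \<Sum>c\<in>C. P c v)"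
  have Q_bl: "bounded_linear Q" unfolding Q_def by (intro bounded_linear_sum P_bl)
  note Q_lin = bounded_linear.linear[OF Q_bl]
  have M': "M' v = M (v - Q v) + L2_set (\<lambda>c. M (P c v)) C" for v by (simp add: M'_def Q_def)
  have P0: "0 \<le> L2_set (\<lambda>c. M (P c v)) C" for v by (rule L2_set_nonneg)
  have Ple: "M (P c v) \<le> M' v" if "c \<in> C" for c v
    using member_le_L2_set[OF C that, of "\<lambda>c. M (P c v)"] M_simps(1)[of "v - Q v"] unfolding M' by linarith
  have lower: "M v \<le> (1 + real (card C)) * M' v" for v
  proof -
    have Qle: "M (Q v) \<le> real (card C) * M' v"
    proof -
      have "M (\<Sum>c\<in>A. P c v) \<le> (\<Sum>c\<in>A. M (P c v))" if "finite A" for A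
        using that
      proof (induction A rule: finite_induct)
        case (insert a A)
        then show ?case using M_simps(4)[of "P a v" "\<Sum>c\<in>A. P c v"] by simp
      qed (simp add: M_simps)
      then have "M (Q v) \<le> (\<Sum>c\<in>C. M (P c v))" unfolding Q_def using C by blast
      also have "\<dots> \<le> (\<Sum>c\<in>C. M' v)" by (rule sum_mono) (rule Ple)
      finally show ?thesis by simp
    qed
    have "M v \<le> M (v - Q v) + M (Q v)" using M_simps(4)[of "v - Q v" "Q v"] by simp
    moreover have "M (v - Q v) \<le> M' v" using P0 unfolding M' by simp
    ultimately show ?thesis using Qle by (simp add: algebra_simps)
  qed
  have norm': "is_norm M'"
    unfolding is_norm_def
  proof (intro conjI allI)
    show nn: "0 \<le> M' v" for v unfolding M' using P0 M_simps(1) by (simp add: add_nonneg_nonneg)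
    show "M' v = 0 \<longleftrightarrow> v = 0" for v
    proof
      assume "M' v = 0"
      then have "M v = 0" using lower[of v] M_simps(1)[of v] by simp
      then show "v = 0" by (simp add: M_simps)
    qed (simp add: M' linear_0[OF Q_lin] P_simps M_simps L2_set_def)
    show "M' (r *\<^sub>R v) = \<bar>r\<bar> * M' v" for r v
    proof -
      have "r *\<^sub>R v - Q (r *\<^sub>R v) = r *\<^sub>R (v - Q v)" by (simp add: linear_cmul[OF Q_lin] algebra_simps)
      then show ?thesis
        by (simp add: M' P_simps M_simps(3) L2_set_right_distrib distrib_left)
    qed
    show "M' (v + w) \<le> M' v + M' w" for v w
    proof -
      have eq: "v + w - Q (v + w) = (v - Q v) + (w - Q w)" by (simp add: linear_add[OF Q_lin])
      have "M (v + w - Q (v + w)) \<le> M (v - Q v) + M (w - Q w)" unfolding eq by (rule M_simps(4))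
      moreover have "L2_set (\<lambda>c. M (P c (v + w))) C \<le> L2_set (\<lambda>c. M (P c v) + M (P c w)) C"
        by (rule L2_set_mono) (simp_all add: P_simps M_simps)
      moreover have "\<dots> \<le> L2_set (\<lambda>c. M (P c v)) C + L2_set (\<lambda>c. M (P c w)) C" by (rule L2_set_triangle_ineq)
      ultimately show ?thesis unfolding M' by linarith
    qed
  qed
  obtain a b where ab: "a > 0" "b > 0" "\<And>x. a * norm x \<le> M x" "\<And>x. M x \<le> b * norm x" using M_bounds by metis
  have "\<exists>K\<ge>0. \<forall>v. M (T v) \<le> K * norm v" if T: "bounded_linear T" for T
  proof -
    obtain K where K: "K \<ge> 0" "\<And>v. norm (T v) \<le> norm v * K" using bounded_linear.nonneg_bounded[OF T] by blast
    have "M (T v) \<le> (b * K) * norm v" for v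
    proof -
      have "M (T v) \<le> b * norm (T v)" by (rule ab(4))
      also have "\<dots> \<le> b * (norm v * K)" using ab(2) K(2)[of v] by (intro mult_left_mono) simp_all
      finally show ?thesis by (simp add: mult_ac)
    qed
    then show ?thesis using K ab(2) by (intro exI[of _ "b * K"]) simp
  qed
  note upper = this
  obtain K0 where K0: "K0 \<ge> 0" "\<And>v. M (v - Q v) \<le> K0 * norm v"
    using upper[OF bounded_linear_sub[OF bounded_linear_ident Q_bl]] by blast
  obtain K where K: "\<And>c. K c \<ge> 0" "\<And>c v. M (P c v) \<le> K c * norm v"
    using upper[OF P_bl] by metis
  have up: "M' v \<le> (K0 + (\<Sum>c\<in>C. K c) + 1) * norm v" for v
  proof -
    have "L2_set (\<lambda>c. M (P c v)) C \<le> (\<Sum>c\<in>C. M (P c v))" by (rule L2_set_le_sum) (rule M_simps(1))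
    also have "\<dots> \<le> (\<Sum>c\<in>C. K c * norm v)" by (intro sum_mono K(2))
    finally have "L2_set (\<lambda>c. M (P c v)) C \<le> (\<Sum>c\<in>C. K c) * norm v" by (simp add: sum_distrib_right)
    then have "M' v \<le> K0 * norm v + (\<Sum>c\<in>C. K c) * norm v" unfolding M' using K0(2)[of v] by linarith
    then show ?thesis unfolding distrib_right using norm_ge_zero[of v] by linarith
  qed
  have low: "a / (1 + real (card C)) * norm v \<le> M' v" for v
  proof -
    have "a * norm v \<le> (1 + real (card C)) * M' v" using ab(3)[of v] lower[of v] by linarith
    then show ?thesis by (simp add: field_simps)
  qed
  have "0 < a / (1 + real (card C))" using ab(1) by simp
  moreover have "0 < K0 + (\<Sum>c\<in>C. K c) + 1" using K0(1) sum_nonneg[of C K] K(1) by (simp add: add_nonneg_pos)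
  ultimately show ?thesis unfolding equivalent_norm_def using norm' low up by blast
qed

text \<open>Two finite components that are fixed by every isometry can be merged: the group gains a
  reflection along a vector with parts in both of them.\<close>

lemma enlargeable:
  assumes fin: "\<And>i. finite {j. merged i j}" and nm: "\<not> merged i1 i2"
    and fix1: "\<And>T. T \<in> Isom M \<Longrightarrow> T ` F i1 = F i1" and fix2: "\<And>T. T \<in> Isom M \<Longrightarrow> T ` F i2 = F i2"
  shows "\<exists>M'. equivalent_norm M' \<and> Isom M \<subset> Isom M'"
proof -
  define C1 C2 where "C1 = {j. merged i1 j}" and "C2 = {j. merged i2 j}"
  define C where "C = C1 \<union> C2"
  have C: "finite C1" "finite C2" "finite C" using fin by (auto simp: C1_def C2_def C_def)
  have F_cong: "F i = F j \<longleftrightarrow> merged i j" for i j by (rule F_eq_iff[OF fin])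
  have disj: "C1 \<inter> C2 = {}"
  proof (rule ccontr)
    assume "C1 \<inter> C2 \<noteq> {}"
    then obtain j where "merged i1 j" "merged i2 j" by (auto simp: C1_def C2_def)
    then have "F i1 = F i2" using F_cong by metis
    then show False using nm F_cong by simp
  qed
  define Q where "Q = (\<lambda>v. \<Sum>c\<in>C. P c v)"
  define Q1 where "Q1 = (\<lambda>v. \<Sum>c\<in>C1. P c v)"
  define Q2 where "Q2 = (\<lambda>v. \<Sum>c\<in>C2. P c v)"
  have Q: "Q v = Q1 v + Q2 v" for v
    unfolding Q_def Q1_def Q2_def C_def using C disj by (intro sum.union_disjoint)
  have cfsum: "cf p (\<Sum>c\<in>A. P c v) = (if blk p \<in> A then cf p v else 0)" if "finite A" for A p v
    using that by (simp add: cf_simps cf_P)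
  have Q1F: "Q1 v \<in> F i1" and Q2F: "Q2 v \<in> F i2" for v
    using C by (auto simp: F_def Q1_def Q2_def cfsum C1_def C2_def)
  have Q_bl: "bounded_linear Q" unfolding Q_def by (intro bounded_linear_sum P_bl)
  note Q_lin = bounded_linear.linear[OF Q_bl]
  have QF: "Q x = x" if "x \<in> F i1 \<or> x \<in> F i2" for x
    unfolding Q_def using that by (intro sum_P_eq[OF C(3)]) (auto simp: F_def C_def C1_def C2_def)
  define M' where "M' = (\<lambda>v. M (v - Q v) + L2_set (\<lambda>c. M (P c v)) C)"
  have M'_eq: "equivalent_norm M'" unfolding M'_def Q_def by (rule enlarged_norm[OF C(3)])
  \<comment> \<open>\<open>M\<close> is already Euclidean on each of the two components, so the
    Euclidean sum over \<open>C\<close> only depends on \<open>M (Q1 v)\<close> and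
    \<open>M (Q2 v)\<close>.\<close>
  have L2: "(\<Sum>c\<in>C. (M (P c v))\<^sup>2) = (M (Q1 v))\<^sup>2 + (M (Q2 v))\<^sup>2" for v
  proof -
    have P1: "P c (Q1 v) = P c v" if "c \<in> C1" for c
      using that C by (intro cf_eqI) (simp add: cf_P Q1_def cfsum)
    have P2: "P c (Q2 v) = P c v" if "c \<in> C2" for c
      using that C by (intro cf_eqI) (simp add: cf_P Q2_def cfsum)
    have "(\<Sum>c\<in>C. (M (P c v))\<^sup>2) = (\<Sum>c\<in>C1. (M (P c v))\<^sup>2) + (\<Sum>c\<in>C2. (M (P c v))\<^sup>2)"
      unfolding C_def using C disj by (intro sum.union_disjoint)
    also have "(\<Sum>c\<in>C1. (M (P c v))\<^sup>2) = (\<Sum>c\<in>C1. (M (P c (Q1 v)))\<^sup>2)" by (simp add: P1)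
    also have "(\<Sum>c\<in>C2. (M (P c v))\<^sup>2) = (\<Sum>c\<in>C2. (M (P c (Q2 v)))\<^sup>2)" by (simp add: P2)
    finally show ?thesis
      using F_star(2)[OF fin Q1F, of v] F_star(2)[OF fin Q2F, of v] by (simp add: C1_def C2_def)
  qed
  have sub': "Isom M \<subseteq> Isom M'"
  proof
    fix T assume T: "T \<in> Isom M"
    have Tl: "linear T" and MT: "M (T v) = M v" for v using T by (auto simp: Isom_def)
    have T_bl: "bounded_linear T" by (rule Isom_bounded_linear[OF T])
    have injT: "inj T" by (rule bij_is_inj[OF Isom_bij[OF M_norm T]])
    \<comment> \<open>\<open>T\<close> permutes the components and keeps the two chosen ones, so it
      takes a block outside \<open>C\<close> into a component that avoids \<open>C\<close>.\<close>
    have out: "Q (T (P c w)) = 0" if c: "c \<notin> C" for c w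
    proof -
      obtain j where j: "T ` F c = F j" using Isom_permutes_components[OF fin T] by blast
      have nj: "\<not> merged j l" if l: "l \<in> C" for l
      proof
        assume "merged j l"
        then have jl: "F j = F l" by (simp add: F_cong)
        from l consider "merged i1 l" | "merged i2 l" by (auto simp: C_def C1_def C2_def)
        then have "T ` F c = T ` F i1 \<or> T ` F c = T ` F i2"
          using j jl fix1[OF T] fix2[OF T] F_cong by metis
        then have "F c = F i1 \<or> F c = F i2" using inj_image_eq_iff[OF injT] by blast
        then have "merged c i1 \<or> merged c i2" by (simp add: F_cong)
        then show False using c merged_sym by (auto simp: C_def C1_def C2_def)
      qed
      have "P c w \<in> F c" by (auto simp: F_def cf_P merged_refl)
      then have "T (P c w) \<in> F j" using j by blast
      then have "P l (T (P c w)) = 0" if "l \<in> C" for l using nj[OF that] F_P by blast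
      then show ?thesis by (simp add: Q_def)
    qed
    \<comment> \<open>Continuity passes from single blocks to all vectors without a part in
      \<open>C\<close>.\<close>
    have rest: "Q (T v) = 0" if "Q v = 0" for v
    proof -
      have Pc: "P c v = 0" if "c \<in> C" for c
      proof -
        have "P c (Q v) = P c v" using that C by (intro cf_eqI) (simp add: cf_P Q_def cfsum)
        then show ?thesis using \<open>Q v = 0\<close> by (simp add: P_simps)
      qed
      have "Q (T (P c v)) = 0" for c
        using out[of c v] Pc[of c] by (cases "c \<in> C") (simp_all add: linear_0[OF Tl] linear_0[OF Q_lin])
      then have "Q (T (\<Sum>c<n. P c v)) = 0" for n
        by (simp add: linear_sum[OF Tl] linear_sum[OF Q_lin])
      moreover have "(\<lambda>n. Q (T (\<Sum>c<n. P c v))) \<longlonglongrightarrow> Q (T v)"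
        by (intro bounded_linear.tendsto[OF Q_bl] bounded_linear.tendsto[OF T_bl] partial_blocks_tendsto)
      ultimately show ?thesis by (simp add: LIMSEQ_const_iff)
    qed
    have TF1: "T (Q1 v) \<in> F i1" and TF2: "T (Q2 v) \<in> F i2" for v
      using fix1[OF T] fix2[OF T] Q1F Q2F by blast+
    have QT: "Q (T v) = T (Q1 v) + T (Q2 v)" for v
    proof -
      have "Q (v - Q v) = 0" using QF[of "Q1 v"] QF[of "Q2 v"] Q1F Q2F
        by (simp add: linear_diff[OF Q_lin] linear_add[OF Q_lin] Q[of v])
      then have "Q (T (v - Q v)) = 0" by (rule rest)
      then have "Q (T v) = Q (T (Q1 v)) + Q (T (Q2 v))"
        by (simp add: linear_diff[OF Tl] linear_diff[OF Q_lin] Q[of v] linear_add[OF Tl] linear_add[OF Q_lin])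
      then show ?thesis using QF TF1 TF2 by simp
    qed
    have "Q1 (T v) = T (Q1 v)" "Q2 (T v) = T (Q2 v)" for v
    proof -
      have "cf p (Q1 (T v)) = cf p (T (Q1 v))" for p
      proof (cases "blk p \<in> C1")
        case True
        then have "cf p (Q1 (T v)) = cf p (Q (T v))" using C by (simp add: Q1_def Q_def cfsum C_def)
        also have "\<dots> = cf p (T (Q1 v)) + cf p (T (Q2 v))" by (simp add: QT cf_simps)
        also have "cf p (T (Q2 v)) = 0" using TF2[of v] True disj by (auto simp: F_def C2_def)
        finally show ?thesis by simp
      next
        case False
        then show ?thesis using TF1[of v] C by (simp add: Q1_def cfsum F_def C1_def)
      qed
      then show 1: "Q1 (T v) = T (Q1 v)" by (rule cf_eqI)
      show "Q2 (T v) = T (Q2 v)" using QT[of v] Q[of "T v"] 1 by simp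
    qed
    moreover have "T v - Q (T v) = T (v - Q v)" for v
      by (simp add: QT Q[of v] linear_diff[OF Tl] linear_add[OF Tl])
    ultimately have "M' (T v) = M' v" for v
      unfolding M'_def L2_set_def L2 by (simp add: MT)
    then show "T \<in> Isom M'" using T by (simp add: Isom_def)
  qed
  obtain p q where p: "blk p = i1" and q: "blk q = i2" using ex_blk by metis
  have i12: "i1 \<noteq> i2" using nm merged_refl by blast
  then have pq: "p \<noteq> q" using p q by auto
  define \<alpha> \<beta> where "\<alpha> = M (e p)" and "\<beta> = M (e q)"
  have pos: "\<alpha> > 0" "\<beta> > 0"
    using M_simps(1,2)[of "e p"] M_simps(1,2)[of "e q"] e_nonzero by (auto simp: \<alpha>_def \<beta>_def order_less_le)
  \<comment> \<open>Both parts of \<open>y\<close> have \<open>M\<close>-length 1, and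
    \<open>f\<close> is the functional of the orthogonal reflection along \<open>y\<close> in the
    Euclidean sum.\<close>
  define y where "y = (1 / \<alpha>) *\<^sub>R e p + (1 / \<beta>) *\<^sub>R e q"
  define f where "f = (\<lambda>v. (\<alpha> * cf p v + \<beta> * cf q v) / 2)"
  have f: "linear f" unfolding f_def by (rule linearI) (simp_all add: cf_simps algebra_simps add_divide_distrib)
  have fy: "f y = 1" using pos pq by (simp add: f_def y_def cf_simps cf_e)
  have in12: "i1 \<in> C" "i2 \<in> C" by (simp_all add: C_def C1_def C2_def merged_refl)
  have Qy: "Q y = y"
    unfolding Q_def by (rule sum_P_eq[OF C(3)]) (use in12 p q in \<open>auto simp: y_def cf_simps cf_e\<close>)
  have Be: "B (blk r) w (e r) = cf r w" for w r
    using fin[of "blk r"] block_space_axioms by (simp add: B_def cf_e if_distrib block_space.fin[OF block_space_axioms] cong: if_cong)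
  have "M' (v - (2 * f v) *\<^sub>R y) = M' v" for v
  proof -
    define t where "t = 2 * f v"
    define w where "w = v - t *\<^sub>R y"
    have t: "t = \<alpha> * cf p v + \<beta> * cf q v" by (simp add: t_def f_def)
    have ww: "w - Q w = v - Q v" by (simp add: w_def linear_diff[OF Q_lin] linear_cmul[OF Q_lin] Qy)
    have other: "P c w = P c v" if "c \<noteq> i1" "c \<noteq> i2" for c
      using that by (simp add: w_def y_def P_simps P_e p q)
    have MP: "(M (P (blk r) x))\<^sup>2 = (M (e r))\<^sup>2 * B (blk r) x x" for r x
      using M_E[OF P_in_E, of "blk r" x] M_E[OF e_in_E, of r] Be[of r "e r"] by (simp add: B_P cf_e)
    have "(M (P (blk r) w))\<^sup>2 = (M (P (blk r) v))\<^sup>2 - 2 * t * M (e r) * cf r v + t\<^sup>2"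
      if r: "r = p \<or> r = q" for r
    proof -
      have pr: "M (e r) > 0" using r pos by (auto simp: \<alpha>_def \<beta>_def)
      have By: "B (blk r) y x = cf r x / M (e r)" for x
        using r p q i12 Be[of p x] Be[of q x] e_in_E[of p] e_in_E[of q]
        by (auto simp: y_def B_simps B_commute[of _ _ x] B_E_other \<alpha>_def \<beta>_def)
      have cfy: "cf r y = 1 / M (e r)"
        using r pq by (auto simp: y_def cf_simps cf_e \<alpha>_def \<beta>_def)
      have "B (blk r) w w = B (blk r) v v - 2 * (t / M (e r)) * cf r v + (t / M (e r))\<^sup>2"
        by (simp add: w_def B_simps By B_commute[of _ v y] cfy power2_eq_square algebra_simps)
      moreover have "(M (e r))\<^sup>2 * (B (blk r) v v - 2 * (t / M (e r)) * cf r v + (t / M (e r))\<^sup>2)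
          = (M (e r))\<^sup>2 * B (blk r) v v - 2 * t * M (e r) * cf r v + t\<^sup>2"
        using pr by (simp add: field_simps power2_eq_square)
      ultimately show ?thesis using MP[of r w] MP[of r v] by simp
    qed
    from this[of p] this[of q] have "(M (P i1 w))\<^sup>2 = (M (P i1 v))\<^sup>2 - 2 * t * \<alpha> * cf p v + t\<^sup>2"
        "(M (P i2 w))\<^sup>2 = (M (P i2 v))\<^sup>2 - 2 * t * \<beta> * cf q v + t\<^sup>2"
      by (simp_all add: p q \<alpha>_def \<beta>_def)
    moreover have "2 * t * \<alpha> * cf p v + 2 * t * \<beta> * cf q v = 2 * t\<^sup>2"
      unfolding t by (simp add: power2_eq_square algebra_simps)
    \<comment> \<open>Only the parts in blocks \<open>i1\<close> and \<open>i2\<close> change; their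
      squared lengths change separately, but the sum does not.\<close>
    ultimately have two: "(M (P i1 w))\<^sup>2 + (M (P i2 w))\<^sup>2 = (M (P i1 v))\<^sup>2 + (M (P i2 v))\<^sup>2" by linarith
    have split: "(\<Sum>c\<in>C. g c) = (\<Sum>c\<in>C - {i1, i2}. g c) + (g i1 + g i2)" for g :: "nat \<Rightarrow> real"
      using C(3) in12 i12 by (subst sum.subset_diff[of "{i1, i2}"]) auto
    have "(\<Sum>c\<in>C. (M (P c w))\<^sup>2) = (\<Sum>c\<in>C. (M (P c v))\<^sup>2)"
      unfolding split[of "\<lambda>c. (M (P c w))\<^sup>2"] split[of "\<lambda>c. (M (P c v))\<^sup>2"] two
      by (simp add: other)
    then have "M' w = M' v" by (simp add: M'_def L2_set_def ww)
    then show ?thesis by (simp add: w_def t_def)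
  qed
  then have R': "(\<lambda>v. v - (2 * f v) *\<^sub>R y) \<in> Isom M'"
    using f fy reflects_iff_Isom[of M' y f] by (simp add: reflects_def)
  have "(\<lambda>v. v - (2 * f v) *\<^sub>R y) \<notin> Isom M"
  proof
    assume "(\<lambda>v. v - (2 * f v) *\<^sub>R y) \<in> Isom M"
    then have "reflects M y f" using f fy by (simp add: reflects_iff_Isom)
    moreover have "P i1 y \<noteq> 0" "P i2 y \<noteq> 0"
      using i12 pos e_nonzero by (simp_all add: y_def P_simps P_e p q)
    ultimately show False using reflects_merged nm by blast
  qed
  then show ?thesis using M'_eq sub' R' by blast
qed

end


section \<open>The two families\<close>

text \<open>The supremum of the norm over an orbit is an invariant equivalent norm, whose isometry
  group is bounded and contains \<open>G\<close>.\<close>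

lemma maximal_bounded_subgroup_is_Isom:
  fixes G :: "('a::real_normed_vector \<Rightarrow> 'a) set"
  assumes G: "maximal_bounded_subgroup G"
  obtains M where "equivalent_norm M" "G = Isom M"
proof -
  have sg: "subgroup G GL" using G by (simp add: maximal_bounded_subgroup_def bounded_subgroup_def)
  obtain K where K: "\<And>g. g \<in> G \<Longrightarrow> onorm g \<le> K"
    using G by (auto simp: maximal_bounded_subgroup_def bounded_subgroup_def)
  have car: "g \<in> carrier GL" if "g \<in> G" for g using subgroup.subset[OF sg] that by blast
  have bl: "bounded_linear g" and bij: "bij g" if "g \<in> G" for g
    using car[OF that] by (auto simp: GL_def)
  have id: "(\<lambda>x. x) \<in> G" using subgroup.one_closed[OF sg] by (simp add: GL_def id_def)
  have comp: "(\<lambda>x. g (h x)) \<in> G" if "g \<in> G" "h \<in> G" for g h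
    using subgroup.m_closed[OF sg that] by (simp add: GL_def comp_def)
  have inv: "inv_into UNIV g \<in> G" if "g \<in> G" for g
    using subgroup.m_inv_closed[OF sg that] m_inv_GL[OF car[OF that]] by simp
  have le: "norm (g x) \<le> K * norm x" if "g \<in> G" for g x
    using onorm[OF bl[OF that], of x] mult_right_mono[OF K[OF that], of "norm x"] by simp
  define M where "M = (\<lambda>x. SUP g\<in>G. norm (g x))"
  have bdd: "bdd_above ((\<lambda>g. norm (g x)) ` G)" for x by (rule bdd_aboveI2) (rule le)
  have up: "norm (g x) \<le> M x" if "g \<in> G" for g x
    unfolding M_def by (rule cSUP_upper[OF that bdd])
  have least: "M x \<le> b" if "\<And>g. g \<in> G \<Longrightarrow> norm (g x) \<le> b" for x b
    unfolding M_def using id that by (intro cSUP_least) auto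
  have nle: "norm x \<le> M x" for x using up[OF id] .
  have scale_le: "M (c *\<^sub>R x) \<le> \<bar>c\<bar> * M x" for c x
  proof (rule least)
    fix g assume g: "g \<in> G"
    then show "norm (g (c *\<^sub>R x)) \<le> \<bar>c\<bar> * M x"
      using up[OF g, of x] by (simp add: linear_cmul[OF bounded_linear.linear[OF bl]] mult_left_mono)
  qed
  have "is_norm M"
    unfolding is_norm_def
  proof (intro conjI allI)
    show nn: "0 \<le> M x" for x using nle[of x] norm_ge_zero[of x] by linarith
    show "M x = 0 \<longleftrightarrow> x = 0" for x
    proof
      assume "x = 0"
      then show "M x = 0" using scale_le[of 0 x] nn[of 0] by simp
    qed (use nle[of x] in simp)
    show "M (c *\<^sub>R x) = \<bar>c\<bar> * M x" for c x
      by (rule abs_homogeneousI[OF subspace_UNIV scale_le nn UNIV_I])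
    show "M (x + y) \<le> M x + M y" for x y
    proof (rule least)
      fix g assume g: "g \<in> G"
      have "norm (g (x + y)) \<le> norm (g x) + norm (g y)"
        by (simp add: linear_add[OF bounded_linear.linear[OF bl[OF g]]] norm_triangle_ineq)
      then show "norm (g (x + y)) \<le> M x + M y" using up[OF g, of x] up[OF g, of y] by linarith
    qed
  qed
  moreover have "M x \<le> (\<bar>K\<bar> + 1) * norm x" for x
  proof (rule least)
    fix g assume "g \<in> G"
    have "K * norm x \<le> (\<bar>K\<bar> + 1) * norm x" by (intro mult_right_mono) auto
    then show "norm (g x) \<le> (\<bar>K\<bar> + 1) * norm x" using le[OF \<open>g \<in> G\<close>, of x] by linarith
  qed
  ultimately have M: "equivalent_norm M"
    unfolding equivalent_norm_def using nle by (intro conjI exI[of _ 1] exI[of _ "\<bar>K\<bar> + 1"]) auto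
  have inv_le: "M (h x) \<le> M x" if h: "h \<in> G" for h x
    by (rule least) (rule up[OF comp[OF _ h]])
  have sub: "G \<subseteq> Isom M"
  proof
    fix h assume h: "h \<in> G"
    have "M (h x) = M x" for x
      using inv_le[OF h, of x] inv_le[OF inv[OF h], of "h x"] bij[OF h] by (simp add: bij_is_inj)
    then show "h \<in> Isom M"
      using bij_is_surj[OF bij[OF h]] bounded_linear.linear[OF bl[OF h]] by (simp add: Isom_def)
  qed
  have "\<not> G \<subset> Isom M"
    using G bounded_subgroup_Isom[OF M] by (simp add: maximal_bounded_subgroup_def)
  then have "G = Isom M" using sub by blast
  with M show ?thesis by (rule that)
qed

section \<open>Block sizes that encode a real number\<close>

lemma ex_fibres_of_size:
  fixes n :: "nat \<Rightarrow> nat"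
  assumes "\<And>i. n i > 0"
  obtains blk :: "nat \<Rightarrow> nat" where "\<And>i. finite (blk -` {i})" "\<And>i. card (blk -` {i}) = n i"
proof -
  define S where "S = (SIGMA i:(UNIV :: nat set). {..<n i})"
  have "infinite S"
  proof
    assume "finite S"
    moreover have "fst ` S = UNIV" using assms by (force simp: S_def)
    ultimately show False using finite_imageI[of S fst] by simp
  qed
  moreover have "countable S" by simp
  ultimately obtain \<phi> :: "nat \<Rightarrow> nat \<times> nat" where \<phi>: "bij_betw \<phi> UNIV S"
    using bij_betw_from_nat_into by blast
  have fib: "bij_betw \<phi> ((fst \<circ> \<phi>) -` {i}) ({i} \<times> {..<n i})" for i
    unfolding bij_betw_def
  proof
    show "inj_on \<phi> ((fst \<circ> \<phi>) -` {i})" using \<phi> by (auto simp: bij_betw_def intro: inj_on_subset)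
    show "\<phi> ` ((fst \<circ> \<phi>) -` {i}) = {i} \<times> {..<n i}"
    proof
      show "{i} \<times> {..<n i} \<subseteq> \<phi> ` ((fst \<circ> \<phi>) -` {i})"
      proof
        fix x assume x: "x \<in> {i} \<times> {..<n i}"
        then have "x \<in> \<phi> ` UNIV" using \<phi> by (auto simp: bij_betw_def S_def)
        then obtain p where "x = \<phi> p" by blast
        then show "x \<in> \<phi> ` ((fst \<circ> \<phi>) -` {i})" using x by auto
      qed
      show "\<phi> ` ((fst \<circ> \<phi>) -` {i}) \<subseteq> {i} \<times> {..<n i}"
      proof
        fix x assume "x \<in> \<phi> ` ((fst \<circ> \<phi>) -` {i})"
        then have "fst x = i" "x \<in> S" using \<phi> by (auto simp: bij_betw_def)
        then show "x \<in> {i} \<times> {..<n i}" by (cases x) (simp add: S_def)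
      qed
    qed
  qed
  show ?thesis
  proof (rule that[of "fst \<circ> \<phi>"])
    show "finite ((fst \<circ> \<phi>) -` {i})" for i using bij_betw_finite[OF fib[of i]] by simp
    show "card ((fst \<circ> \<phi>) -` {i}) = n i" for i using bij_betw_same_card[OF fib[of i]] by simp
  qed
qed

text \<open>Block \<open>prod_encode (k, j)\<close> is number \<open>j\<close> in class
  \<open>k\<close>, so every class has infinitely many blocks.\<close>

definition class_index :: "nat \<Rightarrow> nat" where "class_index i = fst (prod_decode i)"

text \<open>The Dedekind cut of \<open>r\<close> is coded into the set of block dimensions.\<close>

definition odd_size :: "real \<Rightarrow> nat \<Rightarrow> nat" where
  "odd_size r k = 4 * k + 3 + (if of_rat (from_nat k) < r then 2 else 0)"

definition rigid_size :: "real \<Rightarrow> nat \<Rightarrow> nat" where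
  "rigid_size r i = odd_size r (class_index i)"

text \<open>Class 0 is the extra class and class \<open>k + 1\<close> repeats class \<open>k\<close>
  of the first family. The successor in the exponent makes the new sizes even and at least
  2.\<close>

definition loose_size :: "real \<Rightarrow> nat \<Rightarrow> nat" where
  "loose_size r i = (if class_index i = 0 then 2 ^ Suc (snd (prod_decode i)) else odd_size r (class_index i - 1))"

lemma class_index_encode: "class_index (prod_encode (k, j)) = k"
  by (simp add: class_index_def)

lemma surj_class_index: "surj class_index"
  by (rule surjI[of _ "\<lambda>k. prod_encode (k, 0)"]) (rule class_index_encode)

lemma odd_odd_size: "odd (odd_size r k)"
  by (simp add: odd_size_def)

text \<open>The residue modulo 4 is 3 or 1 according to the branch, and within one branch
  \<open>k\<close> can be read off.\<close>

lemma odd_size_inj: "odd_size r k = odd_size r l \<Longrightarrow> k = l"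
  by (auto simp: odd_size_def split: if_splits)

lemma range_odd_size_inj:
  assumes "range (odd_size r) = range (odd_size r')"
  shows "r = r'"
proof -
  \<comment> \<open>The value \<open>4 * k + 5\<close> occurs exactly when the rational with number
    \<open>k\<close> lies below \<open>s\<close>, so the range determines the cut.\<close>
  have mem: "4 * k + 5 \<in> range (odd_size s) \<longleftrightarrow> of_rat (from_nat k) < s" for k s
  proof
    assume "4 * k + 5 \<in> range (odd_size s)"
    then obtain l where l: "4 * k + 5 = odd_size s l" by blast
    show "of_rat (from_nat k) < s"
    proof (cases "of_rat (from_nat l) < s")
      case True
      then have "4 * k + 5 = 4 * l + 5" using l by (simp add: odd_size_def)
      then show ?thesis using True by simp
    next
      case False
      then have "4 * k + 5 = 4 * l + 3" using l by (simp add: odd_size_def)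
      then have False by presburger
      then show ?thesis ..
    qed
  next
    assume "of_rat (from_nat k) < s"
    then have "odd_size s k = 4 * k + 5" by (simp add: odd_size_def)
    then show "4 * k + 5 \<in> range (odd_size s)" by (metis rangeI)
  qed
  have eq: "of_rat (from_nat k) < r \<longleftrightarrow> of_rat (from_nat k) < r'" for k
    using mem[of k r] mem[of k r'] assms by simp
  have "\<not> s < s'" if "\<And>k. of_rat (from_nat k) < s \<longleftrightarrow> of_rat (from_nat k) < s'" for s s' :: real
  proof
    assume "s < s'"
    then obtain q :: rat where q: "s < of_rat q" "of_rat q < s'" using of_rat_dense by blast
    then show False using that[of "to_nat q"] by simp
  qed
  from this[of r r'] this[of r' r] eq show ?thesis by (meson linorder_neqE)
qed

lemma infinite_class:
  assumes "\<And>j. class_index j = k \<Longrightarrow> n j = m"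
  shows "infinite {j. class_index j = k \<and> n j = m}"
proof -
  have "range (\<lambda>j. prod_encode (k, j)) \<subseteq> {j. class_index j = k \<and> n j = m}"
    using assms by (auto simp: class_index_encode)
  moreover have "inj (\<lambda>j. prod_encode (k, j))" by (auto simp: inj_def)
  then have "infinite (range (\<lambda>j. prod_encode (k, j)))" using range_inj_infinite by blast
  ultimately show ?thesis using finite_subset by blast
qed

lemma rigid_merged:
  assumes "block_over e cf blk class_index N M" and sz: "\<And>i. card (blk -` {i}) = rigid_size r i"
    and m: "block_over.merged cf blk M i j"
  shows "i = j"
proof -
  interpret block_over e cf blk class_index N M by fact
  have "infinite {j. class_index j = class_index i \<and> card (blk -` {j}) = card (blk -` {i})}"
    by (rule infinite_class) (simp add: sz rigid_size_def)
  then show ?thesis using m by (rule merged_rigid)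
qed

lemma rigid_maximal:
  assumes b: "block_space e cf blk class_index N" and sz: "\<And>i. card (blk -` {i}) = rigid_size r i"
  shows "maximal_renorming N"
  unfolding maximal_renorming_def
proof (intro conjI allI impI)
  show "equivalent_norm N" by (rule block_space.equiv[OF b])
  fix M assume "equivalent_norm M" and sub: "Isom N \<subseteq> Isom M"
  then have bo: "block_over e cf blk class_index N M"
    by (intro block_over.intro[OF b] block_over_axioms.intro)
  then have "Isom M \<subseteq> Isom N"
    by (rule block_over.Isom_subset_of_rigid) (use rigid_merged[OF bo sz] odd_size_inj in \<open>auto simp: sz rigid_size_def\<close>)
  with sub show "Isom N = Isom M" by blast
qed

lemma rigid_block_dims:
  assumes bo: "block_over e cf blk class_index N M" and sz: "\<And>i. card (blk -` {i}) = rigid_size r i"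
  shows "range (block_over.block_dims cf blk M) = range (odd_size r)"
proof -
  interpret block_over e cf blk class_index N M by fact
  have m: "merged i j \<longleftrightarrow> i = j" for i j using rigid_merged[OF bo sz] merged_refl by blast
  have "block_dims i = odd_size r (class_index i)" for i
    using block_dims_sum[of i] by (simp add: m sz rigid_size_def)
  then have "block_dims = (\<lambda>i. odd_size r (class_index i))" by (rule ext)
  moreover have "range (\<lambda>i. odd_size r (class_index i)) = odd_size r ` range class_index"
    unfolding image_image ..
  ultimately show ?thesis using surj_class_index by simp
qed

section \<open>Components of an arbitrary norm above the second family\<close>

context
  fixes e cf blk and N :: "'a::banach \<Rightarrow> real" and M r
  assumes bo: "block_over e cf blk class_index N M" and sz: "\<And>i. card (blk -` {i}) = loose_size r i"
begin

interpretation block_over e cf blk class_index N M by (rule bo)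

lemma loose_merged:
  assumes m: "merged i j" and i: "class_index i \<noteq> 0"
  shows "i = j"
proof -
  have "infinite {j. class_index j = class_index i \<and> card (blk -` {j}) = card (blk -` {i})}"
    by (rule infinite_class) (simp add: sz loose_size_def i)
  then show ?thesis using m by (rule merged_rigid)
qed

lemma loose_merged_class: "merged i j \<Longrightarrow> class_index i = 0 \<Longrightarrow> class_index j = 0"
  using loose_merged[of j i] merged_sym[of i j] by metis

lemma loose_finite: "finite {j. merged i j}"
proof (cases "class_index i = 0")
  case True
  then have "{j. merged i j} \<subseteq> {j. merged i j \<and> class_index j = 0}" using loose_merged_class by blast
  then show ?thesis using finite_merged_class finite_subset by blast
next
  case False
  then have "{j. merged i j} \<subseteq> {i}" using loose_merged by blast
  then show ?thesis using finite_subset by blast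
qed

lemma loose_dims_rigid: "class_index i \<noteq> 0 \<Longrightarrow> block_dims i = odd_size r (class_index i - 1)"
proof -
  assume i: "class_index i \<noteq> 0"
  then have "{j. merged i j} = {i}" using loose_merged merged_refl by blast
  then show ?thesis using block_dims_sum[OF loose_finite, of i] i by (simp add: sz loose_size_def)
qed

text \<open>The dimension is a sum of distinct powers of 2, whose binary digits, shifted by one
  place, name the blocks of the component.\<close>

lemma loose_dims_zero:
  assumes i: "class_index i = 0"
  shows "block_dims i = 2 * set_encode ((\<lambda>j. snd (prod_decode j)) ` {j. merged i j})"
proof -
  have c: "class_index j = 0" if "merged i j" for j using loose_merged_class[OF that i] .
  have "inj_on (\<lambda>j. snd (prod_decode j)) {j. merged i j}"
  proof (rule inj_onI)
    fix j k assume "j \<in> {j. merged i j}" "k \<in> {j. merged i j}" "snd (prod_decode j) = snd (prod_decode k)"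
    then have "prod_decode j = prod_decode k" using c by (auto simp: class_index_def prod_eq_iff)
    then show "j = k" by (metis prod_decode_inverse)
  qed
  then have "2 * set_encode ((\<lambda>j. snd (prod_decode j)) ` {j. merged i j}) = (\<Sum>j\<in>{j. merged i j}. 2 * 2 ^ snd (prod_decode j))"
    by (simp add: set_encode_def sum.reindex sum_distrib_left)
  also have "\<dots> = (\<Sum>j\<in>{j. merged i j}. card (blk -` {j}))"
    by (rule sum.cong) (auto simp: sz loose_size_def c)
  finally show ?thesis using block_dims_sum[OF loose_finite, of i] by simp
qed

lemma loose_block_dims: "range block_dims \<inter> {d. odd d} = range (odd_size r)" "\<exists>d\<in>range block_dims. even d"
proof -
  show "range block_dims \<inter> {d. odd d} = range (odd_size r)"
  proof
    show "range block_dims \<inter> {d. odd d} \<subseteq> range (odd_size r)"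
    proof
      fix d assume "d \<in> range block_dims \<inter> {d. odd d}"
      then obtain i where i: "d = block_dims i" "odd (block_dims i)" by auto
      have "class_index i \<noteq> 0"
      proof
        assume "class_index i = 0"
        then have "even (block_dims i)" by (simp add: loose_dims_zero)
        then show False using i(2) by simp
      qed
      then have "d = odd_size r (class_index i - 1)" unfolding i(1) by (rule loose_dims_rigid)
      then show "d \<in> range (odd_size r)" by (rule range_eqI)
    qed
    show "range (odd_size r) \<subseteq> range block_dims \<inter> {d. odd d}"
    proof
      fix d assume "d \<in> range (odd_size r)"
      then obtain k where k: "d = odd_size r k" by blast
      have "d = block_dims (prod_encode (Suc k, 0))"
        using loose_dims_rigid[of "prod_encode (Suc k, 0)"] by (simp add: class_index_encode k)
      then have "d \<in> range block_dims" by (rule range_eqI)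
      then show "d \<in> range block_dims \<inter> {d. odd d}" by (simp add: k odd_odd_size)
    qed
  qed
  have "even (block_dims (prod_encode (0, 0)))"
    using loose_dims_zero[of "prod_encode (0, 0)"] by (simp add: class_index_encode)
  then show "\<exists>d\<in>range block_dims. even d" by blast
qed

text \<open>The image is a component of the same dimension. Parity places it in the extra class, and
  the binary expansion shows that it contains block \<open>i\<close>.\<close>

lemma loose_component_fixed:
  assumes i: "class_index i = 0" and T: "T \<in> Isom M"
  shows "T ` F i = F i"
proof -
  obtain j where j: "T ` F i = F j" "block_dims i = block_dims j"
    using Isom_permutes_components[OF loose_finite T] by blast
  have j0: "class_index j = 0"
  proof (rule ccontr)
    assume "class_index j \<noteq> 0"
    then have "odd (block_dims j)" by (simp add: loose_dims_rigid odd_odd_size)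
    moreover have "even (block_dims i)" by (simp add: loose_dims_zero[OF i])
    ultimately show False by (simp add: j(2))
  qed
  have "set_encode ((\<lambda>j. snd (prod_decode j)) ` {k. merged i k}) = set_encode ((\<lambda>j. snd (prod_decode j)) ` {k. merged j k})"
    using j(2) loose_dims_zero[OF i] loose_dims_zero[OF j0] by simp
  then have "(\<lambda>j. snd (prod_decode j)) ` {k. merged i k} = (\<lambda>j. snd (prod_decode j)) ` {k. merged j k}"
    using loose_finite by (subst (asm) set_encode_eq) auto
  then have "snd (prod_decode i) \<in> (\<lambda>j. snd (prod_decode j)) ` {k. merged j k}"
    using merged_refl[of i] by blast
  then obtain k where k: "merged j k" "snd (prod_decode i) = snd (prod_decode k)" by blast
  have "class_index k = 0" using loose_merged_class[OF k(1) j0] .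
  then have "prod_decode i = prod_decode k" using k(2) i by (simp add: class_index_def prod_eq_iff)
  then have "i = k" by (metis prod_decode_inverse)
  then have "F j = F i" using F_eq[OF loose_finite] k(1) by blast
  then show ?thesis using j(1) by simp
qed

lemma loose_enlargeable: "\<exists>M'. equivalent_norm M' \<and> Isom M \<subset> Isom M'"
proof -
  define i1 where "i1 = prod_encode (0, 0)"
  \<comment> \<open>The trivial equation only fits the form of \<open>infinite_class\<close>, with a
    constant function; an infinite class contains a block outside the finite component of
    \<open>i1\<close>.\<close>
  have "infinite {j. class_index j = 0 \<and> (0::nat) = 0}" by (rule infinite_class) simp
  then have "infinite ({j. class_index j = 0 \<and> (0::nat) = 0} - {j. merged i1 j})"
    using loose_finite[of i1] by (rule Diff_infinite_finite[rotated])
  then obtain i2 where i2: "class_index i2 = 0" "\<not> merged i1 i2"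
    using infinite_imp_nonempty by blast
  have i1: "class_index i1 = 0" by (simp add: i1_def class_index_encode)
  show ?thesis
    by (rule enlargeable[OF loose_finite i2(2) loose_component_fixed[OF i1] loose_component_fixed[OF i2(1)]])
qed

end

lemma conjugate_refl: "conjugate_subgroups (Isom N) (Isom (N :: 'a::real_normed_vector \<Rightarrow> real))"
  unfolding conjugate_subgroups_def
proof
  show one: "\<one>\<^bsub>GL\<^esub> \<in> carrier (GL :: ('a \<Rightarrow> 'a) monoid)"
    using group.is_monoid[OF group_GL] by (rule monoid.one_closed)
  have "inv\<^bsub>GL\<^esub> \<one>\<^bsub>GL\<^esub> = (\<one>\<^bsub>GL\<^esub> :: 'a \<Rightarrow> 'a)" using group.is_monoid[OF group_GL] by (rule monoid.inv_one)
  then show "Isom N = (\<lambda>h. inv\<^bsub>GL\<^esub> \<one>\<^bsub>GL\<^esub> \<otimes>\<^bsub>GL\<^esub> h \<otimes>\<^bsub>GL\<^esub> \<one>\<^bsub>GL\<^esub>) ` Isom N"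
    by (simp add: GL_def)
qed

theorem theorem4p6:
  fixes u :: "nat \<Rightarrow> 'a::banach"
  assumes "universal_unconditional_basis u"
  shows "\<exists>\<A> \<B> :: ('a \<Rightarrow> real) set.
           \<A> \<approx> (UNIV :: real set) \<and> \<B> \<approx> (UNIV :: real set) \<and>
           (\<forall>N\<in>\<A> \<union> \<B>. equivalent_norm N) \<and>
           pairwise (\<lambda>N M. \<not> conjugate_subgroups (Isom N) (Isom M)) (\<A> \<union> \<B>) \<and>
           (\<forall>N\<in>\<A>. maximal_renorming N) \<and>
           (\<forall>N\<in>\<B>. \<not> (\<exists>G. maximal_bounded_subgroup G \<and> Isom N \<subseteq> G))"
proof -
  have ex: "\<exists>(e :: real \<Rightarrow> nat \<Rightarrow> 'a) cf blk N.
      \<forall>r. block_space (e r) (cf r) (blk r) class_index (N r) \<and> (\<forall>i. card (blk r -` {i}) = n r i)"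
    if n: "\<And>r i. 2 \<le> n r i" for n
  proof -
    \<comment> \<open>All witnesses for a parameter are packed into one tuple, so that a single
      choice gives functions of \<open>r\<close>.\<close>
    define realizes :: "real \<Rightarrow> (nat \<Rightarrow> 'a) \<times> (nat \<Rightarrow> 'a \<Rightarrow> real) \<times> (nat \<Rightarrow> nat) \<times> ('a \<Rightarrow> real) \<Rightarrow> bool"
      where "realizes = (\<lambda>r (e, cf, blk, N). block_space e cf blk class_index N \<and> (\<forall>i. card (blk -` {i}) = n r i))"
    have "\<exists>x. realizes r x" for r
    proof -
      have pos: "n r i > 0" for i using n[of r i] by simp
      obtain blk :: "nat \<Rightarrow> nat" where blk: "\<And>i. finite (blk -` {i})" "\<And>i. card (blk -` {i}) = n r i"
        using ex_fibres_of_size[of "n r", OF pos] by blast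
      have "block_data u blk class_index"
        by (rule block_data.intro) (use assms blk n surj_class_index in simp_all)
      then obtain e :: "nat \<Rightarrow> 'a" and cf N where "block_space e cf blk class_index N"
        by (rule block_data.block_space_exists)
      then have "realizes r (e, cf, blk, N)" using blk(2) by (simp add: realizes_def)
      then show ?thesis by (rule exI)
    qed
    then have "\<forall>r. \<exists>x. realizes r x" ..
    from choice[OF this] obtain x where x: "\<And>r. realizes r (x r)" by blast
    show ?thesis
      by (rule exI[of _ "\<lambda>r. fst (x r)"], rule exI[of _ "\<lambda>r. fst (snd (x r))"],
          rule exI[of _ "\<lambda>r. fst (snd (snd (x r)))"], rule exI[of _ "\<lambda>r. snd (snd (snd (x r)))"])
         (use x in \<open>simp add: realizes_def case_prod_beta\<close>)
  qed
  have "2 \<le> rigid_size r i" for r i by (simp add: rigid_size_def odd_size_def)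
  from ex[of rigid_size, OF this] obtain ea :: "real \<Rightarrow> nat \<Rightarrow> 'a" and ca ba A where
    A: "block_space (ea r) (ca r) (ba r) class_index (A r)" "card (ba r -` {i}) = rigid_size r i" for r i by blast
  have "2 \<le> loose_size r i" for r i by (simp add: loose_size_def odd_size_def)
  from ex[of loose_size, OF this] obtain eb :: "real \<Rightarrow> nat \<Rightarrow> 'a" and cb bb B where
    B: "block_space (eb r) (cb r) (bb r) class_index (B r)" "card (bb r -` {i}) = loose_size r i" for r i by blast
  have over: "block_over e cf blk class_index N N" if "block_space e cf blk class_index N"
    for e :: "nat \<Rightarrow> 'a" and cf blk N
    using block_space.equiv[OF that] by (intro block_over.intro[OF that] block_over_axioms.intro) auto
  note Ao = over[OF A(1)] and Bo = over[OF B(1)]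
  have finA: "finite {j. block_over.merged (ca r) (ba r) (A r) i j}" for r i
    by (rule finite_subset[of _ "{i}"]) (auto dest: rigid_merged[OF Ao A(2)])
  note finB = loose_finite[OF Bo B(2)]
  define dA where "dA = (\<lambda>r. range (block_over.block_dims (ca r) (ba r) (A r)))"
  define dB where "dB = (\<lambda>r. range (block_over.block_dims (cb r) (bb r) (B r)))"
  have dA: "dA r = range (odd_size r)" for r unfolding dA_def by (rule rigid_block_dims[OF Ao A(2)])
  have dB: "dB r \<inter> {d. odd d} = range (odd_size r)" "\<exists>d\<in>dB r. even d" for r
    unfolding dB_def by (rule loose_block_dims[OF Bo B(2)])+
  have dAB: "dA r \<noteq> dB s" for r s
  proof
    assume "dA r = dB s"
    then obtain d where "d \<in> range (odd_size r)" "even d" using dB(2)[of s] unfolding dA[symmetric] by auto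
    then show False using odd_odd_size by auto
  qed
  have AA: "r = s" if "conjugate_subgroups (Isom (A r)) (Isom (A s))" for r s
  proof -
    have "dA r = dA s" using conjugate_block_dims[OF Ao Ao finA finA that] by (simp add: dA_def)
    then have "range (odd_size r) = range (odd_size s)" by (simp add: dA)
    then show ?thesis by (rule range_odd_size_inj)
  qed
  have BB: "r = s" if "conjugate_subgroups (Isom (B r)) (Isom (B s))" for r s
  proof -
    have "dB r = dB s" using conjugate_block_dims[OF Bo Bo finB finB that] by (simp add: dB_def)
    then have "range (odd_size r) = range (odd_size s)" using dB(1)[of r] dB(1)[of s] by simp
    then show ?thesis by (rule range_odd_size_inj)
  qed
  have AB: "\<not> conjugate_subgroups (Isom (A r)) (Isom (B s))" for r s
  proof
    assume "conjugate_subgroups (Isom (A r)) (Isom (B s))"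
    from conjugate_block_dims[OF Ao Bo finA finB this] have "dA r = dB s" by (simp add: dA_def dB_def)
    with dAB show False ..
  qed
  have BA: "\<not> conjugate_subgroups (Isom (B s)) (Isom (A r))" for r s
  proof
    assume "conjugate_subgroups (Isom (B s)) (Isom (A r))"
    from conjugate_block_dims[OF Bo Ao finB finA this] have "dA r = dB s" by (simp add: dA_def dB_def)
    with dAB show False ..
  qed
  \<comment> \<open>Equal norms have conjugate groups, so the conjugacy invariant also separates the
    parameters and gives both families the cardinality of the reals.\<close>
  have "inj A" by (rule injI, rule AA) (simp add: conjugate_refl)
  moreover have "inj B" by (rule injI, rule BB) (simp add: conjugate_refl)
  ultimately have card: "range A \<approx> (UNIV :: real set)" "range B \<approx> (UNIV :: real set)"
    by (simp_all add: inj_on_image_eqpoll_self)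
  have nonmax: "\<not> (\<exists>G. maximal_bounded_subgroup G \<and> Isom (B r) \<subseteq> G)" for r
  proof
    assume "\<exists>G. maximal_bounded_subgroup G \<and> Isom (B r) \<subseteq> G"
    then obtain G where G: "maximal_bounded_subgroup G" "Isom (B r) \<subseteq> G" by blast
    obtain M where M: "equivalent_norm M" "G = Isom M" by (rule maximal_bounded_subgroup_is_Isom[OF G(1)])
    \<comment> \<open>The norm of the hypothetical maximal group lies above \<open>B r\<close>, so
      its isometry group can be enlarged.\<close>
    have "block_over (eb r) (cb r) (bb r) class_index (B r) M"
      using M G(2) by (intro block_over.intro[OF B(1)] block_over_axioms.intro) auto
    from loose_enlargeable[OF this B(2)]
    obtain M' where M': "equivalent_norm M'" "Isom M \<subset> Isom M'" by blast
    have "\<not> G \<subset> Isom M'"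
      using G(1) bounded_subgroup_Isom[OF M'(1)] by (simp add: maximal_bounded_subgroup_def)
    then show False using M'(2) M(2) by simp
  qed
  show ?thesis
  proof (intro exI conjI)
    show "\<forall>N\<in>range A \<union> range B. equivalent_norm N"
      using block_space.equiv[OF A(1)] block_space.equiv[OF B(1)] by auto
    show "pairwise (\<lambda>N M. \<not> conjugate_subgroups (Isom N) (Isom M)) (range A \<union> range B)"
      by (rule pairwiseI) (auto dest: AA BB simp: AB BA)
    show "\<forall>N\<in>range A. maximal_renorming N" by (auto intro: rigid_maximal[OF A])
    show "\<forall>N\<in>range B. \<not> (\<exists>G. maximal_bounded_subgroup G \<and> Isom N \<subseteq> G)"
      using nonmax by auto
  qed (rule card)+
qed

end
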